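(* Let $(\mathfrak h,\dot\rho,\delta)$ be a Lie $\mathfrak g$-quasi-bialgebra and let $H^*$ be the 1-connected $\mathfrak g$-quasi-Poisson Lie group integrating its dual Lie $\mathfrak g$-quasi-bialgebra $\mathfrak h^*$. Let $(M,\rho_M,\pi_M)$ be a $\mathfrak g$-quasi-Poisson manifold. If $$\mu:M\to H^*$$ is a $\mathfrak g$-quasi-Poisson map, then the map $$\psi:\mathfrak h\to\Gamma(TM),\qquad\psi(X)=-\mathsf a_+(\mu^*X^L)$$ is a $\mathfrak g$-quasi-Poisson action of $\mathfrak h$ on $M$. Here, for $X\in\mathfrak h=(\mathfrak h^* )^*$, $X^L$ denotes the corresponding left-invariant 1-form on $H^*$, and $\mathsf a_+:T^*M\to TM$ is given by $\mathsf a_+(\alpha)=\sigma(\alpha,\cdot)$ with $\sigma:=\pi_M+\frac12\rho_M(t)\in\Gamma(T^{\otimes2}M)$.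
   Context: Real finite-dimensional setting; summation convention; $a\wedge b=a\otimes b-b\otimes a$. $\mathfrak g$ is a Lie algebra with a non-degenerate $t=t^{ij}e_i\otimes e_j\in(S^2\mathfrak g)^{\mathfrak g}$, and $\rho_M(t)=t^{ij}\rho_M(e_i)\otimes\rho_M(e_j)$. Let $\phi\in\bigwedge^3\mathfrak g$ be $\phi(\alpha,\beta,\gamma)=\frac14\alpha([t^\sharp\beta,t^\sharp\gamma])$ for $\alpha,\beta,\gamma\in\mathfrak g^*$, where $t^\sharp:\mathfrak g^*\to\mathfrak g$ is induced by $t$. A $\mathfrak g$-quasi-Poisson manifold is a smooth manifold $M$ with an action $\rho$ of $\mathfrak g$ (a Lie algebra homomorphism $\rho:\mathfrak g\to\Gamma(TM)$, extended to $\bigwedge\mathfrak g\to\Gamma(\bigwedge TM)$) and a $\mathfrak g$-invariant bivector field $\pi$ with $[\pi,\pi]/2=\rho(\phi)$, where $[\,,]$ is the Schouten bracket, normalized so that $[X,\cdot]=\mathcal L_X$ for vector fields $X$ and $[X_1\wedge X_2,Y_1\wedge Y_2]=\sum_{i,j}(-1)^{i+j}[X_i,Y_j]\wedge X_{\hat i}\wedge Y_{\hat j}$ (with $X_{\hat i}$ the remaining factor). A map is $\mathfrak g$-quasi-Poisson if it is $\mathfrak g$-equivariant and pushes $\pi_1$ forward to $\pi_2$. The fusion product $M_1\circledast M_2$ is $M_1\times M_2$ with the diagonal action and the bivector field $\pi_1+\pi_2-\frac12t^{ij}\rho_1(e_i)\wedge\rho_2(e_j)$. A $\mathfrak g$-quasi-Poisson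 Lie group is a Lie group $H$ with a $\mathfrak g$-quasi-Poisson structure $(\rho,\pi)$ such that the multiplication $H\circledast H\to H$ is $\mathfrak g$-quasi-Poisson. Its Lie algebra $\mathfrak h$ becomes a Lie $\mathfrak g$-quasi-bialgebra with $(\dot\rho(u)X)^L=[\rho(u),X^L]$ and $\delta(X)=[X^L,\pi]|_1$ ($X^L$ = left-invariant vector field). A Lie $\mathfrak g$-quasi-bialgebra is a triple $(\mathfrak h,\dot\rho,\delta)$ where $\mathfrak h$ is a Lie algebra, $\dot\rho$ is an action of $\mathfrak g$ on $\mathfrak h$ by derivations, and $\delta:\mathfrak h\to\bigwedge^2\mathfrak h$ is a $\mathfrak g$-invariant Lie cobracket (its transpose is a Lie bracket) with $\operatorname{ad}^{(2)}_X\delta(Y)-\operatorname{ad}^{(2)}_Y\delta(X)-\delta([X,Y])-t^{ij}\dot\rho(e_i)(X)\wedge\dot\rho(e_j)(Y)=0$ for all $X,Y\in\mathfrak h$, where $\operatorname{ad}^{(2)}_X=\operatorname{ad}_X\otimes1+1\otimes\operatorname{ad}_X$. A Manin quadruple $(\mathfrak d,\mathfrak a,\mathfrak b,\mathfrak c)$ is a Lie algebra $\mathfrak d$ with an invariant non-degenerate symmetric pairing $\langle\,,\rangle$ and Lie subalgebras $\mathfrak a,\mathfrak b,\mathfrak c$ with $\mathfrak d=\mathfrak a\oplus\mathfrak b\oplus\mathfrak c$, $\mathfrak a^\perp=\mathfrak a\oplus\mathfrak b$, $\mathfrak c^\perp=\mathfrak b\oplus\mathfrak c$. Lie $\mathfrak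 g$-quasi-bialgebras correspond to Manin quadruples $(\mathfrak d,\mathfrak h,\mathfrak g,\mathfrak h^* )$ (with $\langle\,,\rangle|_{\mathfrak g}$ the inverse of $t$ and the third subalgebra identified with the dual of $\mathfrak h$ via $\langle\,,\rangle$) by $\dot\rho(v)X=[v,X]$ and $\langle\delta(X),A\otimes B\rangle=\langle X,[B,A]\rangle$ for $v\in\mathfrak g$, $X\in\mathfrak h$, $A,B\in\mathfrak h^*$. The dual Lie $\mathfrak g$-quasi-bialgebra of $\mathfrak h$ is $\mathfrak h^*$ with the structure coming in the same way from the Manin quadruple $(\mathfrak d,\mathfrak h^*,\mathfrak g,\mathfrak h)$. Every Lie $\mathfrak g$-quasi-bialgebra integrates to a unique $\mathfrak g$-quasi-Poisson Lie group structure on the corresponding 1-connected Lie group; $H^*$ is the one integrating $\mathfrak h^*$. An action $\psi$ of $\mathfrak h$ on $M$ (a Lie algebra homomorphism $\psi:\mathfrak h\to\Gamma(TM)$, extended to $\bigwedge\mathfrak h\to\Gamma(\bigwedge TM)$) is called $\mathfrak g$-quasi-Poisson if it is $\mathfrak g$-equivariant, i.e. $\psi(\dot\rho(u)X)=[\rho_M(u),\psi(X)]$, and for every $X\in\mathfrak h$ $$[\psi(X),\pi_M]=-\psi(\delta(X))+\tfrac12t^{ij}\,\psi(\dot\rho(e_i)X)\wedge\rho_M(e_j).$$ *)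

theory Defs
  imports "HOL-Analysis.Analysis"
begin

section \<open>Linear algebra\<close>

definition fin_dim :: "'a::real_vector set \<Rightarrow> bool" where
  "fin_dim S \<longleftrightarrow> (\<exists>B. finite B \<and> S \<subseteq> span B)"

text \<open>All normed spaces below are assumed finite-dimensional (dimension 0 is allowed, which is why
  \<open>euclidean_space\<close> is not used).  Then \<open>'a \<Rightarrow>\<^sub>L real\<close> is the full dual space, and
  \<open>V \<otimes> V\<close> is the space of bilinear forms on the dual of \<open>V\<close>.\<close>

type_synonym 'a tensor2 = "('a \<Rightarrow>\<^sub>L real) \<Rightarrow>\<^sub>L ('a \<Rightarrow>\<^sub>L real) \<Rightarrow>\<^sub>L real"

definition tens :: "'a \<Rightarrow> 'a \<Rightarrow> 'a::real_normed_vector tensor2" where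
  "tens a b = Blinfun (\<lambda>\<alpha>. Blinfun (\<lambda>\<beta>. blinfun_apply \<alpha> a * blinfun_apply \<beta> b))"

definition wedge :: "'a \<Rightarrow> 'a \<Rightarrow> 'a::real_normed_vector tensor2" where
  "wedge a b = tens a b - tens b a"

definition wedge3 :: "'a \<Rightarrow> 'a \<Rightarrow> 'a \<Rightarrow>
    ('a::real_normed_vector \<Rightarrow>\<^sub>L real) \<Rightarrow> ('a \<Rightarrow>\<^sub>L real) \<Rightarrow> ('a \<Rightarrow>\<^sub>L real) \<Rightarrow> real" where
  "wedge3 a b c \<alpha> \<beta> \<gamma> =
     blinfun_apply \<alpha> a * (blinfun_apply \<beta> b * blinfun_apply \<gamma> c - blinfun_apply \<beta> c * blinfun_apply \<gamma> b)
   + blinfun_apply \<alpha> b * (blinfun_apply \<beta> c * blinfun_apply \<gamma> a - blinfun_apply \<beta> a * blinfun_apply \<gamma> c)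
   + blinfun_apply \<alpha> c * (blinfun_apply \<beta> a * blinfun_apply \<gamma> b - blinfun_apply \<beta> b * blinfun_apply \<gamma> a)"

definition skew :: "'a::real_normed_vector tensor2 \<Rightarrow> bool" where
  "skew T \<longleftrightarrow> (\<forall>\<alpha> \<beta>. blinfun_apply (blinfun_apply T \<alpha>) \<beta> = - blinfun_apply (blinfun_apply T \<beta>) \<alpha>)"

text \<open>\<open>tmap2 L1 L2\<close> is \<open>L1 \<otimes> L2\<close>, and \<open>act2 L\<close> is \<open>L \<otimes> 1 + 1 \<otimes> L\<close>.\<close>

definition tmap2 :: "('a::real_normed_vector \<Rightarrow>\<^sub>L 'b::real_normed_vector) \<Rightarrow> ('a \<Rightarrow>\<^sub>L 'b) \<Rightarrow>
    'a tensor2 \<Rightarrow> 'b tensor2" where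
  "tmap2 L1 L2 T =
     Blinfun (\<lambda>\<alpha>. Blinfun (\<lambda>\<beta>. blinfun_apply (blinfun_apply T (\<alpha> o\<^sub>L L1)) (\<beta> o\<^sub>L L2)))"

definition act2 :: "('a::real_normed_vector \<Rightarrow>\<^sub>L 'a) \<Rightarrow> 'a tensor2 \<Rightarrow> 'a tensor2" where
  "act2 L T = tmap2 L id_blinfun T + tmap2 id_blinfun L T"

text \<open>The vector \<open>T(\<alpha>, \<cdot>)\<close>, using that a finite-dimensional space is its own double dual.\<close>

definition contract :: "'a::real_normed_vector tensor2 \<Rightarrow> ('a \<Rightarrow>\<^sub>L real) \<Rightarrow> 'a" where
  "contract T \<alpha> = (THE v. \<forall>\<beta>. blinfun_apply \<beta> v = blinfun_apply (blinfun_apply T \<alpha>) \<beta>)"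

lemma tens_apply:
  fixes a b :: "'a::real_normed_vector"
  shows "blinfun_apply (blinfun_apply (tens a b) \<alpha>) \<beta> = blinfun_apply \<alpha> a * blinfun_apply \<beta> b"
proof -
  have inner: "bounded_linear (\<lambda>\<beta>. blinfun_apply \<alpha> a * blinfun_apply \<beta> b)" for \<alpha> :: "'a \<Rightarrow>\<^sub>L real"
    by (rule bounded_linear_const_mult[OF blinfun.bounded_linear_left])
  have eq: "Blinfun (\<lambda>\<beta>. blinfun_apply \<alpha> a * blinfun_apply \<beta> b)
      = blinfun_apply \<alpha> a *\<^sub>R Blinfun (\<lambda>\<beta>. blinfun_apply \<beta> b)" for \<alpha> :: "'a \<Rightarrow>\<^sub>L real"
    by (rule blinfun_eqI)
      (simp add: bounded_linear_Blinfun_apply[OF inner] scaleR_blinfun.rep_eq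
        bounded_linear_Blinfun_apply[OF blinfun.bounded_linear_left])
  have "bounded_linear (\<lambda>\<alpha>::'a \<Rightarrow>\<^sub>L real. Blinfun (\<lambda>\<beta>. blinfun_apply \<alpha> a * blinfun_apply \<beta> b))"
    unfolding eq by (rule bounded_linear_compose[OF bounded_linear_scaleR_left blinfun.bounded_linear_left])
  then show ?thesis
    by (simp add: tens_def bounded_linear_Blinfun_apply inner)
qed

lemma tmap2_apply:
  fixes L1 L2 :: "'a::real_normed_vector \<Rightarrow>\<^sub>L 'b::real_normed_vector"
  shows "blinfun_apply (blinfun_apply (tmap2 L1 L2 T) \<alpha>) \<beta>
    = blinfun_apply (blinfun_apply T (\<alpha> o\<^sub>L L1)) (\<beta> o\<^sub>L L2)"
proof -
  have pre: "bounded_linear (\<lambda>\<alpha>::'b \<Rightarrow>\<^sub>L real. \<alpha> o\<^sub>L L)" for L :: "'a \<Rightarrow>\<^sub>L 'b"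
    by (rule bounded_bilinear.bounded_linear_left[OF bounded_bilinear_blinfun_compose])
  have inner: "bounded_linear (\<lambda>\<beta>. blinfun_apply (blinfun_apply T (\<alpha> o\<^sub>L L1)) (\<beta> o\<^sub>L L2))" for \<alpha>
    using bounded_linear_compose[OF blinfun.bounded_linear_right pre] .
  have eq: "Blinfun (\<lambda>\<beta>. blinfun_apply (blinfun_apply T (\<alpha> o\<^sub>L L1)) (\<beta> o\<^sub>L L2))
      = blinfun_apply T (\<alpha> o\<^sub>L L1) o\<^sub>L Blinfun (\<lambda>\<beta>. \<beta> o\<^sub>L L2)" for \<alpha>
    by (rule blinfun_eqI)
      (simp add: bounded_linear_Blinfun_apply[OF inner] bounded_linear_Blinfun_apply[OF pre])
  have "bounded_linear (\<lambda>\<alpha>. blinfun_apply T (\<alpha> o\<^sub>L L1) o\<^sub>L Blinfun (\<lambda>\<beta>. \<beta> o\<^sub>L L2))"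
    using bounded_linear_compose[OF
        bounded_bilinear.bounded_linear_left[OF bounded_bilinear_blinfun_compose]
        bounded_linear_compose[OF blinfun.bounded_linear_right pre]] .
  then show ?thesis
    by (simp add: tmap2_def bounded_linear_Blinfun_apply inner eq[symmetric])
qed


section \<open>Lie algebras\<close>

definition lie_algebra :: "('a::real_vector \<Rightarrow> 'a \<Rightarrow> 'a) \<Rightarrow> bool" where
  "lie_algebra br \<longleftrightarrow>
     fin_dim (UNIV :: 'a set) \<and> bilinear br \<and> (\<forall>x. br x x = 0) \<and>
     (\<forall>x y z. br x (br y z) + br y (br z x) + br z (br x y) = 0)"

text \<open>A Lie algebra with bracket \<open>gbr\<close>, a basis \<open>e\<^sub>i\<close> for \<open>i < gdim\<close>, and the coefficients
  \<open>t\<^sup>i\<^sup>j\<close> of a tensor \<open>t = t\<^sup>i\<^sup>j e\<^sub>i \<otimes> e\<^sub>j\<close>.\<close>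

record 'g quad_lie =
  gbr :: "'g \<Rightarrow> 'g \<Rightarrow> 'g"
  gdim :: nat
  gbasis :: "nat \<Rightarrow> 'g"
  gcoef :: "nat \<Rightarrow> nat \<Rightarrow> real"

text \<open>\<open>tsum G F\<close> is \<open>t\<^sup>i\<^sup>j F(e\<^sub>i, e\<^sub>j)\<close>.\<close>

definition tsum :: "'g quad_lie \<Rightarrow> ('g \<Rightarrow> 'g \<Rightarrow> 'b::real_vector) \<Rightarrow> 'b" where
  "tsum G F = (\<Sum>i<gdim G. \<Sum>j<gdim G. gcoef G i j *\<^sub>R F (gbasis G i) (gbasis G j))"

definition tsharp :: "'g::real_vector quad_lie \<Rightarrow> ('g \<Rightarrow> real) \<Rightarrow> 'g" where
  "tsharp G \<alpha> = tsum G (\<lambda>a b. \<alpha> a *\<^sub>R b)"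

definition quadratic_lie_algebra :: "'g::real_vector quad_lie \<Rightarrow> bool" where
  "quadratic_lie_algebra G \<longleftrightarrow>
     lie_algebra (gbr G) \<and>
     inj_on (gbasis G) {..<gdim G} \<and> independent (gbasis G ` {..<gdim G}) \<and>
     span (gbasis G ` {..<gdim G}) = UNIV \<and>
     (\<forall>i<gdim G. \<forall>j<gdim G. gcoef G i j = gcoef G j i) \<and>
     (\<forall>u \<alpha> \<beta>. linear \<alpha> \<longrightarrow> linear \<beta> \<longrightarrow>
        tsum G (\<lambda>a b. \<alpha> (gbr G u a) * \<beta> b + \<alpha> a * \<beta> (gbr G u b)) = (0::real)) \<and>
     bij_betw (tsharp G) {\<alpha>. linear \<alpha>} UNIV"

definition phi :: "'g::real_vector quad_lie \<Rightarrow> ('g \<Rightarrow> real) \<Rightarrow> ('g \<Rightarrow> real) \<Rightarrow> ('g \<Rightarrow> real) \<Rightarrow> real" where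
  "phi G \<alpha> \<beta> \<gamma> = \<alpha> (gbr G (tsharp G \<beta>) (tsharp G \<gamma>)) / 4"

text \<open>The bracket on the dual which is the transpose of a map \<open>\<delta> : V \<rightarrow> V \<otimes> V\<close>.\<close>

definition cobracket_transpose ::
    "('h::real_normed_vector \<Rightarrow> 'h tensor2) \<Rightarrow> ('h \<Rightarrow>\<^sub>L real) \<Rightarrow> ('h \<Rightarrow>\<^sub>L real) \<Rightarrow> ('h \<Rightarrow>\<^sub>L real)" where
  "cobracket_transpose \<delta> \<alpha> \<beta> = Blinfun (\<lambda>X. blinfun_apply (blinfun_apply (\<delta> X) \<alpha>) \<beta>)"

definition lie_quasi_bialgebra :: "'g::real_vector quad_lie \<Rightarrow>
    ('h::real_normed_vector \<Rightarrow> 'h \<Rightarrow> 'h) \<Rightarrow> ('g \<Rightarrow> 'h \<Rightarrow> 'h) \<Rightarrow> ('h \<Rightarrow> 'h tensor2) \<Rightarrow> bool" where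
  "lie_quasi_bialgebra G br dr \<delta> \<longleftrightarrow>
     lie_algebra br \<and>
     bilinear dr \<and>
     (\<forall>u v X. dr (gbr G u v) X = dr u (dr v X) - dr v (dr u X)) \<and>
     (\<forall>u X Y. dr u (br X Y) = br (dr u X) Y + br X (dr u Y)) \<and>
     linear \<delta> \<and> (\<forall>X. skew (\<delta> X)) \<and>
     (\<forall>u X. \<delta> (dr u X) = act2 (Blinfun (dr u)) (\<delta> X)) \<and>
     lie_algebra (cobracket_transpose \<delta>) \<and>
     (\<forall>X Y. act2 (Blinfun (br X)) (\<delta> Y) - act2 (Blinfun (br Y)) (\<delta> X) - \<delta> (br X Y)
        - tsum G (\<lambda>a b. wedge (dr a X) (dr b Y)) = 0)"

definition manin_quadruple :: "('d::real_vector \<Rightarrow> 'd \<Rightarrow> 'd) \<Rightarrow> ('d \<Rightarrow> 'd \<Rightarrow> real) \<Rightarrow>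
    'd set \<Rightarrow> 'd set \<Rightarrow> 'd set \<Rightarrow> bool" where
  "manin_quadruple br pr a b c \<longleftrightarrow>
     lie_algebra br \<and>
     bilinear pr \<and> (\<forall>x y. pr x y = pr y x) \<and>
     (\<forall>x. (\<forall>y. pr x y = 0) \<longrightarrow> x = 0) \<and>
     (\<forall>x y z. pr (br x y) z = pr x (br y z)) \<and>
     (\<forall>s\<in>{a, b, c}. subspace s \<and> (\<forall>x\<in>s. \<forall>y\<in>s. br x y \<in> s)) \<and>
     (\<forall>x. \<exists>!(u, v, w). u \<in> a \<and> v \<in> b \<and> w \<in> c \<and> x = u + v + w) \<and>
     {x. \<forall>y\<in>a. pr x y = 0} = {u + v |u v. u \<in> a \<and> v \<in> b} \<and>
     {x. \<forall>y\<in>c. pr x y = 0} = {v + w |v w. v \<in> b \<and> w \<in> c}"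

text \<open>The Manin quadruple \<open>(\<dd>, \<aa>, \<gg>, \<cc>)\<close>, with \<open>\<aa>\<close>, \<open>\<gg>\<close>, \<open>\<cc>\<close> embedded by \<open>ia\<close>, \<open>ig\<close>, \<open>ic\<close>,
  corresponds to the structure \<open>(br, dr, \<delta>)\<close> on \<open>\<aa>\<close>.  Elements \<open>A\<close> of \<open>\<cc>\<close> act as functionals on
  \<open>\<aa>\<close> through the pairing.\<close>

definition manin_corresponds :: "'g::real_vector quad_lie \<Rightarrow>
    ('d::real_vector \<Rightarrow> 'd \<Rightarrow> 'd) \<Rightarrow> ('d \<Rightarrow> 'd \<Rightarrow> real) \<Rightarrow>
    ('a::real_normed_vector \<Rightarrow> 'd) \<Rightarrow> ('g \<Rightarrow> 'd) \<Rightarrow> ('c::real_vector \<Rightarrow> 'd) \<Rightarrow>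
    ('a \<Rightarrow> 'a \<Rightarrow> 'a) \<Rightarrow> ('g \<Rightarrow> 'a \<Rightarrow> 'a) \<Rightarrow> ('a \<Rightarrow> 'a tensor2) \<Rightarrow> bool" where
  "manin_corresponds G brd pr ia ig ic br dr \<delta> \<longleftrightarrow>
     manin_quadruple brd pr (range ia) (range ig) (range ic) \<and>
     linear ia \<and> inj ia \<and> linear ig \<and> inj ig \<and> linear ic \<and> inj ic \<and>
     (\<forall>X Y. ia (br X Y) = brd (ia X) (ia Y)) \<and>
     (\<forall>u v. ig (gbr G u v) = brd (ig u) (ig v)) \<and>
     (\<forall>u. tsharp G (\<lambda>v. pr (ig v) (ig u)) = u) \<and>
     (\<forall>v X. ia (dr v X) = brd (ig v) (ia X)) \<and>
     (\<forall>X A B. blinfun_apply (blinfun_apply (\<delta> X) (Blinfun (\<lambda>Y. pr (ic A) (ia Y))))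
          (Blinfun (\<lambda>Y. pr (ic B) (ia Y))) = pr (ia X) (brd (ic B) (ic A)))"

text \<open>\<open>(brs, drs, \<delta>s)\<close> on the dual of \<open>'h\<close> is the dual of \<open>(br, dr, \<delta>)\<close>: one and the same
  \<open>\<dd> = \<hh> \<oplus> \<gg> \<oplus> \<hh>\<^sup>*\<close> corresponds to the latter as \<open>(\<dd>, \<hh>, \<gg>, \<hh>\<^sup>*)\<close> and to the former as
  \<open>(\<dd>, \<hh>\<^sup>*, \<gg>, \<hh>)\<close>, the pairing of \<open>\<hh>\<close> and \<open>\<hh>\<^sup>*\<close> being evaluation.\<close>

definition dual_lie_quasi_bialgebra :: "'g::real_vector quad_lie \<Rightarrow>
    ('h::real_normed_vector \<Rightarrow> 'h \<Rightarrow> 'h) \<Rightarrow> ('g \<Rightarrow> 'h \<Rightarrow> 'h) \<Rightarrow> ('h \<Rightarrow> 'h tensor2) \<Rightarrow>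
    (('h \<Rightarrow>\<^sub>L real) \<Rightarrow> ('h \<Rightarrow>\<^sub>L real) \<Rightarrow> ('h \<Rightarrow>\<^sub>L real)) \<Rightarrow> ('g \<Rightarrow> ('h \<Rightarrow>\<^sub>L real) \<Rightarrow> ('h \<Rightarrow>\<^sub>L real)) \<Rightarrow>
    (('h \<Rightarrow>\<^sub>L real) \<Rightarrow> ('h \<Rightarrow>\<^sub>L real) tensor2) \<Rightarrow> bool" where
  "dual_lie_quasi_bialgebra G br dr \<delta> brs drs \<delta>s \<longleftrightarrow>
     (\<exists>(brd :: 'h \<times> 'g \<times> ('h \<Rightarrow>\<^sub>L real) \<Rightarrow> 'h \<times> 'g \<times> ('h \<Rightarrow>\<^sub>L real) \<Rightarrow> 'h \<times> 'g \<times> ('h \<Rightarrow>\<^sub>L real)) pr.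
        (\<forall>A X. pr (0, 0, A) (X, 0, 0) = blinfun_apply A X) \<and>
        manin_corresponds G brd pr (\<lambda>X. (X, 0, 0)) (\<lambda>u. (0, u, 0)) (\<lambda>A. (0, 0, A)) br dr \<delta> \<and>
        manin_corresponds G brd pr (\<lambda>A. (0, 0, A)) (\<lambda>u. (0, u, 0)) (\<lambda>X. (X, 0, 0)) brs drs \<delta>s)"


section \<open>Smooth manifolds\<close>

text \<open>\<open>f\<close> is of class \<open>C\<^sup>k\<close> on the open subset \<open>S\<close> of a finite-dimensional space.\<close>

fun Ck_on :: "nat \<Rightarrow> 'a::real_normed_vector set \<Rightarrow> ('a \<Rightarrow> 'b::real_normed_vector) \<Rightarrow> bool" where
  "Ck_on 0 S f \<longleftrightarrow> continuous_on S f"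
| "Ck_on (Suc k) S f \<longleftrightarrow>
     (\<forall>x\<in>S. f differentiable (at x)) \<and> (\<forall>v. Ck_on k S (\<lambda>x. frechet_derivative f (at x) v))"

definition smooth_on :: "'a::real_normed_vector set \<Rightarrow> ('a \<Rightarrow> 'b::real_normed_vector) \<Rightarrow> bool" where
  "smooth_on S f \<longleftrightarrow> (\<forall>k. Ck_on k S f)"

definition bderiv :: "('a::real_normed_vector \<Rightarrow> 'b::real_normed_vector) \<Rightarrow> 'a \<Rightarrow> 'a \<Rightarrow>\<^sub>L 'b" where
  "bderiv f x = Blinfun (frechet_derivative f (at x))"

text \<open>A smooth manifold, whose underlying topological space is the type \<open>'m\<close>, is given by an atlas
  indexed by the points: \<open>M p\<close> consists of the domain of a chart around \<open>p\<close> and of the chart map into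
  the model space \<open>'e\<close>.  Singling out a chart at each point serves only to have \<open>'e\<close> as the concrete
  tangent space at each point: a vector \<open>v :: 'e\<close> at \<open>p\<close> is the tangent vector whose coordinates in
  the chart \<open>M p\<close> are \<open>v\<close>.  Cotangent vectors and tensors at \<open>p\<close> are then those on \<open>'e\<close>.\<close>

type_synonym ('m, 'e) atlas = "'m \<Rightarrow> 'm set \<times> ('m \<Rightarrow> 'e)"

definition cdom :: "('m, 'e) atlas \<Rightarrow> 'm \<Rightarrow> 'm set" where
  "cdom M p = fst (M p)"

definition cmap :: "('m, 'e) atlas \<Rightarrow> 'm \<Rightarrow> 'm \<Rightarrow> 'e" where
  "cmap M p = snd (M p)"

definition cimg :: "('m, 'e) atlas \<Rightarrow> 'm \<Rightarrow> 'e set" where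
  "cimg M p = cmap M p ` cdom M p"

definition cinv :: "('m, 'e) atlas \<Rightarrow> 'm \<Rightarrow> 'e \<Rightarrow> 'm" where
  "cinv M p = inv_into (cdom M p) (cmap M p)"

definition smooth_manifold ::
    "('m::{t2_space, second_countable_topology}, 'e::real_normed_vector) atlas \<Rightarrow> bool" where
  "smooth_manifold M \<longleftrightarrow>
     fin_dim (UNIV :: 'e set) \<and>
     (\<forall>p. p \<in> cdom M p \<and> open (cdom M p) \<and> open (cimg M p) \<and>
          homeomorphism (cdom M p) (cimg M p) (cmap M p) (cinv M p)) \<and>
     (\<forall>p q. smooth_on (cmap M p ` (cdom M p \<inter> cdom M q)) (cmap M q \<circ> cinv M p))"

definition smooth_map :: "('m::topological_space, 'e::real_normed_vector) atlas \<Rightarrow>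
    ('n::topological_space, 'f::real_normed_vector) atlas \<Rightarrow> ('m \<Rightarrow> 'n) \<Rightarrow> bool" where
  "smooth_map M N f \<longleftrightarrow>
     continuous_on UNIV f \<and>
     (\<forall>p q. smooth_on (cmap M p ` (cdom M p \<inter> f -` cdom N q)) (cmap N q \<circ> f \<circ> cinv M p))"

definition tangent_map :: "('m, 'e::real_normed_vector) atlas \<Rightarrow> ('n, 'f::real_normed_vector) atlas \<Rightarrow>
    ('m \<Rightarrow> 'n) \<Rightarrow> 'm \<Rightarrow> 'e \<Rightarrow>\<^sub>L 'f" where
  "tangent_map M N f x = bderiv (cmap N (f x) \<circ> f \<circ> cinv M x) (cmap M x x)"

text \<open>The differential at \<open>x\<close> of the chart \<open>M q\<close>, and the coordinate expressions in this chart of a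
  vector field and of a field of 2-tensors.\<close>

definition chart_deriv :: "('m, 'e::real_normed_vector) atlas \<Rightarrow> 'm \<Rightarrow> 'm \<Rightarrow> 'e \<Rightarrow>\<^sub>L 'e" where
  "chart_deriv M q x = bderiv (cmap M q \<circ> cinv M x) (cmap M x x)"

definition vf_rep :: "('m, 'e::real_normed_vector) atlas \<Rightarrow> 'm \<Rightarrow> ('m \<Rightarrow> 'e) \<Rightarrow> 'e \<Rightarrow> 'e" where
  "vf_rep M q X y = (let x = cinv M q y in blinfun_apply (chart_deriv M q x) (X x))"

definition t2_rep :: "('m, 'e::real_normed_vector) atlas \<Rightarrow> 'm \<Rightarrow> ('m \<Rightarrow> 'e tensor2) \<Rightarrow> 'e \<Rightarrow> 'e tensor2" where
  "t2_rep M q T y = (let x = cinv M q y in tmap2 (chart_deriv M q x) (chart_deriv M q x) (T x))"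

definition smooth_vf_on :: "('m, 'e::real_normed_vector) atlas \<Rightarrow> 'm set \<Rightarrow> ('m \<Rightarrow> 'e) \<Rightarrow> bool" where
  "smooth_vf_on M U X \<longleftrightarrow> (\<forall>q. smooth_on (cmap M q ` (cdom M q \<inter> U)) (vf_rep M q X))"

definition smooth_t2 :: "('m, 'e::real_normed_vector) atlas \<Rightarrow> ('m \<Rightarrow> 'e tensor2) \<Rightarrow> bool" where
  "smooth_t2 M T \<longleftrightarrow> (\<forall>q. smooth_on (cimg M q) (t2_rep M q T))"

text \<open>Lie bracket of vector fields and Lie derivative of 2-tensors, at \<open>x\<close>, by the usual formulas in
  coordinates, using the chart at \<open>x\<close>:
  \<open>[X, Y] = DY(X) - DX(Y)\<close> and \<open>L\<^sub>X T = DT(X) - (DX \<otimes> 1 + 1 \<otimes> DX) T\<close>.\<close>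

definition lie_bracket :: "('m, 'e::real_normed_vector) atlas \<Rightarrow> ('m \<Rightarrow> 'e) \<Rightarrow> ('m \<Rightarrow> 'e) \<Rightarrow> 'm \<Rightarrow> 'e" where
  "lie_bracket M X Y x =
     blinfun_apply (bderiv (vf_rep M x Y) (cmap M x x)) (X x)
     - blinfun_apply (bderiv (vf_rep M x X) (cmap M x x)) (Y x)"

definition lie_deriv2 :: "('m, 'e::real_normed_vector) atlas \<Rightarrow> ('m \<Rightarrow> 'e) \<Rightarrow> ('m \<Rightarrow> 'e tensor2) \<Rightarrow>
    'm \<Rightarrow> 'e tensor2" where
  "lie_deriv2 M X T x =
     blinfun_apply (bderiv (t2_rep M x T) (cmap M x x)) (X x)
     - act2 (bderiv (vf_rep M x X) (cmap M x x)) (T x)"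

text \<open>\<open>S\<close> is the Schouten bracket \<open>[P, Q]\<close> of the bivector fields \<open>P\<close> and \<open>Q\<close>.  Bivector fields are
  locally finite sums of decomposable ones; for any such local expressions of \<open>P\<close> and \<open>Q\<close>, \<open>S\<close> is
  given by
  \<open>[X\<^sub>1 \<and> X\<^sub>2, Y\<^sub>1 \<and> Y\<^sub>2] = \<Sum>\<^sub>i\<^sub>,\<^sub>j (-1)\<^sup>i\<^sup>+\<^sup>j [X\<^sub>i, Y\<^sub>j] \<and> X\<^sub>3\<^sub>-\<^sub>i \<and> Y\<^sub>3\<^sub>-\<^sub>j\<close>.\<close>

definition is_schouten_bracket :: "('m::topological_space, 'e::real_normed_vector) atlas \<Rightarrow>
    ('m \<Rightarrow> 'e tensor2) \<Rightarrow> ('m \<Rightarrow> 'e tensor2) \<Rightarrow>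
    ('m \<Rightarrow> ('e \<Rightarrow>\<^sub>L real) \<Rightarrow> ('e \<Rightarrow>\<^sub>L real) \<Rightarrow> ('e \<Rightarrow>\<^sub>L real) \<Rightarrow> real) \<Rightarrow> bool" where
  "is_schouten_bracket M P Q S \<longleftrightarrow>
     (\<forall>U (m::nat) (n::nat) X1 X2 Y1 Y2.
        open U \<longrightarrow>
        (\<forall>i<m. smooth_vf_on M U (X1 i) \<and> smooth_vf_on M U (X2 i)) \<longrightarrow>
        (\<forall>j<n. smooth_vf_on M U (Y1 j) \<and> smooth_vf_on M U (Y2 j)) \<longrightarrow>
        (\<forall>x\<in>U. P x = (\<Sum>i<m. wedge (X1 i x) (X2 i x))) \<longrightarrow>
        (\<forall>x\<in>U. Q x = (\<Sum>j<n. wedge (Y1 j x) (Y2 j x))) \<longrightarrow>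
        (\<forall>x\<in>U. \<forall>\<alpha> \<beta> \<gamma>. S x \<alpha> \<beta> \<gamma> = (\<Sum>i<m. \<Sum>j<n.
             wedge3 (lie_bracket M (X1 i) (Y1 j) x) (X2 i x) (Y2 j x) \<alpha> \<beta> \<gamma>
           - wedge3 (lie_bracket M (X1 i) (Y2 j) x) (X2 i x) (Y1 j x) \<alpha> \<beta> \<gamma>
           - wedge3 (lie_bracket M (X2 i) (Y1 j) x) (X1 i x) (Y2 j x) \<alpha> \<beta> \<gamma>
           + wedge3 (lie_bracket M (X2 i) (Y2 j) x) (X1 i x) (Y1 j x) \<alpha> \<beta> \<gamma>)))"

definition lie_action :: "('u::real_vector \<Rightarrow> 'u \<Rightarrow> 'u) \<Rightarrow> ('m, 'e::real_normed_vector) atlas \<Rightarrow>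
    ('u \<Rightarrow> 'm \<Rightarrow> 'e) \<Rightarrow> bool" where
  "lie_action br M \<rho> \<longleftrightarrow>
     (\<forall>u. smooth_vf_on M UNIV (\<rho> u)) \<and> (\<forall>x. linear (\<lambda>u. \<rho> u x)) \<and>
     (\<forall>u v x. \<rho> (br u v) x = lie_bracket M (\<rho> u) (\<rho> v) x)"


section \<open>Quasi-Poisson manifolds\<close>

definition quasi_poisson_manifold :: "'g::real_vector quad_lie \<Rightarrow>
    ('m::{t2_space, second_countable_topology}, 'e::real_normed_vector) atlas \<Rightarrow>
    ('g \<Rightarrow> 'm \<Rightarrow> 'e) \<Rightarrow> ('m \<Rightarrow> 'e tensor2) \<Rightarrow> bool" where
  "quasi_poisson_manifold G M \<rho> \<pi> \<longleftrightarrow>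
     smooth_manifold M \<and>
     lie_action (gbr G) M \<rho> \<and>
     smooth_t2 M \<pi> \<and> (\<forall>x. skew (\<pi> x)) \<and>
     (\<forall>u x. lie_deriv2 M (\<rho> u) \<pi> x = 0) \<and>
     is_schouten_bracket M \<pi> \<pi> (\<lambda>x \<alpha> \<beta> \<gamma>.
        2 * phi G (\<lambda>u. blinfun_apply \<alpha> (\<rho> u x)) (\<lambda>u. blinfun_apply \<beta> (\<rho> u x)) (\<lambda>u. blinfun_apply \<gamma> (\<rho> u x)))"

definition quasi_poisson_map ::
    "('m::topological_space, 'e::real_normed_vector) atlas \<Rightarrow> ('g \<Rightarrow> 'm \<Rightarrow> 'e) \<Rightarrow> ('m \<Rightarrow> 'e tensor2) \<Rightarrow>
     ('n::topological_space, 'f::real_normed_vector) atlas \<Rightarrow> ('g \<Rightarrow> 'n \<Rightarrow> 'f) \<Rightarrow> ('n \<Rightarrow> 'f tensor2) \<Rightarrow>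
     ('m \<Rightarrow> 'n) \<Rightarrow> bool" where
  "quasi_poisson_map M \<rho> \<pi> N \<rho>' \<pi>' f \<longleftrightarrow>
     smooth_map M N f \<and>
     (\<forall>u x. blinfun_apply (tangent_map M N f x) (\<rho> u x) = \<rho>' u (f x)) \<and>
     (\<forall>x. tmap2 (tangent_map M N f x) (tangent_map M N f x) (\<pi> x) = \<pi>' (f x))"

definition prod_atlas :: "('m, 'e) atlas \<Rightarrow> ('n, 'f) atlas \<Rightarrow> ('m \<times> 'n, 'e \<times> 'f) atlas" where
  "prod_atlas M N = (\<lambda>(p, q). (cdom M p \<times> cdom N q, map_prod (cmap M p) (cmap N q)))"

definition fusion_action :: "('g \<Rightarrow> 'm \<Rightarrow> 'e) \<Rightarrow> ('g \<Rightarrow> 'n \<Rightarrow> 'f) \<Rightarrow> 'g \<Rightarrow> 'm \<times> 'n \<Rightarrow> 'e \<times> 'f" where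
  "fusion_action \<rho>1 \<rho>2 u = (\<lambda>(p, q). (\<rho>1 u p, \<rho>2 u q))"

definition fusion_bivector :: "'g quad_lie \<Rightarrow>
    ('g \<Rightarrow> 'm \<Rightarrow> 'e::real_normed_vector) \<Rightarrow> ('m \<Rightarrow> 'e tensor2) \<Rightarrow>
    ('g \<Rightarrow> 'n \<Rightarrow> 'f::real_normed_vector) \<Rightarrow> ('n \<Rightarrow> 'f tensor2) \<Rightarrow> 'm \<times> 'n \<Rightarrow> ('e \<times> 'f) tensor2" where
  "fusion_bivector G \<rho>1 \<pi>1 \<rho>2 \<pi>2 = (\<lambda>(p, q).
     tmap2 (Blinfun (\<lambda>v. (v, 0))) (Blinfun (\<lambda>v. (v, 0))) (\<pi>1 p)
     + tmap2 (Blinfun (\<lambda>w. (0, w))) (Blinfun (\<lambda>w. (0, w))) (\<pi>2 q)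
     - (1/2) *\<^sub>R tsum G (\<lambda>a b. wedge (\<rho>1 a p, 0) (0, \<rho>2 b q)))"


section \<open>Quasi-Poisson Lie groups\<close>

definition lie_group :: "('k::{t2_space, second_countable_topology}, 'e::real_normed_vector) atlas \<Rightarrow>
    ('k \<Rightarrow> 'k \<Rightarrow> 'k) \<Rightarrow> 'k \<Rightarrow> ('k \<Rightarrow> 'k) \<Rightarrow> bool" where
  "lie_group K mul one iv \<longleftrightarrow>
     smooth_manifold K \<and> group mul one iv \<and>
     smooth_map (prod_atlas K K) K (\<lambda>(h, k). mul h k) \<and> smooth_map K K iv"

definition left_inv_vf :: "('k, 'e::real_normed_vector) atlas \<Rightarrow> ('k \<Rightarrow> 'k \<Rightarrow> 'k) \<Rightarrow> 'k \<Rightarrow>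
    'e \<Rightarrow> 'k \<Rightarrow> 'e" where
  "left_inv_vf K mul one v k = blinfun_apply (tangent_map K K (mul k) one) v"

definition left_inv_form :: "('k, 'e::real_normed_vector) atlas \<Rightarrow> ('k \<Rightarrow> 'k \<Rightarrow> 'k) \<Rightarrow> ('k \<Rightarrow> 'k) \<Rightarrow>
    ('e \<Rightarrow>\<^sub>L real) \<Rightarrow> 'k \<Rightarrow> 'e \<Rightarrow>\<^sub>L real" where
  "left_inv_form K mul iv \<xi> k = \<xi> o\<^sub>L tangent_map K K (mul (iv k)) k"

definition quasi_poisson_lie_group :: "'g::real_vector quad_lie \<Rightarrow>
    ('k::{t2_space, second_countable_topology}, 'e::real_normed_vector) atlas \<Rightarrow>
    ('k \<Rightarrow> 'k \<Rightarrow> 'k) \<Rightarrow> 'k \<Rightarrow> ('k \<Rightarrow> 'k) \<Rightarrow> ('g \<Rightarrow> 'k \<Rightarrow> 'e) \<Rightarrow> ('k \<Rightarrow> 'e tensor2) \<Rightarrow> bool" where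
  "quasi_poisson_lie_group G K mul one iv \<rho> \<pi> \<longleftrightarrow>
     lie_group K mul one iv \<and>
     quasi_poisson_manifold G K \<rho> \<pi> \<and>
     quasi_poisson_map (prod_atlas K K) (fusion_action \<rho> \<rho>) (fusion_bivector G \<rho> \<pi> \<rho> \<pi>) K \<rho> \<pi>
       (\<lambda>(h, k). mul h k)"

text \<open>The linear isomorphism \<open>J\<close> from \<open>'a\<close> to the tangent space at the unit identifies
  \<open>(br, dr, \<delta>)\<close> with the Lie quasi-bialgebra of the quasi-Poisson Lie group.\<close>

definition integrates :: "('k, 'e::real_normed_vector) atlas \<Rightarrow> ('k \<Rightarrow> 'k \<Rightarrow> 'k) \<Rightarrow> 'k \<Rightarrow>
    ('g \<Rightarrow> 'k \<Rightarrow> 'e) \<Rightarrow> ('k \<Rightarrow> 'e tensor2) \<Rightarrow> ('a::real_normed_vector \<Rightarrow>\<^sub>L 'e) \<Rightarrow>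
    ('a \<Rightarrow> 'a \<Rightarrow> 'a) \<Rightarrow> ('g \<Rightarrow> 'a \<Rightarrow> 'a) \<Rightarrow> ('a \<Rightarrow> 'a tensor2) \<Rightarrow> bool" where
  "integrates K mul one \<rho> \<pi> J br dr \<delta> \<longleftrightarrow>
     bij (blinfun_apply J) \<and>
     (let L = (\<lambda>X. left_inv_vf K mul one (blinfun_apply J X)) in
       (\<forall>X Y. L (br X Y) = lie_bracket K (L X) (L Y)) \<and>
       (\<forall>u X. L (dr u X) = lie_bracket K (\<rho> u) (L X)) \<and>
       (\<forall>X. tmap2 J J (\<delta> X) = lie_deriv2 K (L X) \<pi> one))"


section \<open>Quasi-Poisson actions and the moment map construction\<close>

text \<open>In the last line \<open>\<psi>\<close> is extended to \<open>\<And>\<^sup>2 \<hh>\<close> by applying \<open>\<psi> \<otimes> \<psi>\<close>.\<close>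

definition quasi_poisson_action :: "'g::real_vector quad_lie \<Rightarrow>
    ('h::real_normed_vector \<Rightarrow> 'h \<Rightarrow> 'h) \<Rightarrow> ('g \<Rightarrow> 'h \<Rightarrow> 'h) \<Rightarrow> ('h \<Rightarrow> 'h tensor2) \<Rightarrow>
    ('m, 'e::real_normed_vector) atlas \<Rightarrow> ('g \<Rightarrow> 'm \<Rightarrow> 'e) \<Rightarrow> ('m \<Rightarrow> 'e tensor2) \<Rightarrow>
    ('h \<Rightarrow> 'm \<Rightarrow> 'e) \<Rightarrow> bool" where
  "quasi_poisson_action G br dr \<delta> M \<rho> \<pi> \<psi> \<longleftrightarrow>
     lie_action br M \<psi> \<and>
     (\<forall>u X x. \<psi> (dr u X) x = lie_bracket M (\<rho> u) (\<psi> X) x) \<and>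
     (\<forall>X x. lie_deriv2 M (\<psi> X) \<pi> x =
        - tmap2 (Blinfun (\<lambda>Y. \<psi> Y x)) (Blinfun (\<lambda>Y. \<psi> Y x)) (\<delta> X)
        + (1/2) *\<^sub>R tsum G (\<lambda>a b. wedge (\<psi> (dr a X) x) (\<rho> b x)))"

definition sigma :: "'g quad_lie \<Rightarrow> ('g \<Rightarrow> 'm \<Rightarrow> 'e::real_normed_vector) \<Rightarrow> ('m \<Rightarrow> 'e tensor2) \<Rightarrow>
    'm \<Rightarrow> 'e tensor2" where
  "sigma G \<rho> \<pi> x = \<pi> x + (1/2) *\<^sub>R tsum G (\<lambda>a b. tens (\<rho> a x) (\<rho> b x))"

definition pullback_form :: "('m, 'e::real_normed_vector) atlas \<Rightarrow> ('n, 'f::real_normed_vector) atlas \<Rightarrow>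
    ('m \<Rightarrow> 'n) \<Rightarrow> ('n \<Rightarrow> 'f \<Rightarrow>\<^sub>L real) \<Rightarrow> 'm \<Rightarrow> 'e \<Rightarrow>\<^sub>L real" where
  "pullback_form M N f \<theta> x = \<theta> (f x) o\<^sub>L tangent_map M N f x"

text \<open>An element \<open>X\<close> of \<open>'h\<close> as a cotangent vector at the unit of a group whose Lie algebra is
  identified with the dual of \<open>'h\<close> by \<open>J\<close>.\<close>

definition cotangent_of :: "(('h::real_normed_vector \<Rightarrow>\<^sub>L real) \<Rightarrow>\<^sub>L 'e::real_normed_vector) \<Rightarrow>
    'h \<Rightarrow> 'e \<Rightarrow>\<^sub>L real" where
  "cotangent_of J X = Blinfun (\<lambda>v. blinfun_apply (inv (blinfun_apply J) v) X)"

end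

theory Submission
  imports Defs
begin

text \<open>
  Write \<open>\<sigma> = \<pi> + t/2\<close> and \<open>a(\<alpha>) = \<sigma>(\<alpha>, \<cdot>)\<close>, with transpose \<open>a\<^sup>T(\<beta>) = \<sigma>(\<cdot>, \<beta>)\<close>.  On a
  quasi-Poisson manifold the equation for \<open>[\<pi>, \<pi>]\<close> and the invariance of \<open>\<pi>\<close> and \<open>t\<close> give, for 1-forms
  \<open>\<alpha>\<close> and \<open>\<beta>\<close>,

  \<^item> \<open>[\<rho>(u), a(\<alpha>)] = a(L\<^sub>\<rho>\<^sub>(\<^sub>u\<^sub>) \<alpha>)\<close>,
  \<^item> \<open>L\<^sub>a\<^sub>(\<^sub>\<alpha>\<^sub>) \<pi> = 1/2 t\<^sup>i\<^sup>j [\<rho>(e\<^sub>i), a(\<alpha>)] \<and> \<rho>(e\<^sub>j) + (a \<otimes> a)(d\<alpha>)\<close>,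
  \<^item> \<open>[a(\<alpha>), a(\<beta>)] = a(B(\<alpha>, \<beta>))\<close>, where \<open>B(\<alpha>, \<beta>)\<close> is
    \<open>d(\<sigma>(\<alpha>, \<beta>)) + i\<^sub>a\<^sub>(\<^sub>\<alpha>\<^sub>) d\<beta> + i\<^sub>a\<^sub>T\<^sub>(\<^sub>\<beta>\<^sub>) d\<alpha> - t\<^sup>i\<^sup>j \<beta>(\<rho>(e\<^sub>j)) L\<^sub>\<rho>\<^sub>(\<^sub>e\<^sub>i\<^sub>) \<alpha>\<close>.

  These are identities between first-order jets at a point, hence pure linear algebra in a chart.  All
  terms of \<open>B\<close> are natural under quasi-Poisson maps, so that for the forms \<open>\<mu>\<^sup>*X\<^sup>L\<close> they need only be
  evaluated on the group.  There \<open>dX\<^sup>L\<close> is given by the Maurer-Cartan equation, hence by \<open>\<delta>(X)\<close>.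
  Differentiating the multiplicativity of \<open>\<pi>\<close> in the second factor at the unit gives
  \<open>L\<^sub>A \<pi> = (\<delta>A)\<^sup>L - 1/2 t\<^sup>i\<^sup>j (e\<^sub>iA)\<^sup>L \<and> \<rho>(e\<^sub>j)\<close> for left-invariant \<open>A\<close>, and this turns
  \<open>B(X\<^sup>L, Y\<^sup>L)\<close> into \<open>-[X, Y]\<^sup>L\<close>.
\<close>

text \<open>Vectors are compared through functionals \<gamma>. As \<sigma> is not skew, its
  transpose matters: \<gamma>(a(\<alpha>)) = \<alpha>(a^T(\<gamma>)) turns every identity into one
  about the single vector w = a^T(\<gamma>). The differential of \<mu> sends w to a tangent vector
  of the group, and any such vector is the value of a left-invariant field. The derivative of
  \<sigma>(X^L, Y^L) along w is therefore one along a left-invariant field, where the formula for L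
  \<pi> applies.

  Two cancellations then settle the bracket of anchors. The terms with dX^L and dY^L produced by
  this derivative are opposite to those of B, so they drop out, and Maurer-Cartan enters only
  through the Lie derivative of \<pi>. The skew correction of L \<pi> and the symmetric half of t in
  \<sigma> add up to one term, which cancels the last term of B. What is left is [Y, X] rather than
  [X, Y]: the map X -> a(\<mu>^* X^L) reverses brackets, and this is where the minus sign in \<psi>
  comes from.\<close>

type_synonym 'a dual = "'a \<Rightarrow>\<^sub>L real"

notation (input) blinfun_apply (infixl "\<cdot>" 90)

section \<open>Finite-dimensional spaces\<close>

text \<open>A resolution of the identity into continuous functionals and vectors. It says just
  enough to expand a linear map over finitely many vectors, and allows n = 0.\<close>

definition frame :: "nat \<Rightarrow> (nat \<Rightarrow> 'a::real_normed_vector) \<Rightarrow> (nat \<Rightarrow> 'a dual) \<Rightarrow> bool" where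
  "frame n b \<beta> \<longleftrightarrow> (\<forall>v. (\<Sum>i<n. \<beta> i \<cdot> v *\<^sub>R b i) = v)"

text \<open>Equivalence of norms. By independence the norm of the combination does not vanish on the
  compact set of coefficients with absolute sum 1, so it has a positive minimum there; homogeneity
  does the rest.\<close>

lemma independent_coefficients_bounded:
  fixes B :: "'a::real_normed_vector set"
  assumes B: "finite B" "independent B"
  shows "\<exists>c>0. \<forall>f. c * (\<Sum>b\<in>B. \<bar>f b\<bar>) \<le> norm (\<Sum>b\<in>B. f b *\<^sub>R b)"
proof (cases "B = {}")
  case True
  then show ?thesis by (auto intro: exI[of _ 1])
next
  case False
  \<comment> \<open>Coefficients are functions on the whole type. Pinning them to 0 outside
    \<open>B\<close> makes the box a product of compact sets, hence compact.\<close>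
  define box where "box = PiE UNIV (\<lambda>b. if b \<in> B then {-1..1::real} else {0})"
  define S where "S = box \<inter> {f. (\<Sum>b\<in>B. \<bar>f b\<bar>) = 1}"
  have "compactin (product_topology (\<lambda>i::'a. euclidean :: real topology) UNIV) box"
    unfolding box_def compactin_PiE by auto
  then have "compact box"
    unfolding euclidean_product_topology by simp
  moreover have "closed {f :: 'a \<Rightarrow> real. (\<Sum>b\<in>B. \<bar>f b\<bar>) = 1}"
    by (intro closed_Collect_eq continuous_intros continuous_on_product_coordinates)
  ultimately have S: "compact S"
    unfolding S_def by (rule compact_Int_closed)
  obtain b0 where b0: "b0 \<in> B" using False by auto
  have "(\<lambda>b. if b = b0 then 1 else 0 :: real) \<in> S"
    using b0 B(1) unfolding S_def box_def by (auto simp: if_distrib cong: if_cong)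
  then have ne: "S \<noteq> {}" by auto
  have cont: "continuous_on S (\<lambda>f. norm (\<Sum>b\<in>B. f b *\<^sub>R b))"
    by (intro continuous_intros continuous_on_subset[OF continuous_on_product_coordinates]) auto
  obtain g where g: "g \<in> S" "\<And>f. f \<in> S \<Longrightarrow> norm (\<Sum>b\<in>B. g b *\<^sub>R b) \<le> norm (\<Sum>b\<in>B. f b *\<^sub>R b)"
    using continuous_attains_inf[OF S ne cont] by auto
  define c where "c = norm (\<Sum>b\<in>B. g b *\<^sub>R b)"
  have "c \<noteq> 0"
  proof
    assume "c = 0"
    then have "(\<Sum>b\<in>B. g b *\<^sub>R b) = 0" by (simp add: c_def)
    then have "\<forall>b\<in>B. g b = 0" using B dependent_finite[OF B(1)] by blast
    then show False using g(1) unfolding S_def by auto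
  qed
  then have c: "c > 0" by (simp add: c_def)
  have "c * (\<Sum>b\<in>B. \<bar>f b\<bar>) \<le> norm (\<Sum>b\<in>B. f b *\<^sub>R b)" for f
  proof (cases "(\<Sum>b\<in>B. \<bar>f b\<bar>) = 0")
    case True
    then show ?thesis by simp
  next
    case False
    define N where "N = (\<Sum>b\<in>B. \<bar>f b\<bar>)"
    have N: "N > 0" using False sum_nonneg[of B "\<lambda>b. \<bar>f b\<bar>"] unfolding N_def by linarith
    define h where "h b = (if b \<in> B then f b / N else 0)" for b
    have hN: "(\<Sum>b\<in>B. \<bar>h b\<bar>) = 1"
      using N by (simp add: h_def sum_divide_distrib[symmetric] N_def[symmetric] cong: sum.cong)
    have le: "\<bar>f b\<bar> \<le> N" if "b \<in> B" for b
      unfolding N_def using that B(1) by (intro member_le_sum) auto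
    have "h \<in> box"
      unfolding box_def
    proof (intro PiE_I)
      show "h b \<in> (if b \<in> B then {-1..1} else {0})" for b
        using N le[of b] by (auto simp: h_def divide_simps abs_le_iff)
    qed auto
    with hN have "h \<in> S" by (simp add: S_def)
    from g(2)[OF this] have "c \<le> norm (\<Sum>b\<in>B. h b *\<^sub>R b)" by (simp add: c_def)
    also have "(\<Sum>b\<in>B. h b *\<^sub>R b) = (1 / N) *\<^sub>R (\<Sum>b\<in>B. f b *\<^sub>R b)"
      by (simp add: h_def scaleR_sum_right cong: sum.cong)
    finally show ?thesis using N by (simp add: N_def[symmetric] field_simps)
  qed
  with c show ?thesis by auto
qed

text \<open>The norm is arbitrary, so what has to be shown is continuity of the coordinates with
  respect to a basis. The preceding lower bound \<open>c\<close> gives them operator norm at most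
  1/c.\<close>

lemma frame_exists:
  assumes "fin_dim (UNIV :: 'a::real_normed_vector set)"
  obtains n and b :: "nat \<Rightarrow> 'a::real_normed_vector" and \<beta> where "frame n b \<beta>"
proof -
  obtain B0 :: "'a set" where B0: "finite B0" "UNIV \<subseteq> span B0"
    using assms by (auto simp: fin_dim_def)
  obtain B where B: "B \<subseteq> B0" "independent B" "B0 \<subseteq> span B"
    using maximal_independent_subset[of B0] by blast
  have fB: "finite B" using B(1) B0(1) finite_subset by blast
  have "span B0 \<subseteq> span B" using B(3) span_minimal[OF _ subspace_span] by blast
  then have sp: "span B = UNIV" using B0(2) by auto
  obtain c where c: "c > 0" "\<And>f. c * (\<Sum>b\<in>B. \<bar>f b\<bar>) \<le> norm (\<Sum>b\<in>B. f b *\<^sub>R b)"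
    using independent_coefficients_bounded[OF fB B(2)] by auto
  have rep: "(\<Sum>b\<in>B. representation B v b *\<^sub>R b) = v" for v
    using sum_representation_eq[OF B(2), of v B] sp fB by auto
  have bl: "bounded_linear (\<lambda>v. representation B v b)" if "b \<in> B" for b
  proof (rule bounded_linear_intro[where K = "1 / c"])
    show "representation B (x + y) b = representation B x b + representation B y b" for x y
      using representation_add[OF B(2)] sp by auto
    show "representation B (r *\<^sub>R x) b = r *\<^sub>R representation B x b" for r x
      using representation_scale[OF B(2)] sp by auto
    show "norm (representation B x b) \<le> norm x * (1 / c)" for x
    proof -
      have "\<bar>representation B x b\<bar> \<le> (\<Sum>b\<in>B. \<bar>representation B x b\<bar>)"
        using that fB by (intro member_le_sum) auto
      then have "c * \<bar>representation B x b\<bar> \<le> norm x"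
        using c(2)[of "representation B x"] c(1) unfolding rep
        by (smt (verit) mult_left_mono)
      then show ?thesis using c(1) by (simp add: field_simps)
    qed
  qed
  obtain e where e: "bij_betw e {..<card B} B"
    using ex_bij_betw_nat_finite[OF fB] by (auto simp: atLeast0LessThan)
  have "frame (card B) e (\<lambda>i. Blinfun (\<lambda>v. representation B v (e i)))"
    unfolding frame_def
  proof
    fix v
    have "(\<Sum>i<card B. Blinfun (\<lambda>v. representation B v (e i)) \<cdot> v *\<^sub>R e i)
        = (\<Sum>i<card B. representation B v (e i) *\<^sub>R e i)"
      using e by (intro sum.cong refl) (auto simp: bounded_linear_Blinfun_apply bl bij_betw_apply)
    also have "\<dots> = v"
      using sum.reindex_bij_betw[OF e, of "\<lambda>b. representation B v b *\<^sub>R b"] rep by simp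
    finally show "(\<Sum>i<card B. Blinfun (\<lambda>v. representation B v (e i)) \<cdot> v *\<^sub>R e i) = v" .
  qed
  then show thesis by (rule that)
qed

lemma frame_expand:
  assumes "frame n b \<beta>" "linear f"
  shows "f v = (\<Sum>i<n. \<beta> i \<cdot> v *\<^sub>R f (b i))"
proof -
  have "f v = f (\<Sum>i<n. \<beta> i \<cdot> v *\<^sub>R b i)" using assms(1) by (simp add: frame_def)
  also have "\<dots> = (\<Sum>i<n. \<beta> i \<cdot> v *\<^sub>R f (b i))"
    by (simp add: linear_sum[OF assms(2)] linear_scale[OF assms(2)])
  finally show ?thesis .
qed

lemma fin_dim_bounded_linear:
  fixes f :: "'a::real_normed_vector \<Rightarrow> 'b::real_normed_vector"
  assumes "fin_dim (UNIV :: 'a set)" "linear f"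
  shows "bounded_linear f"
proof -
  obtain n and b :: "nat \<Rightarrow> 'a" and \<beta> where fr: "frame n b \<beta>"
    using frame_exists[OF assms(1)] .
  have "f = (\<lambda>v. \<Sum>i<n. \<beta> i \<cdot> v *\<^sub>R f (b i))"
    by (intro ext frame_expand[OF fr assms(2)])
  moreover have "bounded_linear (\<lambda>v. \<Sum>i<n. \<beta> i \<cdot> v *\<^sub>R f (b i))"
    by (intro bounded_linear_sum bounded_linear_scaleR_const blinfun.bounded_linear_right)
  ultimately show ?thesis by metis
qed

lemma Blinfun_apply_linear:
  fixes f :: "'a::real_normed_vector \<Rightarrow> 'b::real_normed_vector"
  assumes "fin_dim (UNIV :: 'a set)" "linear f"
  shows "blinfun_apply (Blinfun f) = f"
  using fin_dim_bounded_linear[OF assms] by (simp add: bounded_linear_Blinfun_apply)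

lemma fin_dim_functionals_separate:
  fixes v w :: "'a::real_normed_vector"
  assumes "fin_dim (UNIV :: 'a set)" "\<And>\<gamma> :: 'a dual. \<gamma> \<cdot> v = \<gamma> \<cdot> w"
  shows "v = w"
proof -
  obtain n and b :: "nat \<Rightarrow> 'a" and \<beta> where "frame n b \<beta>"
    using frame_exists[OF assms(1)] .
  then have "(\<Sum>i<n. \<beta> i \<cdot> v *\<^sub>R b i) = v"
    and "(\<Sum>i<n. \<beta> i \<cdot> w *\<^sub>R b i) = w"
    by (auto simp: frame_def)
  then show ?thesis unfolding assms(2) by simp
qed

lemma tensor2_eqI:
  fixes S T :: "'a::real_normed_vector tensor2"
  assumes "\<And>\<alpha> \<beta>. S \<cdot> \<alpha> \<cdot> \<beta> = T \<cdot> \<alpha> \<cdot> \<beta>"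
  shows "S = T"
  using assms by (intro blinfun_eqI) auto

text \<open>Reflexivity: a sum over a frame represents the functional, and since functionals
  separate points it is the only such vector. Hence the description in \<open>contract\<close>
  denotes.\<close>

lemma apply_contract:
  fixes T :: "'a::real_normed_vector tensor2"
  assumes "fin_dim (UNIV :: 'a set)"
  shows "\<gamma> \<cdot> contract T \<alpha> = T \<cdot> \<alpha> \<cdot> \<gamma>"
proof -
  obtain n and b :: "nat \<Rightarrow> 'a" and \<beta> where fr: "frame n b \<beta>"
    using frame_exists[OF assms] .
  define v where "v = (\<Sum>i<n. T \<cdot> \<alpha> \<cdot> \<beta> i *\<^sub>R b i)"
  have v: "\<gamma> \<cdot> v = T \<cdot> \<alpha> \<cdot> \<gamma>" for \<gamma>
  proof -
    have "\<gamma> = (\<Sum>i<n. \<gamma> \<cdot> b i *\<^sub>R \<beta> i)"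
    proof (rule blinfun_eqI)
      fix w
      show "\<gamma> \<cdot> w = (\<Sum>i<n. \<gamma> \<cdot> b i *\<^sub>R \<beta> i) \<cdot> w"
        using frame_expand[OF fr, of "blinfun_apply \<gamma>" w]
        by (simp add: blinfun.sum_left blinfun.scaleR_left mult.commute
            bounded_linear.linear[OF blinfun.bounded_linear_right])
    qed
    then have "T \<cdot> \<alpha> \<cdot> \<gamma> = T \<cdot> \<alpha> \<cdot> (\<Sum>i<n. \<gamma> \<cdot> b i *\<^sub>R \<beta> i)" by simp
    also have "\<dots> = \<gamma> \<cdot> v"
      by (simp add: v_def blinfun.sum_right blinfun.scaleR_right mult.commute)
    finally show ?thesis by simp
  qed
  have "contract T \<alpha> = v"
    unfolding contract_def
    by (rule the_equality) (auto simp: v intro: fin_dim_functionals_separate[OF assms])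
  then show ?thesis using v by simp
qed

text \<open>Replaces the description operator by a finite sum, from which smoothness of contracted
  fields can be read off.\<close>

lemma contract_apply_frame:
  fixes T :: "'a::real_normed_vector tensor2"
  assumes "frame n b \<beta>"
  shows "contract T \<alpha> = (\<Sum>i<n. T \<cdot> \<alpha> \<cdot> \<beta> i *\<^sub>R b i)"
proof -
  have "fin_dim (UNIV :: 'a set)"
    unfolding fin_dim_def
  proof (intro exI[of _ "b ` {..<n}"] conjI subsetI)
    fix v :: 'a
    have "v = (\<Sum>i<n. \<beta> i \<cdot> v *\<^sub>R b i)" using assms by (simp add: frame_def)
    also have "\<dots> \<in> span (b ` {..<n})"
      by (intro span_sum span_scale span_base) auto
    finally show "v \<in> span (b ` {..<n})" .
  qed simp
  from apply_contract[OF this] frame_expand[OF assms linear_ident, of "contract T \<alpha>"]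
  show ?thesis by simp
qed

lemma linear_tsum:
  assumes "linear f"
  shows "f (tsum G F) = tsum G (\<lambda>a b. f (F a b))"
  by (simp add: tsum_def linear_sum[OF assms] linear_scale[OF assms])

lemma frame_sum:
  assumes "frame n b \<beta>"
  shows "(\<Sum>i<n. \<beta> i \<cdot> v *\<^sub>R A \<cdot> b i) = A \<cdot> v"
  using frame_expand[OF assms bounded_linear.linear[OF blinfun.bounded_linear_right], of A v] by metis

section \<open>Calculus of smooth maps\<close>

lemma blinfun_apply_bderiv:
  assumes "(f has_derivative f') (at x)"
  shows "blinfun_apply (bderiv f x) = f'"
  unfolding bderiv_def frechet_derivative_at[OF assms, symmetric]
  by (rule bounded_linear_Blinfun_apply[OF has_derivative_bounded_linear[OF assms]])

lemma has_derivative_bderiv: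
  assumes "f differentiable (at x)"
  shows "(f has_derivative blinfun_apply (bderiv f x)) (at x)"
  using blinfun_apply_bderiv assms unfolding differentiable_def by metis

lemma frechet_derivative_eq_bderiv:
  assumes "f differentiable (at x)"
  shows "frechet_derivative f (at x) = blinfun_apply (bderiv f x)"
  using frechet_derivative_at[OF has_derivative_bderiv[OF assms]] by simp

lemma has_derivative_cong_open:
  assumes "(f has_derivative f') (at x)" "open S" "x \<in> S" "\<And>y. y \<in> S \<Longrightarrow> f y = g y"
  shows "(g has_derivative f') (at x)"
  using has_derivative_transform_within_open[OF assms(1-3)] assms(4) by blast

lemma bderiv_cong_open:
  assumes "f differentiable (at x)" "open S" "x \<in> S" "\<And>y. y \<in> S \<Longrightarrow> f y = g y"
  shows "bderiv g x = bderiv f x" "g differentiable (at x)"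
proof -
  have "(g has_derivative blinfun_apply (bderiv f x)) (at x)"
    using has_derivative_cong_open[OF has_derivative_bderiv[OF assms(1)] assms(2-4)] .
  then show "bderiv g x = bderiv f x" "g differentiable (at x)"
    using blinfun_apply_bderiv[of g "blinfun_apply (bderiv f x)" x]
    by (auto simp: blinfun_apply_inject differentiable_def)
qed

section \<open>Closure properties of the class C^k and of smoothness\<close>

lemma Ck_on_cong:
  assumes "open S" "Ck_on k S f" "\<And>x. x \<in> S \<Longrightarrow> f x = g x"
  shows "Ck_on k S g"
  using assms(2,3)
proof (induction k arbitrary: f g)
  case 0
  then show ?case by (auto cong: continuous_on_cong)
next
  case (Suc k)
  have d: "(g has_derivative blinfun_apply (bderiv f x)) (at x)" if "x \<in> S" for x
    using Suc.prems that by (intro has_derivative_cong_open[OF has_derivative_bderiv assms(1)]) auto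
  have e: "frechet_derivative f (at x) v = frechet_derivative g (at x) v" if "x \<in> S" for x v
    using Suc.prems(1) that frechet_derivative_at[OF d[OF that]]
    by (auto simp: frechet_derivative_eq_bderiv)
  show ?case
    unfolding Ck_on.simps
  proof (intro conjI ballI allI)
    show "g differentiable at x" if "x \<in> S" for x
      using d[OF that] by (auto simp: differentiable_def)
    show "Ck_on k S (\<lambda>x. frechet_derivative g (at x) v)" for v
    proof (rule Suc.IH)
      show "Ck_on k S (\<lambda>x. frechet_derivative f (at x) v)" using Suc.prems(1) by simp
    qed (rule e)
  qed
qed

text \<open>An explicit formula on \<open>S\<close> may stand in for
  \<open>frechet_derivative\<close>; the two need to agree only on the open set
  \<open>S\<close>.\<close>

lemma Ck_on_SucI:
  assumes "open S" "\<And>x. x \<in> S \<Longrightarrow> (f has_derivative F x) (at x)" "\<And>v. Ck_on k S (\<lambda>x. F x v)"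
  shows "Ck_on (Suc k) S f"
  unfolding Ck_on.simps
proof (intro conjI ballI allI)
  show "f differentiable at x" if "x \<in> S" for x
    using assms(2)[OF that] by (auto simp: differentiable_def)
  show "Ck_on k S (\<lambda>x. frechet_derivative f (at x) v)" for v
    using frechet_derivative_at[OF assms(2)] by (rule_tac Ck_on_cong[OF assms(1) assms(3)[of v]]) metis
qed

lemma Ck_on_Suc_bderiv:
  assumes "open S" "Ck_on (Suc k) S f"
  shows "Ck_on k S (\<lambda>x. bderiv f x \<cdot> v)"
  using assms by (rule_tac Ck_on_cong[OF assms(1), of k "\<lambda>x. frechet_derivative f (at x) v"])
    (auto simp: frechet_derivative_eq_bderiv)

lemma Ck_on_subset: "Ck_on k S f \<Longrightarrow> T \<subseteq> S \<Longrightarrow> Ck_on k T f"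
  by (induction k arbitrary: f) (auto intro: continuous_on_subset)

lemma Ck_on_local:
  assumes "\<And>x. x \<in> S \<Longrightarrow> \<exists>T. open T \<and> x \<in> T \<and> Ck_on k T f"
  shows "Ck_on k S f"
  using assms
proof (induction k arbitrary: f)
  case 0
  then show ?case
    by (force simp: continuous_on_eq_continuous_at intro!: continuous_at_imp_continuous_on)
next
  case (Suc k)
  have "Ck_on k S (\<lambda>x. frechet_derivative f (at x) v)" for v
    by (rule Suc.IH) (use Suc.prems in fastforce)
  then show ?case using Suc.prems by fastforce
qed

lemma Ck_on_pred: "Ck_on (Suc k) S f \<Longrightarrow> Ck_on k S f"
proof (induction k arbitrary: f)
  case 0
  then show ?case
    by (auto intro!: continuous_at_imp_continuous_on differentiable_imp_continuous_within)
next
  case (Suc k)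
  then show ?case by (metis Ck_on.simps(2))
qed

lemma Ck_on_const: "open S \<Longrightarrow> Ck_on k S (\<lambda>x. c)"
proof (induction k arbitrary: c)
  case (Suc k)
  then show ?case
    by (intro Ck_on_SucI[where F = "\<lambda>x v. 0"]) (auto intro!: derivative_eq_intros)
qed auto

lemma Ck_on_linear:
  assumes "open S" "bounded_linear L" "Ck_on k S f"
  shows "Ck_on k S (\<lambda>x. L (f x))"
  using assms(3)
proof (induction k arbitrary: f)
  case 0
  then show ?case using assms(2) by (auto intro: bounded_linear.continuous_on)
next
  case (Suc k)
  show ?case
  proof (rule Ck_on_SucI[where F = "\<lambda>x v. L (bderiv f x \<cdot> v)"])
    show "((\<lambda>x. L (f x)) has_derivative (\<lambda>v. L (bderiv f x \<cdot> v))) (at x)"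
      if "x \<in> S" for x
      using Suc.prems that
      by (intro bounded_linear.has_derivative[OF assms(2)] has_derivative_bderiv) auto
    show "Ck_on k S (\<lambda>x. L (bderiv f x \<cdot> v))" for v
      using Suc.prems by (intro Suc.IH Ck_on_Suc_bderiv assms(1))
  qed (rule assms(1))
qed

lemma Ck_on_add:
  assumes "open S" "Ck_on k S f" "Ck_on k S g"
  shows "Ck_on k S (\<lambda>x. f x + g x)"
  using assms(2,3)
proof (induction k arbitrary: f g)
  case 0
  then show ?case by (auto intro: continuous_intros)
next
  case (Suc k)
  show ?case
  proof (rule Ck_on_SucI[where F = "\<lambda>x v. bderiv f x \<cdot> v + bderiv g x \<cdot> v"])
    show "((\<lambda>x. f x + g x) has_derivative
        (\<lambda>v. bderiv f x \<cdot> v + bderiv g x \<cdot> v)) (at x)" if "x \<in> S" for x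
      using Suc.prems that by (intro has_derivative_add has_derivative_bderiv) auto
    show "Ck_on k S (\<lambda>x. bderiv f x \<cdot> v + bderiv g x \<cdot> v)" for v
      using Suc.prems by (intro Suc.IH Ck_on_Suc_bderiv assms(1))
  qed (rule assms(1))
qed

lemma Ck_on_bilinear:
  assumes "open S" "bounded_bilinear B" "Ck_on k S f" "Ck_on k S g"
  shows "Ck_on k S (\<lambda>x. B (f x) (g x))"
  using assms(3,4)
proof (induction k arbitrary: f g)
  case 0
  then show ?case using assms(2) by (auto intro: bounded_bilinear.continuous_on)
next
  case (Suc k)
  show ?case
  proof (rule Ck_on_SucI[where F = "\<lambda>x v. B (f x) (bderiv g x \<cdot> v) + B (bderiv f x \<cdot> v) (g x)"])
    show "((\<lambda>x. B (f x) (g x)) has_derivative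
        (\<lambda>v. B (f x) (bderiv g x \<cdot> v) + B (bderiv f x \<cdot> v) (g x))) (at x)"
      if "x \<in> S" for x
      using Suc.prems that
      by (intro bounded_bilinear.FDERIV[OF assms(2)] has_derivative_bderiv) auto
    show "Ck_on k S (\<lambda>x. B (f x) (bderiv g x \<cdot> v) + B (bderiv f x \<cdot> v) (g x))"
      for v
      using Suc.prems assms(1) by (intro Ck_on_add Suc.IH Ck_on_Suc_bderiv) (auto intro: Ck_on_pred)
  qed (use assms in auto)
qed

lemma Ck_on_sum:
  assumes "open S" "\<And>i. i \<in> I \<Longrightarrow> Ck_on k S (f i)"
  shows "Ck_on k S (\<lambda>x. \<Sum>i\<in>I. f i x)"
  using assms by (induction I rule: infinite_finite_induct) (auto intro: Ck_on_const Ck_on_add)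

lemma Ck_on_id: "open S \<Longrightarrow> Ck_on k S (\<lambda>x. x)"
proof (cases k)
  case (Suc k)
  assume "open S"
  then show ?thesis unfolding Suc
    by (intro Ck_on_SucI[where F = "\<lambda>x v. v"] Ck_on_const has_derivative_ident)
qed (auto intro: continuous_intros)

text \<open>By the chain rule the derivative of \<open>g\<close> is taken in a direction that moves
  with x, while \<open>Ck_on\<close> speaks of fixed directions only. Expanding the direction over a
  frame of the middle space gives a sum of products to which the induction hypothesis
  applies.\<close>

lemma Ck_on_compose:
  fixes f :: "'a::real_normed_vector \<Rightarrow> 'b::real_normed_vector"
    and g :: "'b \<Rightarrow> 'c::real_normed_vector"
  assumes "fin_dim (UNIV :: 'b set)" "open S" "open T" "\<And>x. x \<in> S \<Longrightarrow> f x \<in> T"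
    "Ck_on k S f" "Ck_on k T g"
  shows "Ck_on k S (\<lambda>x. g (f x))"
  using assms(5,6)
proof (induction k arbitrary: g)
  case 0
  then show ?case using assms(4) by (auto intro!: continuous_on_compose2[of T g S f])
next
  case (Suc k)
  obtain n and b :: "nat \<Rightarrow> 'b" and \<beta> where fr: "frame n b \<beta>"
    using frame_exists[OF assms(1)] .
  show ?case
  proof (rule Ck_on_SucI[where F = "\<lambda>x v. \<Sum>i<n. \<beta> i \<cdot> (bderiv f x \<cdot> v) *\<^sub>R
        bderiv g (f x) \<cdot> b i"])
    show "((\<lambda>x. g (f x)) has_derivative (\<lambda>v. \<Sum>i<n. \<beta> i \<cdot> (bderiv f x \<cdot> v) *\<^sub>R
        bderiv g (f x) \<cdot> b i)) (at x)" if "x \<in> S" for x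
    proof -
      have "((\<lambda>x. g (f x)) has_derivative (\<lambda>v. bderiv g (f x) \<cdot> (bderiv f x \<cdot> v))) (at x)"
        using Suc.prems that assms(4)
        by (intro has_derivative_compose[where g = g and f = f] has_derivative_bderiv) auto
      then show ?thesis
        by (simp only: frame_sum[OF fr])
    qed
    show "Ck_on k S (\<lambda>x. \<Sum>i<n. \<beta> i \<cdot> (bderiv f x \<cdot> v) *\<^sub>R
        bderiv g (f x) \<cdot> b i)" for v
    proof -
      have "Ck_on k S (\<lambda>x. \<beta> i \<cdot> (bderiv f x \<cdot> v))" for i
        by (rule Ck_on_linear[OF assms(2) blinfun.bounded_linear_right Ck_on_Suc_bderiv[OF assms(2)]])
          (rule Suc.prems)
      moreover have "Ck_on k S (\<lambda>x. bderiv g (f x) \<cdot> b i)" for i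
        using Suc.prems by (intro Suc.IH Ck_on_Suc_bderiv assms(3)) (auto intro: Ck_on_pred)
      ultimately show ?thesis
        by (rule Ck_on_sum[OF assms(2) Ck_on_bilinear[OF assms(2) bounded_bilinear_scaleR]])
    qed
  qed (use assms in auto)
qed

lemma smooth_on_differentiable: "smooth_on S f \<Longrightarrow> x \<in> S \<Longrightarrow> f differentiable (at x)"
  using Ck_on.simps(2)[of 0 S f] unfolding smooth_on_def by blast

lemma smooth_on_continuous_on: "smooth_on S f \<Longrightarrow> continuous_on S f"
  using Ck_on.simps(1)[of S f] unfolding smooth_on_def by blast

lemma smooth_on_has_derivative:
  "smooth_on S f \<Longrightarrow> x \<in> S \<Longrightarrow> (f has_derivative blinfun_apply (bderiv f x)) (at x)"
  by (intro has_derivative_bderiv smooth_on_differentiable)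

lemma smooth_on_cong: "open S \<Longrightarrow> smooth_on S f \<Longrightarrow> (\<And>x. x \<in> S \<Longrightarrow> f x = g x) \<Longrightarrow> smooth_on S g"
  unfolding smooth_on_def using Ck_on_cong by blast

lemma smooth_on_subset: "smooth_on S f \<Longrightarrow> T \<subseteq> S \<Longrightarrow> smooth_on T f"
  unfolding smooth_on_def using Ck_on_subset by blast

lemma smooth_on_local:
  "(\<And>x. x \<in> S \<Longrightarrow> \<exists>T. open T \<and> x \<in> T \<and> smooth_on T f) \<Longrightarrow> smooth_on S f"
  unfolding smooth_on_def by (intro allI Ck_on_local) metis

lemma smooth_on_const: "open S \<Longrightarrow> smooth_on S (\<lambda>x. c)"
  unfolding smooth_on_def by (simp add: Ck_on_const)

lemma smooth_on_id: "open S \<Longrightarrow> smooth_on S (\<lambda>x. x)"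
  unfolding smooth_on_def by (simp add: Ck_on_id)

lemma smooth_on_linear:
  "open S \<Longrightarrow> bounded_linear L \<Longrightarrow> smooth_on S f \<Longrightarrow> smooth_on S (\<lambda>x. L (f x))"
  unfolding smooth_on_def by (simp add: Ck_on_linear)

lemma smooth_on_add:
  "open S \<Longrightarrow> smooth_on S f \<Longrightarrow> smooth_on S g \<Longrightarrow> smooth_on S (\<lambda>x. f x + g x)"
  unfolding smooth_on_def by (simp add: Ck_on_add)

lemma smooth_on_bilinear:
  "open S \<Longrightarrow> bounded_bilinear B \<Longrightarrow> smooth_on S f \<Longrightarrow> smooth_on S g \<Longrightarrow> smooth_on S (\<lambda>x. B (f x) (g x))"
  unfolding smooth_on_def by (simp add: Ck_on_bilinear)

lemmas smooth_on_scaleR = smooth_on_bilinear[OF _ bounded_bilinear_scaleR]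
  and smooth_on_apply = smooth_on_bilinear[OF _ bounded_bilinear_blinfun_apply]
  and smooth_on_blinfun_compose = smooth_on_bilinear[OF _ bounded_bilinear_blinfun_compose]

lemma smooth_on_sum:
  "open S \<Longrightarrow> (\<And>i. i \<in> I \<Longrightarrow> smooth_on S (f i)) \<Longrightarrow> smooth_on S (\<lambda>x. \<Sum>i\<in>I. f i x)"
  unfolding smooth_on_def by (simp add: Ck_on_sum)

lemma smooth_on_tsum:
  "open S \<Longrightarrow> (\<And>a b. smooth_on S (\<lambda>x. F x a b)) \<Longrightarrow> smooth_on S (\<lambda>x. tsum G (F x))"
  unfolding tsum_def by (intro smooth_on_sum smooth_on_scaleR[OF _ smooth_on_const])

lemma smooth_on_compose:
  fixes f :: "'a::real_normed_vector \<Rightarrow> 'b::real_normed_vector"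
  assumes "fin_dim (UNIV :: 'b set)" "open S" "open T" "\<And>x. x \<in> S \<Longrightarrow> f x \<in> T"
    "smooth_on S f" "smooth_on T g"
  shows "smooth_on S (\<lambda>x. g (f x))"
  unfolding smooth_on_def
proof
  show "Ck_on k S (\<lambda>x. g (f x))" for k
    by (rule Ck_on_compose[where f = f and g = g, OF assms(1-4)])
      (use assms(5,6) in \<open>simp_all add: smooth_on_def\<close>)
qed

lemma smooth_on_Pair:
  assumes "open S" "smooth_on S f" "smooth_on S g"
  shows "smooth_on S (\<lambda>x. (f x, g x))"
proof -
  have 1: "bounded_linear (\<lambda>v::'b. (v, 0::'c))" and 2: "bounded_linear (\<lambda>v::'c. (0::'b, v))"
    by (intro bounded_linear_Pair bounded_linear_ident bounded_linear_zero)+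
  have "smooth_on S (\<lambda>x. (f x, 0) + (0, g x))"
    by (rule smooth_on_add[OF assms(1) smooth_on_linear[OF assms(1) 1 assms(2)]
          smooth_on_linear[OF assms(1) 2 assms(3)]])
  then show ?thesis by simp
qed

text \<open>Passes from smoothness of each value to smoothness in operator norm: over a frame the
  operator is a finite sum of rank-one operators, each depending linearly on one of these
  values.\<close>

lemma smooth_on_blinfunI:
  fixes f :: "'c::real_normed_vector \<Rightarrow> 'a::real_normed_vector \<Rightarrow>\<^sub>L 'b::real_normed_vector"
  assumes "fin_dim (UNIV :: 'a set)" "open S" "\<And>v. smooth_on S (\<lambda>x. f x \<cdot> v)"
  shows "smooth_on S f"
proof -
  obtain n and b :: "nat \<Rightarrow> 'a" and \<beta> where fr: "frame n b \<beta>"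
    using frame_exists[OF assms(1)] .
  have bl: "bounded_linear (\<lambda>w::'b. blinfun_scaleR_left w o\<^sub>L \<gamma>)" for \<gamma> :: "'a dual"
    by (rule bounded_linear_compose[OF bounded_bilinear.bounded_linear_left[OF bounded_bilinear_blinfun_compose]
        bounded_linear_blinfun_scaleR_left])
  have "smooth_on S (\<lambda>x. \<Sum>i<n. blinfun_scaleR_left (f x \<cdot> b i) o\<^sub>L \<beta> i)"
    by (rule smooth_on_sum[OF assms(2) smooth_on_linear[OF assms(2) bl assms(3)]])
  moreover have "(\<Sum>i<n. blinfun_scaleR_left (f x \<cdot> b i) o\<^sub>L \<beta> i) = f x" for x
    by (intro blinfun_eqI) (simp add: blinfun.sum_left frame_sum[OF fr])
  ultimately show ?thesis by simp
qed

lemma smooth_on_bderiv_apply: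
  "open S \<Longrightarrow> smooth_on S f \<Longrightarrow> smooth_on S (\<lambda>x. bderiv f x \<cdot> v)"
  unfolding smooth_on_def by (simp add: Ck_on_Suc_bderiv del: Ck_on.simps)

lemma smooth_on_bderiv:
  fixes f :: "'a::real_normed_vector \<Rightarrow> 'b::real_normed_vector"
  assumes "fin_dim (UNIV :: 'a set)" "open S" "smooth_on S f"
  shows "smooth_on S (bderiv f)"
  by (rule smooth_on_blinfunI[OF assms(1,2) smooth_on_bderiv_apply[OF assms(2,3)]])

section \<open>Symmetry of second derivatives\<close>

lemma bderiv_apply_const:
  assumes "F differentiable (at x)"
  shows "bderiv (\<lambda>y. F y \<cdot> w) x \<cdot> v = bderiv F x \<cdot> v \<cdot> w"
  by (rule fun_cong[OF blinfun_apply_bderiv[OF bounded_linear.has_derivative[OF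
        blinfun.bounded_linear_left has_derivative_bderiv[OF assms]]]])

text \<open>The mean value theorem is used twice: for the increment along w as a function of s, and
  for the derivative along v as a function of t. The second difference on the left is symmetric in v
  and w, which is what makes the lemma useful.\<close>

lemma second_difference_mean_value:
  fixes f :: "'a::real_normed_vector \<Rightarrow> real"
  assumes S: "open S" "smooth_on S f" and r: "r > 0"
    and box: "\<And>s t. 0 \<le> s \<Longrightarrow> s \<le> r \<Longrightarrow> 0 \<le> t \<Longrightarrow> t \<le> r \<Longrightarrow> x + s *\<^sub>R v + t *\<^sub>R w \<in> S"
  shows "\<exists>s t. 0 \<le> s \<and> s \<le> r \<and> 0 \<le> t \<and> t \<le> r \<and>
    f (x + r *\<^sub>R v + r *\<^sub>R w) - f (x + r *\<^sub>R v) - f (x + r *\<^sub>R w) + f x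
    = r * (r * bderiv (\<lambda>y. bderiv f y \<cdot> v) (x + s *\<^sub>R v + t *\<^sub>R w) \<cdot> w)"
proof -
  define D where "D y = bderiv f y \<cdot> v" for y
  have smD: "smooth_on S D" unfolding D_def using S by (rule smooth_on_bderiv_apply)
  define h where "h s = f (x + s *\<^sub>R v + r *\<^sub>R w) - f (x + s *\<^sub>R v)" for s
  have dh: "(h has_real_derivative (D (x + s *\<^sub>R v + r *\<^sub>R w) - D (x + s *\<^sub>R v))) (at s)"
    if "0 \<le> s" "s \<le> r" for s
  proof -
    have 1: "((\<lambda>s. x + s *\<^sub>R v + r *\<^sub>R w) has_derivative (\<lambda>h. h *\<^sub>R v)) (at s)"
      "((\<lambda>s. x + s *\<^sub>R v) has_derivative (\<lambda>h. h *\<^sub>R v)) (at s)"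
      by (auto intro!: derivative_eq_intros)
    have "(h has_derivative (\<lambda>h. bderiv f (x + s *\<^sub>R v + r *\<^sub>R w) \<cdot> (h *\<^sub>R v)
        - bderiv f (x + s *\<^sub>R v) \<cdot> (h *\<^sub>R v))) (at s)"
      unfolding h_def using box[of s r] box[of s 0] that r
      by (intro has_derivative_diff has_derivative_compose[OF 1(1)] has_derivative_compose[OF 1(2)]
          smooth_on_has_derivative[OF S(2)]) auto
    then show ?thesis
      unfolding has_field_derivative_def D_def
      by (simp add: blinfun.scaleR_right right_diff_distrib[symmetric] mult_commute_abs)
  qed
  obtain s where s: "0 < s" "s < r" "h r - h 0 = r * (D (x + s *\<^sub>R v + r *\<^sub>R w) - D (x + s *\<^sub>R v))"
    using MVT2[OF r, of h "\<lambda>s. D (x + s *\<^sub>R v + r *\<^sub>R w) - D (x + s *\<^sub>R v)"] dh by auto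
  have dk: "((\<lambda>t. D (x + s *\<^sub>R v + t *\<^sub>R w)) has_real_derivative
      bderiv D (x + s *\<^sub>R v + t *\<^sub>R w) \<cdot> w) (at t)" if "0 \<le> t" "t \<le> r" for t
  proof -
    have 1: "((\<lambda>t. x + s *\<^sub>R v + t *\<^sub>R w) has_derivative (\<lambda>h. h *\<^sub>R w)) (at t)"
      by (rule derivative_eq_intros refl | simp)+
    have "((\<lambda>t. D (x + s *\<^sub>R v + t *\<^sub>R w)) has_derivative
        (\<lambda>h. bderiv D (x + s *\<^sub>R v + t *\<^sub>R w) \<cdot> (h *\<^sub>R w))) (at t)"
      using box[of s t] that s
      by (intro has_derivative_compose[OF 1] smooth_on_has_derivative[OF smD]) auto
    then show ?thesis
      unfolding has_field_derivative_def
      by (simp add: blinfun.scaleR_right mult_commute_abs)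
  qed
  obtain t where t: "0 < t" "t < r" "D (x + s *\<^sub>R v + r *\<^sub>R w) - D (x + s *\<^sub>R v + 0 *\<^sub>R w)
      = (r - 0) * bderiv D (x + s *\<^sub>R v + t *\<^sub>R w) \<cdot> w"
    using MVT2[OF r, of "\<lambda>t. D (x + s *\<^sub>R v + t *\<^sub>R w)"
        "\<lambda>t. bderiv D (x + s *\<^sub>R v + t *\<^sub>R w) \<cdot> w"] dk by auto
  have "f (x + r *\<^sub>R v + r *\<^sub>R w) - f (x + r *\<^sub>R v) - f (x + r *\<^sub>R w) + f x = h r - h 0"
    by (simp add: h_def)
  also have "\<dots> = r * (r * bderiv D (x + s *\<^sub>R v + t *\<^sub>R w) \<cdot> w)"
    using s(3) t(3) by simp
  finally show ?thesis
    using s t unfolding D_def by (intro exI[of _ s] exI[of _ t]) auto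
qed

text \<open>Over a small square the second difference is r^2 times either mixed derivative, each at
  some point of the square. Continuity of both mixed derivatives at x then excludes a gap between
  their values.\<close>

lemma second_derivative_symmetric_real:
  fixes f :: "'a::real_normed_vector \<Rightarrow> real"
  assumes S: "open S" "smooth_on S f" and x: "x \<in> S"
  shows "bderiv (\<lambda>y. bderiv f y \<cdot> v) x \<cdot> w = bderiv (\<lambda>y. bderiv f y \<cdot> w) x \<cdot> v" (is "?A x = ?B x")
proof (rule ccontr)
  assume neq: "?A x \<noteq> ?B x"
  \<comment> \<open>Half of the gap, so that two errors smaller than \<open>e\<close> cannot close
    it.\<close>
  define e where "e = \<bar>?A x - ?B x\<bar> / 2"
  have e: "e > 0" using neq by (simp add: e_def)
  have cA: "continuous_on S ?A" and cB: "continuous_on S ?B"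
    by (rule smooth_on_continuous_on[OF smooth_on_bderiv_apply[OF S(1) smooth_on_bderiv_apply[OF S]]])+
  obtain d0 where d0: "d0 > 0" "ball x d0 \<subseteq> S" using S(1) x by (meson openE)
  obtain d1 where d1: "d1 > 0" "\<And>y. y \<in> S \<Longrightarrow> dist y x < d1 \<Longrightarrow> dist (?A y) (?A x) < e"
    using cA[unfolded continuous_on_iff, rule_format, OF x e] by blast
  obtain d2 where d2: "d2 > 0" "\<And>y. y \<in> S \<Longrightarrow> dist y x < d2 \<Longrightarrow> dist (?B y) (?B x) < e"
    using cB[unfolded continuous_on_iff, rule_format, OF x e] by blast
  define d where "d = min d0 (min d1 d2)"
  have d: "d > 0" using d0 d1 d2 by (simp add: d_def)
  \<comment> \<open>The summand 1 keeps \<open>N\<close> positive when v = w = 0. With r = d / N the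
    whole square stays within distance d of x.\<close>
  define N where "N = 2 * (norm v + norm w + 1)"
  have "0 < 2 * (z + 1) \<and> z < 2 * (z + 1)" if "z \<ge> 0" for z :: real using that by auto
  then have N1: "N > 0" and N2: "norm v + norm w < N"
    unfolding N_def using add_nonneg_nonneg[OF norm_ge_zero norm_ge_zero] by metis+
  define r where "r = d / N"
  have r: "r > 0" and rN: "r * N = d" using d N1 by (simp_all add: r_def)
  have near: "dist (x + s *\<^sub>R v + t *\<^sub>R w) x < d" if "0 \<le> s" "s \<le> r" "0 \<le> t" "t \<le> r" for s t
  proof -
    have "dist (x + s *\<^sub>R v + t *\<^sub>R w) x = norm (s *\<^sub>R v + t *\<^sub>R w)" by (simp add: dist_norm)
    also have "\<dots> \<le> s * norm v + t * norm w"
      using that norm_triangle_ineq[of "s *\<^sub>R v" "t *\<^sub>R w"] by simp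
    also have "\<dots> \<le> r * norm v + r * norm w"
      using that by (intro add_mono mult_right_mono) auto
    also have "\<dots> = r * (norm v + norm w)" by (simp add: distrib_left)
    also have "\<dots> < r * N" using N2 r by simp
    finally show ?thesis using rN by simp
  qed
  have inS: "x + s *\<^sub>R v + t *\<^sub>R w \<in> S" if "0 \<le> s" "s \<le> r" "0 \<le> t" "t \<le> r" for s t
    using near[OF that] d0 by (auto simp: d_def dist_commute)
  obtain s t where st: "0 \<le> s" "s \<le> r" "0 \<le> t" "t \<le> r"
    "f (x + r *\<^sub>R v + r *\<^sub>R w) - f (x + r *\<^sub>R v) - f (x + r *\<^sub>R w) + f x
      = r * (r * ?A (x + s *\<^sub>R v + t *\<^sub>R w))"
    using second_difference_mean_value[OF S r inS] by blast
  have inS': "x + s *\<^sub>R w + t *\<^sub>R v \<in> S" if "0 \<le> s" "s \<le> r" "0 \<le> t" "t \<le> r" for s t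
    using inS[OF that(3,4,1,2)] by (simp add: add_ac)
  obtain s' t' where st': "0 \<le> s'" "s' \<le> r" "0 \<le> t'" "t' \<le> r"
    "f (x + r *\<^sub>R w + r *\<^sub>R v) - f (x + r *\<^sub>R w) - f (x + r *\<^sub>R v) + f x
      = r * (r * ?B (x + s' *\<^sub>R w + t' *\<^sub>R v))"
    using second_difference_mean_value[OF S r inS'] by blast
  have "r * (r * ?A (x + s *\<^sub>R v + t *\<^sub>R w)) = r * (r * ?B (x + s' *\<^sub>R w + t' *\<^sub>R v))"
    unfolding st(5)[symmetric] st'(5)[symmetric] by (simp add: add_ac)
  then have AB: "?A (x + s *\<^sub>R v + t *\<^sub>R w) = ?B (x + t' *\<^sub>R v + s' *\<^sub>R w)"
    using r by (simp add: add_ac)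
  have "dist (?A (x + s *\<^sub>R v + t *\<^sub>R w)) (?A x) < e"
    using near[OF st(1-4)] by (intro d1(2) inS[OF st(1-4)]) (simp add: d_def)
  moreover have "dist (?B (x + t' *\<^sub>R v + s' *\<^sub>R w)) (?B x) < e"
    using near[OF st'(3,4,1,2)] by (intro d2(2) inS[OF st'(3,4,1,2)]) (simp add: d_def)
  ultimately show False
    unfolding AB e_def dist_real_def by (simp add: abs_if split: if_splits)
qed

lemma bderiv_linear:
  assumes "bounded_linear L" "f differentiable (at x)"
  shows "bderiv (\<lambda>y. L (f y)) x \<cdot> v = L (bderiv f x \<cdot> v)"
  by (rule fun_cong[OF blinfun_apply_bderiv[OF bounded_linear.has_derivative[OF assms(1)
        has_derivative_bderiv[OF assms(2)]]]])

text \<open>Functionals commute with both derivatives and separate points, which reduces the claim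
  to real-valued functions.\<close>

lemma second_derivative_symmetric:
  fixes f :: "'a::real_normed_vector \<Rightarrow> 'b::real_normed_vector"
  assumes fd: "fin_dim (UNIV :: 'b set)" and S: "open S" "smooth_on S f" and x: "x \<in> S"
  shows "bderiv (\<lambda>y. bderiv f y \<cdot> v) x \<cdot> w = bderiv (\<lambda>y. bderiv f y \<cdot> w) x \<cdot> v"
proof (rule fin_dim_functionals_separate[OF fd])
  fix \<gamma> :: "'b dual"
  have *: "\<gamma> \<cdot> (bderiv (\<lambda>y. bderiv f y \<cdot> v) x \<cdot> w)
      = bderiv (\<lambda>y. bderiv (\<lambda>y. \<gamma> \<cdot> f y) y \<cdot> v) x \<cdot> w" for v w
  proof -
    have "\<gamma> \<cdot> (bderiv (\<lambda>y. bderiv f y \<cdot> v) x \<cdot> w) = bderiv (\<lambda>y. \<gamma> \<cdot> (bderiv f y \<cdot> v)) x \<cdot> w"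
      by (rule bderiv_linear[symmetric, OF blinfun.bounded_linear_right
            smooth_on_differentiable[OF smooth_on_bderiv_apply[OF S] x]])
    also have "bderiv (\<lambda>y. \<gamma> \<cdot> (bderiv f y \<cdot> v)) x = bderiv (\<lambda>y. bderiv (\<lambda>y. \<gamma> \<cdot> f y) y \<cdot> v) x"
    proof (rule bderiv_cong_open(1)[OF _ S(1) x, symmetric])
      show "(\<lambda>y. \<gamma> \<cdot> (bderiv f y \<cdot> v)) differentiable at x"
        by (rule smooth_on_differentiable[OF smooth_on_linear[OF S(1) blinfun.bounded_linear_right
              smooth_on_bderiv_apply[OF S]] x])
      show "\<gamma> \<cdot> (bderiv f y \<cdot> v) = bderiv (\<lambda>y. \<gamma> \<cdot> f y) y \<cdot> v" if "y \<in> S" for y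
        by (rule bderiv_linear[symmetric, OF blinfun.bounded_linear_right smooth_on_differentiable[OF S(2) that]])
    qed
    finally show ?thesis .
  qed
  show "\<gamma> \<cdot> (bderiv (\<lambda>y. bderiv f y \<cdot> v) x \<cdot> w) = \<gamma> \<cdot> (bderiv (\<lambda>y. bderiv f y \<cdot> w) x \<cdot> v)"
    unfolding *
    by (rule second_derivative_symmetric_real[OF S(1) smooth_on_linear[OF S(1) blinfun.bounded_linear_right S(2)] x])
qed

section \<open>Charts, tangent maps and coordinate expressions\<close>

lemma blinfun_compose_assoc: "(A o\<^sub>L B) o\<^sub>L C = A o\<^sub>L (B o\<^sub>L C)"
  by (intro blinfun_eqI) simp

text \<open>The Jacobian of \<open>f\<close> at \<open>x\<close> in the charts \<open>M q\<close> and \<open>N r\<close>, meaningful only if \<open>x\<close> and \<open>f x\<close> lie in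
  their domains.  With \<open>f = id\<close> it is a change of charts.\<close>

definition locd :: "('m, 'e::real_normed_vector) atlas \<Rightarrow> 'm \<Rightarrow> ('n, 'f::real_normed_vector) atlas \<Rightarrow> 'n \<Rightarrow>
    ('m \<Rightarrow> 'n) \<Rightarrow> 'm \<Rightarrow> 'e \<Rightarrow>\<^sub>L 'f" where
  "locd M q N r f x = bderiv (cmap N r \<circ> f \<circ> cinv M q) (cmap M q x)"

lemma tangent_map_eq_locd: "tangent_map M N f x = locd M x N (f x) f x"
  by (simp add: tangent_map_def locd_def)

lemma chart_deriv_eq_locd: "chart_deriv M q x = locd M x M q id x"
  by (simp add: chart_deriv_def locd_def)

context
  fixes M :: "('m::{t2_space, second_countable_topology}, 'e::real_normed_vector) atlas"
  assumes M: "smooth_manifold M"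
begin

lemma fin_dim_model: "fin_dim (UNIV :: 'e set)"
  and mem_cdom [simp]: "p \<in> cdom M p"
  and open_cdom: "open (cdom M p)"
  and open_cimg: "open (cimg M p)"
  and chart_homeomorphism: "homeomorphism (cdom M p) (cimg M p) (cmap M p) (cinv M p)"
  using M unfolding smooth_manifold_def by blast+

lemma cinv_cmap: "x \<in> cdom M q \<Longrightarrow> cinv M q (cmap M q x) = x"
  and cmap_cinv: "y \<in> cimg M q \<Longrightarrow> cmap M q (cinv M q y) = y"
  and cinv_mem: "y \<in> cimg M q \<Longrightarrow> cinv M q y \<in> cdom M q"
  using chart_homeomorphism[of q] unfolding homeomorphism_def by blast+

lemma cmap_mem: "x \<in> cdom M q \<Longrightarrow> cmap M q x \<in> cimg M q"
  by (simp add: cimg_def)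

lemma cmap_image_eq: "cmap M q ` (cdom M q \<inter> U) = {y \<in> cimg M q. cinv M q y \<in> U}"
  using cinv_cmap cmap_cinv cinv_mem cmap_mem by (auto simp: image_iff) (metis IntI)

lemma open_cmap_image: "open U \<Longrightarrow> open (cmap M q ` (cdom M q \<inter> U))"
proof -
  assume U: "open U"
  have "continuous_on (cimg M q) (cinv M q)"
    using chart_homeomorphism[of q] unfolding homeomorphism_def by blast
  from continuous_open_preimage[OF this open_cimg U]
  have "open (cimg M q \<inter> cinv M q -` U)" .
  also have "cimg M q \<inter> cinv M q -` U = cmap M q ` (cdom M q \<inter> U)"
    unfolding cmap_image_eq by auto
  finally show ?thesis .
qed

lemma smooth_map_id: "smooth_map M M id"
  using M unfolding smooth_map_def smooth_manifold_def by (simp add: continuous_on_id)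

end

lemma smooth_map_locrep:
  "smooth_map M N f \<Longrightarrow> smooth_on (cmap M q ` (cdom M q \<inter> f -` cdom N r)) (cmap N r \<circ> f \<circ> cinv M q)"
  unfolding smooth_map_def by blast

lemma open_locrep_domain:
  fixes M :: "('m::{t2_space, second_countable_topology}, 'e::real_normed_vector) atlas"
    and N :: "('n::{t2_space, second_countable_topology}, 'f::real_normed_vector) atlas"
  assumes "smooth_manifold M" "smooth_manifold N" "smooth_map M N f"
  shows "open (cmap M q ` (cdom M q \<inter> f -` cdom N r))" "open (f -` cdom N r)"
proof -
  have "continuous_on UNIV f" using assms(3) by (simp add: smooth_map_def)
  then show "open (f -` cdom N r)" using open_cdom[OF assms(2)] by (simp add: open_vimage)
  then show "open (cmap M q ` (cdom M q \<inter> f -` cdom N r))" by (rule open_cmap_image[OF assms(1)])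
qed

lemma locd_has_derivative:
  assumes "smooth_map M N f" "x \<in> cdom M q" "f x \<in> cdom N r"
  shows "((cmap N r \<circ> f \<circ> cinv M q) has_derivative blinfun_apply (locd M q N r f x)) (at (cmap M q x))"
  unfolding locd_def using assms
  by (intro smooth_on_has_derivative[OF smooth_map_locrep[OF assms(1)]]) auto

text \<open>The chain rule with a free choice of all three charts. With identity maps among the
  factors it also serves as the rule for changing charts.\<close>

lemma locd_compose:
  fixes M :: "('m::{t2_space, second_countable_topology}, 'e::real_normed_vector) atlas"
    and N :: "('n::{t2_space, second_countable_topology}, 'f::real_normed_vector) atlas"
    and Q :: "('q::{t2_space, second_countable_topology}, 'g::real_normed_vector) atlas"
  assumes man: "smooth_manifold M" "smooth_manifold N"
    and sm: "smooth_map M N f" "smooth_map N Q g"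
    and x: "x \<in> cdom M q" "f x \<in> cdom N r" "g (f x) \<in> cdom Q s"
  shows "locd M q Q s (g \<circ> f) x = locd N r Q s g (f x) o\<^sub>L locd M q N r f x"
proof -
  have cx: "cinv M q (cmap M q x) = x" by (rule cinv_cmap[OF man(1) x(1)])
  have 1: "((cmap N r \<circ> f \<circ> cinv M q) has_derivative blinfun_apply (locd M q N r f x)) (at (cmap M q x))"
    by (rule locd_has_derivative[OF sm(1) x(1,2)])
  have 2: "((cmap Q s \<circ> g \<circ> cinv N r) has_derivative blinfun_apply (locd N r Q s g (f x)))
      (at ((cmap N r \<circ> f \<circ> cinv M q) (cmap M q x)))"
    using locd_has_derivative[OF sm(2) x(2,3)] cx by simp
  have 3: "((cmap Q s \<circ> (g \<circ> f) \<circ> cinv M q) has_derivative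
      blinfun_apply (locd N r Q s g (f x) o\<^sub>L locd M q N r f x)) (at (cmap M q x))"
  proof (rule has_derivative_cong_open[OF _ open_locrep_domain(1)[OF man sm(1), of q r]])
    show "((cmap Q s \<circ> g \<circ> cinv N r) \<circ> (cmap N r \<circ> f \<circ> cinv M q) has_derivative
        blinfun_apply (locd N r Q s g (f x) o\<^sub>L locd M q N r f x)) (at (cmap M q x))"
      using diff_chain_at[OF 1 2] by (simp only: blinfun_compose.rep_eq)
    show "cmap M q x \<in> cmap M q ` (cdom M q \<inter> f -` cdom N r)" using x by auto
    show "((cmap Q s \<circ> g \<circ> cinv N r) \<circ> (cmap N r \<circ> f \<circ> cinv M q)) y
        = (cmap Q s \<circ> (g \<circ> f) \<circ> cinv M q) y" if "y \<in> cmap M q ` (cdom M q \<inter> f -` cdom N r)" for y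
      using that by (auto simp: cinv_cmap[OF man(1)] cinv_cmap[OF man(2)])
  qed
  show ?thesis
    unfolding locd_def[of M q Q] using blinfun_apply_bderiv[OF 3] by (simp add: blinfun_apply_inject)
qed

lemma locd_id:
  fixes M :: "('m::{t2_space, second_countable_topology}, 'e::real_normed_vector) atlas"
  assumes "smooth_manifold M" "x \<in> cdom M q"
  shows "locd M q M q id x = id_blinfun"
proof -
  have "((\<lambda>y. y) has_derivative blinfun_apply (id_blinfun :: 'e \<Rightarrow>\<^sub>L 'e)) (at (cmap M q x))"
    by (simp add: id_blinfun.rep_eq)
  then have "((cmap M q \<circ> id \<circ> cinv M q) has_derivative blinfun_apply (id_blinfun :: 'e \<Rightarrow>\<^sub>L 'e)) (at (cmap M q x))"
    by (rule has_derivative_cong_open[OF _ open_cimg[OF assms(1)] cmap_mem[OF assms]])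
      (simp add: cmap_cinv[OF assms(1)])
  from blinfun_apply_bderiv[OF this] show ?thesis
    unfolding locd_def by (intro blinfun_eqI) simp
qed

text \<open>Covectors are transported against the direction of vectors, so the Jacobian runs from
  the chart q to the chart at the point, opposite to the one in \<open>vf_rep\<close>.\<close>

definition form_rep :: "('m, 'e::real_normed_vector) atlas \<Rightarrow> 'm \<Rightarrow> ('m \<Rightarrow> 'e dual) \<Rightarrow> 'e \<Rightarrow> 'e dual" where
  "form_rep M q \<theta> y = \<theta> (cinv M q y) o\<^sub>L locd M q M (cinv M q y) id (cinv M q y)"

definition smooth_form :: "('m, 'e::real_normed_vector) atlas \<Rightarrow> ('m \<Rightarrow> 'e dual) \<Rightarrow> bool" where
  "smooth_form M \<theta> \<longleftrightarrow> (\<forall>q. smooth_on (cimg M q) (form_rep M q \<theta>))"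

text \<open>\<open>Dvf\<close>, \<open>Dt2\<close> and \<open>Dform\<close> are first jets in the
  preferred chart at x and depend on that chart. Only combinations such as
  \<open>lie_bracket\<close>, \<open>lie_deriv2\<close> and \<open>ext_deriv\<close> have invariant
  meaning; \<open>Dfun\<close> is invariant by itself.\<close>

definition Dvf :: "('m, 'e::real_normed_vector) atlas \<Rightarrow> ('m \<Rightarrow> 'e) \<Rightarrow> 'm \<Rightarrow> 'e \<Rightarrow>\<^sub>L 'e" where
  "Dvf M X x = bderiv (vf_rep M x X) (cmap M x x)"

definition Dt2 :: "('m, 'e::real_normed_vector) atlas \<Rightarrow> ('m \<Rightarrow> 'e tensor2) \<Rightarrow> 'm \<Rightarrow> 'e \<Rightarrow>\<^sub>L 'e tensor2" where
  "Dt2 M T x = bderiv (t2_rep M x T) (cmap M x x)"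

definition Dform :: "('m, 'e::real_normed_vector) atlas \<Rightarrow> ('m \<Rightarrow> 'e dual) \<Rightarrow> 'm \<Rightarrow> 'e \<Rightarrow>\<^sub>L 'e dual" where
  "Dform M \<theta> x = bderiv (form_rep M x \<theta>) (cmap M x x)"

definition Dfun :: "('m, 'e::real_normed_vector) atlas \<Rightarrow> ('m \<Rightarrow> 'v::real_normed_vector) \<Rightarrow> 'm \<Rightarrow> 'e \<Rightarrow>\<^sub>L 'v" where
  "Dfun M F x = bderiv (F \<circ> cinv M x) (cmap M x x)"

text \<open>The normalization carries no factor 1/2: d\<theta>(X, Y) = X(\<theta>(Y)) -
  Y(\<theta>(X)) - \<theta>([X, Y]).\<close>

definition ext_deriv :: "('m, 'e::real_normed_vector) atlas \<Rightarrow> ('m \<Rightarrow> 'e dual) \<Rightarrow> 'm \<Rightarrow> 'e \<Rightarrow> 'e \<Rightarrow> real" where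
  "ext_deriv M \<theta> x v w = Dform M \<theta> x \<cdot> v \<cdot> w - Dform M \<theta> x \<cdot> w \<cdot> v"

lemma lie_bracket_eq:
  "lie_bracket M X Y x = Dvf M Y x \<cdot> X x - Dvf M X x \<cdot> Y x"
  by (simp add: lie_bracket_def Dvf_def)

lemma lie_deriv2_eq:
  "lie_deriv2 M X T x = Dt2 M T x \<cdot> X x - act2 (Dvf M X x) (T x)"
  by (simp add: lie_deriv2_def Dvf_def Dt2_def)

lemma lie_deriv2_apply:
  fixes M :: "('m, 'e::real_normed_vector) atlas"
  shows "lie_deriv2 M X T x \<cdot> \<beta> \<cdot> \<gamma> = Dt2 M T x \<cdot> X x \<cdot> \<beta> \<cdot> \<gamma> - T x \<cdot> (\<beta> o\<^sub>L Dvf M X x) \<cdot> \<gamma>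
     - T x \<cdot> \<beta> \<cdot> (\<gamma> o\<^sub>L Dvf M X x)"
proof -
  have [simp]: "\<gamma> o\<^sub>L id_blinfun = \<gamma>" for \<gamma> :: "'e dual"
    by (intro blinfun_eqI) simp
  show ?thesis
    by (simp add: lie_deriv2_eq act2_def blinfun.diff_left blinfun.add_left tmap2_apply)
qed

context
  fixes M :: "('m::{t2_space, second_countable_topology}, 'e::real_normed_vector) atlas"
  assumes M: "smooth_manifold M"
begin

lemma locd_id_inverse:
  assumes "x \<in> cdom M q" "x \<in> cdom M r"
  shows "locd M q M r id x o\<^sub>L locd M r M q id x = id_blinfun"
  using locd_compose[OF M M smooth_map_id[OF M] smooth_map_id[OF M], of x r q r] assms
    locd_id[OF M assms(2)] by simp

lemma locd_id_trans:
  assumes "x \<in> cdom M q" "x \<in> cdom M r" "x \<in> cdom M s"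
  shows "locd M r M s id x o\<^sub>L locd M q M r id x = locd M q M s id x"
  using locd_compose[OF M M smooth_map_id[OF M] smooth_map_id[OF M], of x q r s] assms by simp

lemma vf_rep_eq: "vf_rep M q X y = locd M (cinv M q y) M q id (cinv M q y) \<cdot> X (cinv M q y)"
  by (simp add: vf_rep_def chart_deriv_eq_locd Let_def)

lemma t2_rep_apply:
  "t2_rep M q T y \<cdot> \<alpha> \<cdot> \<beta> = T (cinv M q y) \<cdot>
     (\<alpha> o\<^sub>L locd M (cinv M q y) M q id (cinv M q y)) \<cdot> (\<beta> o\<^sub>L locd M (cinv M q y) M q id (cinv M q y))"
  by (simp add: t2_rep_def chart_deriv_eq_locd Let_def tmap2_apply)

lemma form_rep_pullback_chart:
  assumes "y \<in> cimg M q"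
  shows "form_rep M q \<theta> y o\<^sub>L locd M (cinv M q y) M q id (cinv M q y) = \<theta> (cinv M q y)"
  using locd_id_inverse[OF cinv_mem[OF M assms] mem_cdom[OF M]]
  unfolding form_rep_def by (simp add: blinfun_compose_assoc) (intro blinfun_eqI, simp)

text \<open>In the chart at x the change of charts at x is the identity. Values of fields can thus
  be mixed with their chart derivatives at x without any Jacobian.\<close>

lemma rep_at_center:
  shows vf_rep_center: "vf_rep M x X (cmap M x x) = X x"
    and form_rep_center: "form_rep M x \<theta> (cmap M x x) = \<theta> x"
    and t2_rep_center: "t2_rep M x T (cmap M x x) = T x"
proof -
  have c: "cinv M x (cmap M x x) = x" by (rule cinv_cmap[OF M mem_cdom[OF M]])
  have i: "locd M x M x id x = id_blinfun" by (rule locd_id[OF M mem_cdom[OF M]])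
  have e: "\<gamma> o\<^sub>L id_blinfun = \<gamma>" for \<gamma> :: "'e dual" by (intro blinfun_eqI) simp
  show "vf_rep M x X (cmap M x x) = X x" by (simp add: vf_rep_eq c i)
  show "form_rep M x \<theta> (cmap M x x) = \<theta> x" by (simp add: form_rep_def c i e)
  show "t2_rep M x T (cmap M x x) = T x" by (intro tensor2_eqI) (simp add: t2_rep_apply c i e)
qed

lemma form_rep_vf_rep:
  assumes "y \<in> cimg M q"
  shows "form_rep M q \<theta> y \<cdot> vf_rep M q X y = \<theta> (cinv M q y) \<cdot> X (cinv M q y)"
  unfolding vf_rep_eq
  by (metis form_rep_pullback_chart[OF assms] blinfun_apply_blinfun_compose)

lemma t2_rep_form_rep:
  assumes "y \<in> cimg M q"
  shows "t2_rep M q T y \<cdot> form_rep M q \<alpha> y \<cdot> form_rep M q \<beta> y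
     = T (cinv M q y) \<cdot> \<alpha> (cinv M q y) \<cdot> \<beta> (cinv M q y)"
  unfolding t2_rep_apply form_rep_pullback_chart[OF assms] ..

lemma vf_rep_contract:
  assumes "y \<in> cimg M q"
  shows "vf_rep M q (\<lambda>x. contract (T x) (\<alpha> x)) y = contract (t2_rep M q T y) (form_rep M q \<alpha> y)"
proof (rule fin_dim_functionals_separate[OF fin_dim_model[OF M]])
  fix \<gamma> :: "'e dual"
  let ?L = "locd M (cinv M q y) M q id (cinv M q y)"
  have "\<gamma> \<cdot> vf_rep M q (\<lambda>x. contract (T x) (\<alpha> x)) y
      = (\<gamma> o\<^sub>L ?L) \<cdot> contract (T (cinv M q y)) (\<alpha> (cinv M q y))"
    by (simp add: vf_rep_eq)
  also have "\<dots> = T (cinv M q y) \<cdot> \<alpha> (cinv M q y) \<cdot> (\<gamma> o\<^sub>L ?L)"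
    by (rule apply_contract[OF fin_dim_model[OF M]])
  also have "\<dots> = t2_rep M q T y \<cdot> form_rep M q \<alpha> y \<cdot> \<gamma>"
    unfolding t2_rep_apply form_rep_pullback_chart[OF assms] ..
  also have "\<dots> = \<gamma> \<cdot> contract (t2_rep M q T y) (form_rep M q \<alpha> y)"
    by (rule apply_contract[OF fin_dim_model[OF M], symmetric])
  finally show "\<gamma> \<cdot> vf_rep M q (\<lambda>x. contract (T x) (\<alpha> x)) y
      = \<gamma> \<cdot> contract (t2_rep M q T y) (form_rep M q \<alpha> y)" .
qed

lemma smooth_vf_rep: "smooth_vf_on M UNIV X \<Longrightarrow> smooth_on (cimg M q) (vf_rep M q X)"
  unfolding smooth_vf_on_def cimg_def by simp

lemma Dvf_has_derivative:
  "smooth_vf_on M UNIV X \<Longrightarrow> (vf_rep M x X has_derivative blinfun_apply (Dvf M X x)) (at (cmap M x x))"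
  unfolding Dvf_def by (rule smooth_on_has_derivative[OF smooth_vf_rep cmap_mem[OF M mem_cdom[OF M]]])

lemma Dt2_has_derivative:
  "smooth_t2 M T \<Longrightarrow> (t2_rep M x T has_derivative blinfun_apply (Dt2 M T x)) (at (cmap M x x))"
  unfolding Dt2_def smooth_t2_def
  using smooth_on_has_derivative[OF _ cmap_mem[OF M mem_cdom[OF M]]] by blast

lemma Dform_has_derivative:
  "smooth_form M \<theta> \<Longrightarrow> (form_rep M x \<theta> has_derivative blinfun_apply (Dform M \<theta> x)) (at (cmap M x x))"
  unfolding Dform_def smooth_form_def
  using smooth_on_has_derivative[OF _ cmap_mem[OF M mem_cdom[OF M]]] by blast

lemma Dfun_pairing_has_derivative:
  assumes "smooth_form M \<theta>" "smooth_vf_on M UNIV X"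
  shows "((\<lambda>x. \<theta> x \<cdot> X x) \<circ> cinv M x has_derivative (\<lambda>v. \<theta> x \<cdot> (Dvf M X x \<cdot> v)
       + Dform M \<theta> x \<cdot> v \<cdot> X x)) (at (cmap M x x))"
proof (rule has_derivative_cong_open[OF _ open_cimg[OF M] cmap_mem[OF M mem_cdom[OF M]]])
  show "((\<lambda>y. form_rep M x \<theta> y \<cdot> vf_rep M x X y) has_derivative (\<lambda>v. \<theta> x \<cdot> (Dvf M X x \<cdot> v)
       + Dform M \<theta> x \<cdot> v \<cdot> X x)) (at (cmap M x x))"
    using bounded_bilinear.FDERIV[OF bounded_bilinear_blinfun_apply Dform_has_derivative[OF assms(1), of x]
        Dvf_has_derivative[OF assms(2), of x]]
    unfolding form_rep_center vf_rep_center .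
qed (simp add: form_rep_vf_rep)

lemma Dfun_pairing:
  assumes "smooth_form M \<theta>" "smooth_vf_on M UNIV X"
  shows "Dfun M (\<lambda>x. \<theta> x \<cdot> X x) x \<cdot> v = \<theta> x \<cdot> (Dvf M X x \<cdot> v) + Dform M \<theta> x \<cdot> v \<cdot> X x"
  unfolding Dfun_def using blinfun_apply_bderiv[OF Dfun_pairing_has_derivative[OF assms]] by simp

lemma Dfun_t2_has_derivative:
  assumes "smooth_t2 M T" "smooth_form M \<alpha>" "smooth_form M \<beta>"
  shows "((\<lambda>x. T x \<cdot> \<alpha> x \<cdot> \<beta> x) \<circ> cinv M x has_derivative (\<lambda>v. T x \<cdot> \<alpha> x \<cdot> (Dform M \<beta> x \<cdot> v)
       + (T x \<cdot> (Dform M \<alpha> x \<cdot> v) + Dt2 M T x \<cdot> v \<cdot> \<alpha> x) \<cdot> \<beta> x)) (at (cmap M x x))"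
proof (rule has_derivative_cong_open[OF _ open_cimg[OF M] cmap_mem[OF M mem_cdom[OF M]]])
  show "((\<lambda>y. t2_rep M x T y \<cdot> form_rep M x \<alpha> y \<cdot> form_rep M x \<beta> y) has_derivative
    (\<lambda>v. T x \<cdot> \<alpha> x \<cdot> (Dform M \<beta> x \<cdot> v) + (T x \<cdot> (Dform M \<alpha> x \<cdot> v)
           + Dt2 M T x \<cdot> v \<cdot> \<alpha> x) \<cdot> \<beta> x)) (at (cmap M x x))"
    using bounded_bilinear.FDERIV[OF bounded_bilinear_blinfun_apply
        bounded_bilinear.FDERIV[OF bounded_bilinear_blinfun_apply Dt2_has_derivative[OF assms(1), of x]
          Dform_has_derivative[OF assms(2), of x]]
        Dform_has_derivative[OF assms(3), of x]]
    unfolding form_rep_center t2_rep_center .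
qed (simp add: t2_rep_form_rep)

lemma Dfun_t2:
  assumes "smooth_t2 M T" "smooth_form M \<alpha>" "smooth_form M \<beta>"
  shows "Dfun M (\<lambda>x. T x \<cdot> \<alpha> x \<cdot> \<beta> x) x \<cdot> v = T x \<cdot> \<alpha> x \<cdot> (Dform M \<beta> x \<cdot> v)
       + T x \<cdot> (Dform M \<alpha> x \<cdot> v) \<cdot> \<beta> x + Dt2 M T x \<cdot> v \<cdot> \<alpha> x \<cdot> \<beta> x"
  unfolding Dfun_def using blinfun_apply_bderiv[OF Dfun_t2_has_derivative[OF assms]]
  by (simp add: blinfun.add_left)

lemma smooth_vf_contract:
  assumes "smooth_t2 M T" "smooth_form M \<alpha>"
  shows "smooth_vf_on M UNIV (\<lambda>x. contract (T x) (\<alpha> x))"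
  unfolding smooth_vf_on_def
proof
  fix q
  obtain n and b :: "nat \<Rightarrow> 'e" and \<beta> where fr: "frame n b \<beta>"
    using frame_exists[OF fin_dim_model[OF M]] .
  have "smooth_on (cimg M q) (\<lambda>y. t2_rep M q T y \<cdot> form_rep M q \<alpha> y \<cdot> \<beta> i *\<^sub>R b i)" for i
    using assms unfolding smooth_t2_def smooth_form_def
    by (intro smooth_on_scaleR smooth_on_apply smooth_on_const open_cimg[OF M]) auto
  then have "smooth_on (cimg M q) (\<lambda>y. \<Sum>i<n. t2_rep M q T y \<cdot> form_rep M q \<alpha> y \<cdot> \<beta> i *\<^sub>R b i)"
    by (rule smooth_on_sum[OF open_cimg[OF M]])
  then have "smooth_on (cimg M q) (vf_rep M q (\<lambda>x. contract (T x) (\<alpha> x)))"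
    by (rule smooth_on_cong[OF open_cimg[OF M]]) (subst vf_rep_contract, simp_all add: contract_apply_frame[OF fr])
  then show "smooth_on (cmap M q ` (cdom M q \<inter> UNIV)) (vf_rep M q (\<lambda>x. contract (T x) (\<alpha> x)))"
    by (simp add: cimg_def)
qed

lemma Dvf_contract:
  assumes "smooth_t2 M T" "smooth_form M \<alpha>"
  shows "\<gamma> \<cdot> (Dvf M (\<lambda>x. contract (T x) (\<alpha> x)) x \<cdot> v) = T x \<cdot> (Dform M \<alpha> x \<cdot> v) \<cdot> \<gamma>
      + Dt2 M T x \<cdot> v \<cdot> \<alpha> x \<cdot> \<gamma>"
proof -
  let ?X = "\<lambda>x. contract (T x) (\<alpha> x)"
  have 1: "((\<lambda>y. \<gamma> \<cdot> vf_rep M x ?X y) has_derivative (\<lambda>v. \<gamma> \<cdot> (Dvf M ?X x \<cdot> v))) (at (cmap M x x))"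
    by (rule bounded_linear.has_derivative[OF blinfun.bounded_linear_right
          Dvf_has_derivative[OF smooth_vf_contract[OF assms]]])
  have "((\<lambda>y. t2_rep M x T y \<cdot> form_rep M x \<alpha> y \<cdot> \<gamma>) has_derivative (\<lambda>v. (T x \<cdot> (Dform M \<alpha> x \<cdot> v)
          + Dt2 M T x \<cdot> v \<cdot> \<alpha> x) \<cdot> \<gamma>)) (at (cmap M x x))"
    using bounded_linear.has_derivative[OF blinfun.bounded_linear_left
        bounded_bilinear.FDERIV[OF bounded_bilinear_blinfun_apply Dt2_has_derivative[OF assms(1), of x]
          Dform_has_derivative[OF assms(2), of x]]]
    unfolding form_rep_center t2_rep_center .
  then have 2: "((\<lambda>y. \<gamma> \<cdot> vf_rep M x ?X y) has_derivative (\<lambda>v. (T x \<cdot> (Dform M \<alpha> x \<cdot> v)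
          + Dt2 M T x \<cdot> v \<cdot> \<alpha> x) \<cdot> \<gamma>)) (at (cmap M x x))"
    by (rule has_derivative_cong_open[OF _ open_cimg[OF M] cmap_mem[OF M mem_cdom[OF M]]])
      (simp add: vf_rep_contract apply_contract[OF fin_dim_model[OF M]])
  show ?thesis
    using fun_cong[OF has_derivative_unique[OF 1 2], of v] by (simp add: blinfun.add_left)
qed

end

section \<open>The tensor field \<sigma> in coordinates\<close>

lemma bounded_bilinear_tens:
  "bounded_bilinear (tens :: 'a::real_normed_vector \<Rightarrow> 'a \<Rightarrow> 'a tensor2)"
proof
  show "tens (a + a') b = tens a b + tens a' b" for a a' b :: 'a
    by (intro tensor2_eqI) (simp add: tens_apply blinfun.add_left blinfun.add_right algebra_simps)
  show "tens a (b + b') = tens a b + tens a b'" for a b b' :: 'a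
    by (intro tensor2_eqI) (simp add: tens_apply blinfun.add_left blinfun.add_right algebra_simps)
  show "tens (r *\<^sub>R a) b = r *\<^sub>R tens a b" for r and a b :: 'a
    by (intro tensor2_eqI) (simp add: tens_apply blinfun.scaleR_left blinfun.scaleR_right)
  show "tens a (r *\<^sub>R b) = r *\<^sub>R tens a b" for r and a b :: 'a
    by (intro tensor2_eqI) (simp add: tens_apply blinfun.scaleR_left blinfun.scaleR_right)
  show "\<exists>K. \<forall>a b :: 'a. norm (tens a b) \<le> norm a * norm b * K"
  proof (intro exI allI)
    fix a b :: 'a
    show "norm (tens a b) \<le> norm a * norm b * 1"
    proof (rule norm_blinfun_bound)
      fix \<alpha> :: "'a dual"
      show "norm (tens a b \<cdot> \<alpha>) \<le> norm a * norm b * 1 * norm \<alpha>"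
      proof (rule norm_blinfun_bound)
        fix \<beta> :: "'a dual"
        have "norm (\<alpha> \<cdot> a * \<beta> \<cdot> b) \<le> (norm \<alpha> * norm a) * (norm \<beta> * norm b)"
          unfolding norm_mult by (intro mult_mono norm_blinfun) auto
        then show "norm (tens a b \<cdot> \<alpha> \<cdot> \<beta>) \<le> norm a * norm b * 1 * norm \<alpha> * norm \<beta>"
          by (simp add: tens_apply mult_ac)
      qed simp
    qed simp
  qed
qed

lemma tsum_apply2:
  "tsum G F \<cdot> \<alpha> \<cdot> \<beta> = tsum G (\<lambda>a b. F a b \<cdot> \<alpha> \<cdot> \<beta>)"
  by (simp add: tsum_def blinfun.sum_left blinfun.scaleR_left)

lemma sigma_apply:
  "sigma G \<rho> \<pi> x \<cdot> \<alpha> \<cdot> \<beta> = \<pi> x \<cdot> \<alpha> \<cdot> \<beta> + (1/2) * tsum G (\<lambda>a b. \<alpha> \<cdot> \<rho> a x * \<beta> \<cdot> \<rho> b x)"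
  by (simp add: sigma_def blinfun.add_left blinfun.scaleR_left tsum_apply2 tens_apply)

lemma has_derivative_tsum:
  assumes "\<And>a b. ((\<lambda>y. F y a b) has_derivative (\<lambda>v. F' v a b)) net"
  shows "((\<lambda>y. tsum G (F y)) has_derivative (\<lambda>v. tsum G (F' v))) net"
  unfolding tsum_def by (intro has_derivative_sum has_derivative_scaleR_right assms)

context
  fixes M :: "('m::{t2_space, second_countable_topology}, 'e::real_normed_vector) atlas"
    and G :: "'g::real_vector quad_lie"
    and \<rho> :: "'g \<Rightarrow> 'm \<Rightarrow> 'e" and \<pi> :: "'m \<Rightarrow> 'e tensor2"
  assumes M: "smooth_manifold M" and \<rho>: "\<And>u. smooth_vf_on M UNIV (\<rho> u)" and \<pi>: "smooth_t2 M \<pi>"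
begin

lemma t2_rep_sigma:
  "t2_rep M q (sigma G \<rho> \<pi>) y
    = t2_rep M q \<pi> y + (1/2) *\<^sub>R tsum G (\<lambda>a b. tens (vf_rep M q (\<rho> a) y) (vf_rep M q (\<rho> b) y))"
  by (intro tensor2_eqI)
    (simp add: t2_rep_apply[OF M] sigma_apply vf_rep_eq[OF M] blinfun.add_left blinfun.scaleR_left
      tsum_apply2 tens_apply)

lemma smooth_t2_sigma: "smooth_t2 M (sigma G \<rho> \<pi>)"
  unfolding smooth_t2_def
proof
  fix q
  have s: "smooth_on (cimg M q) (vf_rep M q (\<rho> a))" for a
    by (rule smooth_vf_rep[OF M \<rho>])
  have "smooth_on (cimg M q) (\<lambda>y. tsum G (\<lambda>a b. tens (vf_rep M q (\<rho> a) y) (vf_rep M q (\<rho> b) y)))"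
    by (rule smooth_on_tsum[OF open_cimg[OF M]
          smooth_on_bilinear[OF open_cimg[OF M] bounded_bilinear_tens s s]])
  then have "smooth_on (cimg M q) (\<lambda>y. t2_rep M q \<pi> y
      + (1/2) *\<^sub>R tsum G (\<lambda>a b. tens (vf_rep M q (\<rho> a) y) (vf_rep M q (\<rho> b) y)))"
    using \<pi> unfolding smooth_t2_def
    by (intro smooth_on_add smooth_on_scaleR smooth_on_const open_cimg[OF M]) auto
  then show "smooth_on (cimg M q) (t2_rep M q (sigma G \<rho> \<pi>))"
    unfolding t2_rep_sigma[abs_def] .
qed

lemma Dt2_sigma:
  "Dt2 M (sigma G \<rho> \<pi>) x \<cdot> v \<cdot> \<beta> \<cdot> \<gamma> = Dt2 M \<pi> x \<cdot> v \<cdot> \<beta> \<cdot> \<gamma>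
   + (1/2) * tsum G (\<lambda>a b. \<beta> \<cdot> (Dvf M (\<rho> a) x \<cdot> v) * \<gamma> \<cdot> \<rho> b x
        + \<beta> \<cdot> \<rho> a x * \<gamma> \<cdot> (Dvf M (\<rho> b) x \<cdot> v))"
proof -
  have d: "(vf_rep M x (\<rho> a) has_derivative blinfun_apply (Dvf M (\<rho> a) x)) (at (cmap M x x))" for a
    by (rule Dvf_has_derivative[OF M \<rho>])
  have "((\<lambda>y. t2_rep M x \<pi> y + (1/2) *\<^sub>R tsum G (\<lambda>a b. tens (vf_rep M x (\<rho> a) y) (vf_rep M x (\<rho> b) y)))
      has_derivative (\<lambda>v. Dt2 M \<pi> x \<cdot> v + (1/2) *\<^sub>R
         tsum G (\<lambda>a b. tens (vf_rep M x (\<rho> a) (cmap M x x)) (Dvf M (\<rho> b) x \<cdot> v)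
           + tens (Dvf M (\<rho> a) x \<cdot> v) (vf_rep M x (\<rho> b) (cmap M x x))))) (at (cmap M x x))"
    by (intro has_derivative_add has_derivative_scaleR_right has_derivative_tsum Dt2_has_derivative[OF M \<pi>]
        bounded_bilinear.FDERIV[OF bounded_bilinear_tens d d])
  from blinfun_apply_bderiv[OF this]
  have "Dt2 M (sigma G \<rho> \<pi>) x \<cdot> v = Dt2 M \<pi> x \<cdot> v + (1/2) *\<^sub>R
         tsum G (\<lambda>a b. tens (\<rho> a x) (Dvf M (\<rho> b) x \<cdot> v) + tens (Dvf M (\<rho> a) x \<cdot> v) (\<rho> b x))"
    unfolding Dt2_def[of M "sigma G \<rho> \<pi>"] t2_rep_sigma[abs_def] vf_rep_center[OF M] by simp
  then show ?thesis
    by (simp add: blinfun.add_left blinfun.scaleR_left tsum_apply2 tens_apply add.commute)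
qed

end

section \<open>Pullbacks\<close>

context
  fixes M :: "('m::{t2_space, second_countable_topology}, 'e::real_normed_vector) atlas"
    and N :: "('n::{t2_space, second_countable_topology}, 'f::real_normed_vector) atlas"
    and f :: "'m \<Rightarrow> 'n"
  assumes M: "smooth_manifold M" and N: "smooth_manifold N" and f: "smooth_map M N f"
begin

text \<open>The Jacobian of f from the chart q to the chart at \<open>f x\<close> is factored in two
  ways, through the chart at x on the source side and through the chart r on the target
  side.\<close>

lemma form_rep_pullback:
  assumes "x \<in> cdom M q" "f x \<in> cdom N r"
  shows "form_rep M q (pullback_form M N f \<theta>) (cmap M q x)
    = form_rep N r \<theta> (cmap N r (f x)) o\<^sub>L locd M q N r f x"
proof -
  have "form_rep M q (pullback_form M N f \<theta>) (cmap M q x)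
      = \<theta> (f x) o\<^sub>L (locd M x N (f x) f x o\<^sub>L locd M q M x id x)"
    by (simp add: form_rep_def cinv_cmap[OF M assms(1)] pullback_form_def tangent_map_eq_locd blinfun_compose_assoc)
  also have "locd M x N (f x) f x o\<^sub>L locd M q M x id x = locd M q N (f x) (f \<circ> id) x"
    by (subst locd_compose[OF M M smooth_map_id[OF M] f, of x q x "f x"])
      (simp_all add: assms mem_cdom[OF M] mem_cdom[OF N])
  also have "\<dots> = locd M q N (f x) (id \<circ> f) x" by simp
  also have "\<dots> = locd N r N (f x) id (f x) o\<^sub>L locd M q N r f x"
    by (rule locd_compose[OF M N f smooth_map_id[OF N]]) (simp_all add: assms mem_cdom[OF N])
  finally show ?thesis
    by (simp add: form_rep_def cinv_cmap[OF N assms(2)] blinfun_compose_assoc)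
qed

lemma form_rep_pullback':
  assumes "y \<in> cmap M q ` (cdom M q \<inter> f -` cdom N r)"
  shows "form_rep M q (pullback_form M N f \<theta>) y
    = form_rep N r \<theta> ((cmap N r \<circ> f \<circ> cinv M q) y) o\<^sub>L bderiv (cmap N r \<circ> f \<circ> cinv M q) y"
proof -
  obtain x where "x \<in> cdom M q" "f x \<in> cdom N r" "y = cmap M q x" using assms by auto
  then show ?thesis
    using form_rep_pullback[of x q r \<theta>] by (simp add: locd_def cinv_cmap[OF M])
qed

lemma smooth_form_pullback:
  assumes "smooth_form N \<theta>"
  shows "smooth_form M (pullback_form M N f \<theta>)"
  unfolding smooth_form_def
proof
  fix q
  show "smooth_on (cimg M q) (form_rep M q (pullback_form M N f \<theta>))"
  proof (rule smooth_on_local)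
    fix y assume y: "y \<in> cimg M q"
    define r where "r = f (cinv M q y)"
    define g where "g = cmap N r \<circ> f \<circ> cinv M q"
    define S where "S = cmap M q ` (cdom M q \<inter> f -` cdom N r)"
    have S: "open S" unfolding S_def by (rule open_locrep_domain(1)[OF M N f])
    have yS: "y \<in> S" unfolding S_def cmap_image_eq[OF M] using y mem_cdom[OF N] by (simp add: r_def)
    have g: "smooth_on S g" unfolding g_def S_def by (rule smooth_map_locrep[OF f])
    have gS: "g z \<in> cimg N r" if "z \<in> S" for z
      using that unfolding S_def g_def by (auto simp: cinv_cmap[OF M] cmap_mem[OF N])
    have "smooth_on (cimg N r) (form_rep N r \<theta>)" using assms by (simp add: smooth_form_def)
    from smooth_on_compose[OF fin_dim_model[OF N] S open_cimg[OF N] gS g this]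
    have "smooth_on S (\<lambda>z. form_rep N r \<theta> (g z))" by simp
    then have "smooth_on S (\<lambda>z. form_rep N r \<theta> (g z) o\<^sub>L bderiv g z)"
      by (rule smooth_on_blinfun_compose[OF S _ smooth_on_bderiv[OF fin_dim_model[OF M] S g]])
    then have "smooth_on S (form_rep M q (pullback_form M N f \<theta>))"
      by (rule smooth_on_cong[OF S]) (simp add: form_rep_pullback' S_def g_def)
    with S yS show "\<exists>T. open T \<and> y \<in> T \<and> smooth_on T (form_rep M q (pullback_form M N f \<theta>))" by blast
  qed
qed

text \<open>Differentiating the pulled-back form produces a term with the second derivative of the
  coordinate expression of f. It is symmetric in v and w and disappears on alternation.\<close>

lemma ext_deriv_pullback:
  assumes "smooth_form N \<theta>"
  shows "ext_deriv M (pullback_form M N f \<theta>) x v w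
    = ext_deriv N \<theta> (f x) (tangent_map M N f x \<cdot> v) (tangent_map M N f x \<cdot> w)"
proof -
  define r where "r = f x"
  define g where "g = cmap N r \<circ> f \<circ> cinv M x"
  define S where "S = cmap M x ` (cdom M x \<inter> f -` cdom N r)"
  define y where "y = cmap M x x"
  have S: "open S" unfolding S_def by (rule open_locrep_domain(1)[OF M N f])
  have yS: "y \<in> S" unfolding S_def y_def using mem_cdom[OF M] mem_cdom[OF N] by (simp add: r_def)
  have g: "smooth_on S g" unfolding g_def S_def by (rule smooth_map_locrep[OF f])
  have gy: "g y = cmap N r (f x)" unfolding g_def y_def by (simp add: cinv_cmap[OF M mem_cdom[OF M]])
  have T: "tangent_map M N f x = bderiv g y" by (simp add: tangent_map_def g_def r_def y_def)
  have dg: "smooth_on S (bderiv g)" by (rule smooth_on_bderiv[OF fin_dim_model[OF M] S g])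
  have d1: "(g has_derivative blinfun_apply (bderiv g y)) (at y)" by (rule smooth_on_has_derivative[OF g yS])
  have d2: "(bderiv g has_derivative blinfun_apply (bderiv (bderiv g) y)) (at y)"
    by (rule smooth_on_has_derivative[OF dg yS])
  have "(form_rep N r \<theta> has_derivative blinfun_apply (Dform N \<theta> r)) (at (g y))"
    using Dform_has_derivative[OF N assms, of r] by (simp add: gy r_def)
  from has_derivative_compose[OF d1 this]
  have "((\<lambda>z. form_rep N r \<theta> (g z)) has_derivative (\<lambda>h. Dform N \<theta> r \<cdot> (bderiv g y \<cdot> h))) (at y)" .
  from bounded_bilinear.FDERIV[OF bounded_bilinear_blinfun_compose this d2]
  have "(form_rep M x (pullback_form M N f \<theta>) has_derivative
      (\<lambda>h. (form_rep N r \<theta> (g y) o\<^sub>L bderiv (bderiv g) y \<cdot> h)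
         + (Dform N \<theta> r \<cdot> (bderiv g y \<cdot> h) o\<^sub>L bderiv g y))) (at y)"
    by (rule has_derivative_cong_open[OF _ S yS]) (simp add: form_rep_pullback' S_def g_def)
  from blinfun_apply_bderiv[OF this]
  have D: "Dform M (pullback_form M N f \<theta>) x \<cdot> v \<cdot> w
      = form_rep N r \<theta> (g y) \<cdot> (bderiv (bderiv g) y \<cdot> v \<cdot> w)
        + Dform N \<theta> r \<cdot> (bderiv g y \<cdot> v) \<cdot> (bderiv g y \<cdot> w)"
    for v w
    by (simp add: Dform_def y_def blinfun.add_left)
  \<comment> \<open>Symmetry of mixed derivatives, which removes the second-order term.\<close>
  have "bderiv (bderiv g) y \<cdot> v \<cdot> w = bderiv (bderiv g) y \<cdot> w \<cdot> v"
    using second_derivative_symmetric[OF fin_dim_model[OF N] S g yS, of w v]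
    unfolding bderiv_apply_const[OF smooth_on_differentiable[OF dg yS]] .
  then show ?thesis unfolding ext_deriv_def D T r_def by simp
qed

lemma Dfun_compose:
  assumes "(F \<circ> cinv N (f x)) differentiable (at (cmap N (f x) (f x)))"
  shows "Dfun M (F \<circ> f) x \<cdot> v = Dfun N F (f x) \<cdot> (tangent_map M N f x \<cdot> v)"
proof -
  have 1: "((cmap N (f x) \<circ> f \<circ> cinv M x) has_derivative blinfun_apply (tangent_map M N f x)) (at (cmap M x x))"
    unfolding tangent_map_eq_locd by (rule locd_has_derivative[OF f mem_cdom[OF M] mem_cdom[OF N]])
  have e: "(cmap N (f x) \<circ> f \<circ> cinv M x) (cmap M x x) = cmap N (f x) (f x)"
    by (simp add: cinv_cmap[OF M mem_cdom[OF M]])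
  have "((F \<circ> cinv N (f x)) \<circ> (cmap N (f x) \<circ> f \<circ> cinv M x) has_derivative
      blinfun_apply (Dfun N F (f x)) \<circ> blinfun_apply (tangent_map M N f x)) (at (cmap M x x))"
    by (rule diff_chain_at[OF 1]) (unfold e Dfun_def, rule has_derivative_bderiv[OF assms])
  then have "((F \<circ> f) \<circ> cinv M x has_derivative
      blinfun_apply (Dfun N F (f x)) \<circ> blinfun_apply (tangent_map M N f x)) (at (cmap M x x))"
  proof (rule has_derivative_cong_open[OF _ open_locrep_domain(1)[OF M N f, of x "f x"]])
    show "cmap M x x \<in> cmap M x ` (cdom M x \<inter> f -` cdom N (f x))" using mem_cdom[OF M] mem_cdom[OF N] by simp
  qed (auto simp: cinv_cmap[OF M] cinv_cmap[OF N])
  from blinfun_apply_bderiv[OF this] show ?thesis unfolding Dfun_def[of M] by simp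
qed

end

section \<open>First-order jets of quasi-Poisson structures\<close>

lemma tsum_add: "tsum G (\<lambda>a b. F a b + F' a b) = tsum G F + tsum G F'"
  by (simp add: tsum_def sum.distrib scaleR_add_right)

lemma tsum_diff: "tsum G (\<lambda>a b. F a b - F' a b) = tsum G F - tsum G F'"
  by (simp add: tsum_def sum_subtractf scaleR_diff_right)

lemma tsum_swap:
  assumes "quadratic_lie_algebra G"
  shows "tsum G (\<lambda>a b. F b a) = tsum G F"
proof -
  have "gcoef G i j = gcoef G j i" if "i < gdim G" "j < gdim G" for i j
    using assms that by (auto simp: quadratic_lie_algebra_def)
  then have "tsum G (\<lambda>a b. F b a) = (\<Sum>i<gdim G. \<Sum>j<gdim G. gcoef G j i *\<^sub>R F (gbasis G j) (gbasis G i))"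
    unfolding tsum_def by (intro sum.cong refl) auto
  also have "\<dots> = tsum G F" unfolding tsum_def by (rule sum.swap)
  finally show ?thesis .
qed

lemma tsum_tsharp_left:
  fixes F :: "'g::real_vector \<Rightarrow> real"
  assumes "linear F"
  shows "tsum G (\<lambda>a b. \<alpha> a * F b) = F (tsharp G \<alpha>)"
  unfolding tsharp_def linear_tsum[OF assms] by (simp add: linear_scale[OF assms])

lemma tsum_tsharp_right:
  fixes F :: "'g::real_vector \<Rightarrow> real"
  assumes "quadratic_lie_algebra G" "linear F"
  shows "tsum G (\<lambda>a b. F a * \<alpha> b) = F (tsharp G \<alpha>)"
  using tsum_tsharp_left[OF assms(2), of G \<alpha>] tsum_swap[OF assms(1), of "\<lambda>a b. F a * \<alpha> b"]
  by (simp add: mult.commute)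

text \<open>\<open>P\<close> and \<open>R\<close> stand for the values, \<open>P'\<close> and
  \<open>R'\<close> for the chart derivatives of \<pi> and \<rho> at one point. The last three
  assumptions are the coordinate forms of the homomorphism property of \<rho>, of invariance of
  \<pi>, and of [\<pi>, \<pi>]/2 = \<rho>(\<phi>).\<close>

locale quasi_poisson_jet =
  fixes G :: "'g::real_vector quad_lie"
    and P :: "'e::real_normed_vector tensor2" and P' :: "'e \<Rightarrow>\<^sub>L 'e tensor2"
    and R :: "'g \<Rightarrow> 'e" and R' :: "'g \<Rightarrow> 'e \<Rightarrow>\<^sub>L 'e"
  assumes G: "quadratic_lie_algebra G"
    and fin_dim: "fin_dim (UNIV :: 'e set)"
    and linear_R: "linear R" and linear_R': "linear (\<lambda>u. R' u \<cdot> w)"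
    and skew_P: "skew P" and skew_P': "skew (P' \<cdot> w)"
    and bracket_R: "R (gbr G u v) = R' v \<cdot> R u - R' u \<cdot> R v"
    and invariant_P: "P' \<cdot> R u \<cdot> \<beta> \<cdot> \<gamma> = P \<cdot> (\<beta> o\<^sub>L R' u) \<cdot> \<gamma> + P \<cdot> \<beta> \<cdot> (\<gamma> o\<^sub>L R' u)"
    and jacobi_P: "P' \<cdot> contract P \<alpha> \<cdot> \<beta> \<cdot> \<gamma> + P' \<cdot> contract P \<beta> \<cdot> \<gamma> \<cdot> \<alpha> + P' \<cdot> contract P \<gamma> \<cdot> \<alpha> \<cdot> \<beta>
      = phi G (\<lambda>u. \<alpha> \<cdot> R u) (\<lambda>u. \<beta> \<cdot> R u) (\<lambda>u. \<gamma> \<cdot> R u)"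
begin

text \<open>The element of the Lie algebra obtained by applying the sharp map of t to the pullback
  of \<beta> along \<rho>. Thus \<open>R (tau \<beta>)\<close> is the contraction of \<rho>(t) with
  \<beta>.\<close>

definition tau :: "'e dual \<Rightarrow> 'g" where
  "tau \<beta> = tsharp G (\<lambda>u. \<beta> \<cdot> R u)"

text \<open>\<open>anchor\<close> and \<open>coanchor\<close> are contraction of \<open>\<sigma> = P + t/2\<close> in the first and second slot.\<close>

definition anchor :: "'e dual \<Rightarrow> 'e" where
  "anchor \<alpha> = contract P \<alpha> + (1/2) *\<^sub>R R (tau \<alpha>)"

definition coanchor :: "'e dual \<Rightarrow> 'e" where
  "coanchor \<beta> = (1/2) *\<^sub>R R (tau \<beta>) - contract P \<beta>"

text \<open>\<open>S\<close> is the derivative of the vector field \<open>\<sigma>(\<alpha>, \<cdot>)\<close> for a 1-form with value \<open>\<alpha>\<close> and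
  derivative \<open>\<alpha>'\<close> at the point.\<close>

definition anchor_deriv :: "'e dual \<Rightarrow> ('e \<Rightarrow>\<^sub>L 'e dual) \<Rightarrow> ('e \<Rightarrow>\<^sub>L 'e) \<Rightarrow> bool" where
  "anchor_deriv \<alpha> \<alpha>' S \<longleftrightarrow> (\<forall>w \<gamma>. \<gamma> \<cdot> (S \<cdot> w) = P \<cdot> (\<alpha>' \<cdot> w) \<cdot> \<gamma> + P' \<cdot> w \<cdot> \<alpha> \<cdot> \<gamma>
    + (1/2) * (\<alpha>' \<cdot> w \<cdot> R (tau \<gamma>) + \<alpha> \<cdot> (R' (tau \<gamma>) \<cdot> w) + \<gamma> \<cdot> (R' (tau \<alpha>) \<cdot> w)))"

lemma linear_R_comp: "linear (\<lambda>u. \<beta> \<cdot> R u)"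
  using linear_compose[OF linear_R bounded_linear.linear[OF blinfun.bounded_linear_right]]
  by (simp add: o_def)

lemma linear_R'_comp: "linear (\<lambda>u. \<beta> \<cdot> (R' u \<cdot> w))"
  using linear_compose[OF linear_R' bounded_linear.linear[OF blinfun.bounded_linear_right]]
  by (simp add: o_def)

lemma tsum_tau_right: "linear F \<Longrightarrow> tsum G (\<lambda>a b. F a * \<beta> \<cdot> R b) = (F (tau \<beta>) :: real)"
  unfolding tau_def by (rule tsum_tsharp_right[OF G])

lemma tsum_tau_left: "linear F \<Longrightarrow> tsum G (\<lambda>a b. \<beta> \<cdot> R a * F b) = (F (tau \<beta>) :: real)"
  unfolding tau_def by (rule tsum_tsharp_left)

lemma tau_symmetric: "\<alpha> \<cdot> R (tau \<beta>) = \<beta> \<cdot> R (tau \<alpha>)"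
  using tsum_tau_right[OF linear_R_comp, of \<alpha> \<beta>] tsum_tau_left[OF linear_R_comp, of \<alpha> \<beta>] by simp

lemma linear_gbr: "linear (gbr G u)"
  using G unfolding quadratic_lie_algebra_def lie_algebra_def bilinear_def by blast

text \<open>Invariance of t under u, evaluated on the pullbacks of \<alpha> and \<beta> along
  \<rho>.\<close>

lemma tau_invariant:
  "\<alpha> \<cdot> R (gbr G u (tau \<beta>)) + \<beta> \<cdot> R (gbr G u (tau \<alpha>)) = 0"
proof -
  have l: "linear (\<lambda>a. \<beta> \<cdot> R (gbr G u a))" for \<beta>
    using linear_compose[OF linear_gbr linear_R_comp] by (simp add: o_def)
  have "tsum G (\<lambda>a b. \<alpha> \<cdot> R (gbr G u a) * \<beta> \<cdot> R b + \<alpha> \<cdot> R a * \<beta> \<cdot> R (gbr G u b)) = 0"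
    using G linear_R_comp unfolding quadratic_lie_algebra_def by blast
  then show ?thesis by (simp only: tsum_add tsum_tau_right[OF l] tsum_tau_left[OF l])
qed

lemma P_skew: "P \<cdot> \<alpha> \<cdot> \<beta> = - P \<cdot> \<beta> \<cdot> \<alpha>"
  using skew_P unfolding skew_def by blast

lemma apply_contract_P: "\<gamma> \<cdot> contract P \<alpha> = P \<cdot> \<alpha> \<cdot> \<gamma>"
  by (rule apply_contract[OF fin_dim])

text \<open>Together with its companion below it turns a value of \<open>P\<close> into a covector
  evaluated at some \<open>contract P \<gamma>\<close>. Composites with \<open>R' u\<close> or
  \<open>S\<close> then unfold, and the identities become linear relations between a few real
  terms.\<close>

lemma P_apply_left: "P \<cdot> \<omega> \<cdot> \<gamma> = - \<omega> \<cdot> contract P \<gamma>"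
  using P_skew[of \<omega> \<gamma>] apply_contract_P by simp

lemma P_apply_right: "P \<cdot> \<gamma> \<cdot> \<omega> = \<omega> \<cdot> contract P \<gamma>"
  using apply_contract_P by simp

lemma invariant_P': "P' \<cdot> R u \<cdot> \<beta> \<cdot> \<gamma> = \<gamma> \<cdot> (R' u \<cdot> contract P \<beta>) - \<beta> \<cdot> (R' u \<cdot> contract P \<gamma>)"
  unfolding invariant_P P_apply_left[of "\<beta> o\<^sub>L R' u"] P_apply_right[of \<beta>] by simp

lemma bracket_R': "\<beta> \<cdot> (R' v \<cdot> R u) = \<beta> \<cdot> R (gbr G u v) + \<beta> \<cdot> (R' u \<cdot> R v)"
  unfolding bracket_R by (simp add: blinfun.diff_right)

lemma anchor_derivD:
  assumes "anchor_deriv \<alpha> \<alpha>' S"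
  shows "\<gamma> \<cdot> (S \<cdot> w) = - \<alpha>' \<cdot> w \<cdot> contract P \<gamma> + P' \<cdot> w \<cdot> \<alpha> \<cdot> \<gamma>
    + (1/2) * (\<alpha>' \<cdot> w \<cdot> R (tau \<gamma>) + \<alpha> \<cdot> (R' (tau \<gamma>) \<cdot> w) + \<gamma> \<cdot> (R' (tau \<alpha>) \<cdot> w))"
  using assms unfolding anchor_deriv_def P_apply_left[symmetric] by blast

text \<open>The right-hand side is the Lie derivative of the form along \<rho>(u), evaluated on
  \<open>coanchor \<beta>\<close>. The half of \<sigma> given by \<open>P\<close> is handled by
  invariance of \<open>P\<close>, the half given by t by \<open>tau_invariant\<close> and the
  bracket relation of \<rho>.\<close>

lemma bracket_action_anchor:
  assumes "anchor_deriv \<alpha> \<alpha>' S"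
  shows "\<beta> \<cdot> (S \<cdot> R u - R' u \<cdot> anchor \<alpha>) = \<alpha>' \<cdot> R u \<cdot> coanchor \<beta> + \<alpha> \<cdot> (R' u \<cdot> coanchor \<beta>)"
  using tau_invariant[of \<alpha> u \<beta>] bracket_R'[of \<alpha> "tau \<beta>" u] bracket_R'[of \<beta> "tau \<alpha>" u]
  by (simp add: anchor_derivD[OF assms] invariant_P' anchor_def coanchor_def blinfun.bilinear_simps
      algebra_simps)

text \<open>The Jacobi-type equation trades the derivative of \<open>P\<close> along
  \<open>contract P \<alpha>\<close> for derivatives along \<open>contract P \<beta>\<close> and
  \<open>contract P \<gamma>\<close>, which cancel against those contained in \<open>S\<close>. The
  constant 1/4 of \<phi> is matched by the product of the 1/2 in front of the first bracket on the
  right and the 1/2 inside \<open>coanchor\<close>.\<close>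

lemma lie_derivative_anchor:
  assumes "anchor_deriv \<alpha> \<alpha>' S"
  shows "P' \<cdot> anchor \<alpha> \<cdot> \<beta> \<cdot> \<gamma> - P \<cdot> (\<beta> o\<^sub>L S) \<cdot> \<gamma> - P \<cdot> \<beta> \<cdot> (\<gamma> o\<^sub>L S)
    = (1/2) * (\<beta> \<cdot> (S \<cdot> R (tau \<gamma>) - R' (tau \<gamma>) \<cdot> anchor \<alpha>)
         - \<gamma> \<cdot> (S \<cdot> R (tau \<beta>) - R' (tau \<beta>) \<cdot> anchor \<alpha>)) + (\<alpha>' \<cdot> coanchor \<beta> \<cdot> coanchor \<gamma>
         - \<alpha>' \<cdot> coanchor \<gamma> \<cdot> coanchor \<beta>)"
proof -
  \<comment> \<open>Solved for the one derivative that occurs on the left-hand side of the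
    claim.\<close>
  have j: "P' \<cdot> contract P \<alpha> \<cdot> \<beta> \<cdot> \<gamma> = (1/4) * \<alpha> \<cdot> R (gbr G (tau \<beta>) (tau \<gamma>))
      - P' \<cdot> contract P \<beta> \<cdot> \<gamma> \<cdot> \<alpha> - P' \<cdot> contract P \<gamma> \<cdot> \<alpha> \<cdot> \<beta>"
    using jacobi_P[of \<alpha> \<beta> \<gamma>] unfolding phi_def tau_def by simp
  have k: "P' \<cdot> contract P \<beta> \<cdot> \<gamma> \<cdot> \<alpha> = - P' \<cdot> contract P \<beta> \<cdot> \<alpha> \<cdot> \<gamma>"
    using skew_P' unfolding skew_def by blast
  show ?thesis
    unfolding bracket_action_anchor[OF assms] P_apply_left[of "\<beta> o\<^sub>L S"] P_apply_right[of \<beta> "\<gamma> o\<^sub>L S"]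
      blinfun_apply_blinfun_compose
    using j k bracket_R'[of \<alpha> "tau \<gamma>" "tau \<beta>"]
    by (simp add: anchor_derivD[OF assms] invariant_P' anchor_def coanchor_def blinfun.bilinear_simps
        algebra_simps)
qed

text \<open>The Jacobi-type equation is not expanded again: \<open>T \<cdot> anchor \<alpha>\<close>
  contains the derivative of \<open>P\<close> along \<open>anchor \<alpha>\<close>, and the
  preceding lemma supplies it. The first two terms on the right amount to d\<beta>(a(\<alpha>), .)
  plus the derivative of \<sigma>(\<alpha>, \<beta>), both taken at
  \<open>coanchor \<gamma>\<close>.\<close>

lemma bracket_anchor_anchor:
  assumes \<alpha>: "anchor_deriv \<alpha> \<alpha>' S" and \<beta>: "anchor_deriv \<beta> \<beta>' T"
  shows "\<gamma> \<cdot> (T \<cdot> anchor \<alpha> - S \<cdot> anchor \<beta>) = \<beta>' \<cdot> anchor \<alpha> \<cdot> coanchor \<gamma> + \<beta> \<cdot> (S \<cdot> coanchor \<gamma>)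
      + (\<alpha>' \<cdot> coanchor \<beta> \<cdot> coanchor \<gamma> - \<alpha>' \<cdot> coanchor \<gamma> \<cdot> coanchor \<beta>)
      - \<gamma> \<cdot> (S \<cdot> R (tau \<beta>) - R' (tau \<beta>) \<cdot> anchor \<alpha>)"
proof -
  have T: "\<gamma> \<cdot> (T \<cdot> anchor \<alpha>) = \<beta>' \<cdot> anchor \<alpha> \<cdot> coanchor \<gamma> + P' \<cdot> anchor \<alpha> \<cdot> \<beta> \<cdot> \<gamma>
      + (1/2) * (\<beta> \<cdot> (R' (tau \<gamma>) \<cdot> anchor \<alpha>) + \<gamma> \<cdot> (R' (tau \<beta>) \<cdot> anchor \<alpha>))"
    unfolding anchor_derivD[OF \<beta>] coanchor_def
    by (simp add: blinfun.bilinear_simps algebra_simps)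
  have S: "\<gamma> \<cdot> (S \<cdot> anchor \<beta>) = \<gamma> \<cdot> (S \<cdot> contract P \<beta>) + (1/2) * \<gamma> \<cdot> (S \<cdot> R (tau \<beta>))"
    by (simp add: anchor_def blinfun.bilinear_simps)
  have B: "\<beta> \<cdot> (S \<cdot> coanchor \<gamma>) = (1/2) * \<beta> \<cdot> (S \<cdot> R (tau \<gamma>)) - \<beta> \<cdot> (S \<cdot> contract P \<gamma>)"
    by (simp add: coanchor_def blinfun.bilinear_simps)
  have L: "P' \<cdot> anchor \<alpha> \<cdot> \<beta> \<cdot> \<gamma> = \<gamma> \<cdot> (S \<cdot> contract P \<beta>) - \<beta> \<cdot> (S \<cdot> contract P \<gamma>)
      + (1/2) * (\<beta> \<cdot> (S \<cdot> R (tau \<gamma>) - R' (tau \<gamma>) \<cdot> anchor \<alpha>)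
         - \<gamma> \<cdot> (S \<cdot> R (tau \<beta>) - R' (tau \<beta>) \<cdot> anchor \<alpha>)) + (\<alpha>' \<cdot> coanchor \<beta> \<cdot> coanchor \<gamma>
         - \<alpha>' \<cdot> coanchor \<gamma> \<cdot> coanchor \<beta>)"
    using lie_derivative_anchor[OF \<alpha>, of \<beta> \<gamma>]
    unfolding P_apply_left[of "\<beta> o\<^sub>L S"] P_apply_right[of \<beta> "\<gamma> o\<^sub>L S"] blinfun_apply_blinfun_compose
    by linarith
  show ?thesis
    unfolding blinfun.diff_right T S B L by (simp add: algebra_simps)
qed

end

section \<open>The Schouten bracket in coordinates\<close>

text \<open>The field whose expression in the chart q is \<open>F\<close>. It is meaningful on the
  domain of this chart only, which suffices because the Schouten bracket is tested on open
  subsets.\<close>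

definition chart_vf :: "('m, 'e::real_normed_vector) atlas \<Rightarrow> 'm \<Rightarrow> ('e \<Rightarrow> 'e) \<Rightarrow> 'm \<Rightarrow> 'e" where
  "chart_vf M q F p = locd M q M p id p \<cdot> F (cmap M q p)"

lemma frame_sum_functional:
  assumes "frame n b \<beta>"
  shows "(\<Sum>j<n. \<gamma> \<cdot> b j *\<^sub>R \<beta> j) = \<gamma>"
proof (rule blinfun_eqI)
  show "(\<Sum>j<n. \<gamma> \<cdot> b j *\<^sub>R \<beta> j) \<cdot> v = \<gamma> \<cdot> v" for v
    using frame_sum[OF assms, of v \<gamma>] by (simp add: blinfun.sum_left blinfun.scaleR_left mult.commute)
qed

context
  fixes M :: "('m::{t2_space, second_countable_topology}, 'e::real_normed_vector) atlas"
  assumes M: "smooth_manifold M"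
begin

lemma vf_rep_chart_vf:
  assumes "p \<in> cdom M q" "p \<in> cdom M r"
  shows "vf_rep M r (chart_vf M q F) (cmap M r p) = locd M q M r id p \<cdot> F (cmap M q p)"
  using locd_id_trans[OF M assms(1) mem_cdom[OF M] assms(2)]
  by (simp add: vf_rep_eq[OF M] chart_vf_def cinv_cmap[OF M assms(2)] flip: blinfun_apply_blinfun_compose)

lemma vf_rep_chart_vf_same:
  assumes "y \<in> cimg M q"
  shows "vf_rep M q (chart_vf M q F) y = F y"
  using vf_rep_chart_vf[OF cinv_mem[OF M assms] cinv_mem[OF M assms], of F]
  by (simp add: cmap_cinv[OF M assms] locd_id[OF M cinv_mem[OF M assms]])

lemma chart_vf_center: "chart_vf M x F x = F (cmap M x x)"
  by (simp add: chart_vf_def locd_id[OF M mem_cdom[OF M]])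

text \<open>In another chart r the field reads as the Jacobian of the change of charts applied to
  \<open>F\<close>, and both factors are smooth functions of the point.\<close>

lemma smooth_chart_vf:
  assumes F: "smooth_on (cimg M q) F"
  shows "smooth_vf_on M (cdom M q) (chart_vf M q F)"
  unfolding smooth_vf_on_def
proof
  fix r
  define g where "g = cmap M q \<circ> id \<circ> cinv M r"
  define h where "h = cmap M r \<circ> id \<circ> cinv M q"
  define S where "S = cmap M r ` (cdom M r \<inter> id -` cdom M q)"
  define T where "T = cmap M q ` (cdom M q \<inter> id -` cdom M r)"
  have S: "open S" and T: "open T"
    unfolding S_def T_def by (rule open_locrep_domain(1)[OF M M smooth_map_id[OF M]])+
  have g: "smooth_on S g" and h: "smooth_on T h"
    unfolding S_def T_def g_def h_def by (rule smooth_map_locrep[OF smooth_map_id[OF M]])+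
  have gT: "g y \<in> T" if "y \<in> S" for y
    using that unfolding S_def T_def g_def by (auto simp: cinv_cmap[OF M])
  have gC: "g y \<in> cimg M q" if "y \<in> S" for y
    using that unfolding S_def g_def by (auto simp: cinv_cmap[OF M] cmap_mem[OF M])
  have s1: "smooth_on S (\<lambda>y. bderiv h (g y))"
    using smooth_on_compose[OF fin_dim_model[OF M] S T gT g smooth_on_bderiv[OF fin_dim_model[OF M] T h]] by simp
  have s2: "smooth_on S (\<lambda>y. F (g y))"
    using smooth_on_compose[OF fin_dim_model[OF M] S open_cimg[OF M] gC g F] by simp
  have "smooth_on S (\<lambda>y. bderiv h (g y) \<cdot> F (g y))"
    by (rule smooth_on_apply[OF S s1 s2])
  then have "smooth_on S (vf_rep M r (chart_vf M q F))"
  proof (rule smooth_on_cong[OF S])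
    fix y assume "y \<in> S"
    then obtain p where p: "p \<in> cdom M r" "p \<in> cdom M q" "y = cmap M r p" unfolding S_def by auto
    then show "bderiv h (g y) \<cdot> F (g y) = vf_rep M r (chart_vf M q F) y"
      by (simp add: vf_rep_chart_vf g_def h_def locd_def cinv_cmap[OF M])
  qed
  then show "smooth_on (cmap M r ` (cdom M r \<inter> cdom M q)) (vf_rep M r (chart_vf M q F))"
    by (simp add: S_def)
qed

lemma Dvf_chart_vf:
  assumes "(F has_derivative F') (at (cmap M x x))"
  shows "blinfun_apply (Dvf M (chart_vf M x F) x) = F'"
  unfolding Dvf_def
  by (rule blinfun_apply_bderiv, rule has_derivative_cong_open[OF assms open_cimg[OF M] cmap_mem[OF M mem_cdom[OF M]]])
    (simp add: vf_rep_chart_vf_same)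

lemma Dt2_skew:
  assumes "smooth_t2 M T" "\<And>x. skew (T x)"
  shows "skew (Dt2 M T x \<cdot> w)"
  unfolding skew_def
proof (intro allI)
  fix \<alpha> \<beta> :: "'e dual"
  have d: "((\<lambda>y. t2_rep M x T y \<cdot> \<alpha> \<cdot> \<beta>) has_derivative
      (\<lambda>w. Dt2 M T x \<cdot> w \<cdot> \<alpha> \<cdot> \<beta>)) (at (cmap M x x))" for \<alpha> \<beta>
    by (intro bounded_linear.has_derivative[OF blinfun.bounded_linear_left] Dt2_has_derivative[OF M assms(1)])
  have "t2_rep M x T y \<cdot> \<alpha> \<cdot> \<beta> = - t2_rep M x T y \<cdot> \<beta> \<cdot> \<alpha>" for y
    unfolding t2_rep_apply[OF M] using assms(2) unfolding skew_def by blast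
  then have "((\<lambda>y. t2_rep M x T y \<cdot> \<alpha> \<cdot> \<beta>) has_derivative
      (\<lambda>w. - Dt2 M T x \<cdot> w \<cdot> \<beta> \<cdot> \<alpha>)) (at (cmap M x x))"
    using has_derivative_minus[OF d[of \<beta> \<alpha>]] by simp
  from has_derivative_unique[OF d this]
  show "Dt2 M T x \<cdot> w \<cdot> \<alpha> \<cdot> \<beta> = - Dt2 M T x \<cdot> w \<cdot> \<beta> \<cdot> \<alpha>" by (rule fun_cong)
qed

text \<open>The bracket is specified on all decompositions, so a convenient one may be chosen.
  Pairing coefficient fields with constant fields in the chart makes one of the four brackets vanish
  and leaves a single derivative in two others. The factor 1/2 in the coefficient fields compensates
  for the wedge counting each pair of indices twice.\<close>

lemma schouten_bracket_coordinates:
  assumes \<pi>: "smooth_t2 M \<pi>" and skew: "\<And>x. skew (\<pi> x)" and S: "is_schouten_bracket M \<pi> \<pi> S"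
  shows "S x \<alpha> \<beta> \<gamma> = 2 * (Dt2 M \<pi> x \<cdot> contract (\<pi> x) \<alpha> \<cdot> \<beta> \<cdot> \<gamma>
      + Dt2 M \<pi> x \<cdot> contract (\<pi> x) \<beta> \<cdot> \<gamma> \<cdot> \<alpha> + Dt2 M \<pi> x \<cdot> contract (\<pi> x) \<gamma> \<cdot> \<alpha> \<cdot> \<beta>)"
proof -
  obtain n and b :: "nat \<Rightarrow> 'e" and e where fr: "frame n b e"
    using frame_exists[OF fin_dim_model[OF M]] .
  let ?P = "blinfun_apply (Dt2 M \<pi> x)"
  \<comment> \<open>In the chart, \<open>\<pi>\<close> is the sum of the \<open>V j \<and> b j\<close>.\<close>
  define V where "V j y = (\<Sum>i<n. (1/2 * t2_rep M x \<pi> y \<cdot> e i \<cdot> e j) *\<^sub>R b i)" for j y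
  define X1 where "X1 j = chart_vf M x (V j)" for j
  define X2 where "X2 j = chart_vf M x (\<lambda>_. b j)" for j
  define v where "v j = V j (cmap M x x)" for j
  define V' where "V' j w = (\<Sum>i<n. (1/2 * ?P w \<cdot> e i \<cdot> e j) *\<^sub>R b i)" for j w
  have V_apply: "\<gamma> \<cdot> V j y = 1/2 * t2_rep M x \<pi> y \<cdot> \<gamma> \<cdot> e j" for \<gamma> j y
  proof -
    have "t2_rep M x \<pi> y \<cdot> \<gamma> \<cdot> e j = t2_rep M x \<pi> y \<cdot> (\<Sum>i<n. \<gamma> \<cdot> b i *\<^sub>R e i) \<cdot> e j"
      by (simp only: frame_sum_functional[OF fr])
    then show ?thesis
      by (simp add: V_def blinfun.bilinear_simps blinfun.sum_left blinfun.sum_right sum_distrib_left mult_ac)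
  qed
  have V'_apply: "\<gamma> \<cdot> V' j w = 1/2 * ?P w \<cdot> \<gamma> \<cdot> e j" for \<gamma> j w
  proof -
    have "?P w \<cdot> \<gamma> \<cdot> e j = ?P w \<cdot> (\<Sum>i<n. \<gamma> \<cdot> b i *\<^sub>R e i) \<cdot> e j"
      by (simp only: frame_sum_functional[OF fr])
    then show ?thesis
      by (simp add: V'_def blinfun.bilinear_simps blinfun.sum_left blinfun.sum_right sum_distrib_left mult_ac)
  qed
  have smV: "smooth_on (cimg M x) (V j)" for j
    unfolding V_def using \<pi> unfolding smooth_t2_def
    by (intro smooth_on_sum smooth_on_scaleR smooth_on_const smooth_on_apply open_cimg[OF M]
        smooth_on_bilinear[OF _ bounded_bilinear_mult]) auto
  have sm1: "smooth_vf_on M (cdom M x) (X1 j)" for j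
    unfolding X1_def by (rule smooth_chart_vf[OF smV])
  have sm2: "smooth_vf_on M (cdom M x) (X2 j)" for j
    unfolding X2_def by (rule smooth_chart_vf[OF smooth_on_const[OF open_cimg[OF M]]])
  have skew_rep: "t2_rep M x \<pi> y \<cdot> \<alpha> \<cdot> \<beta> = - t2_rep M x \<pi> y \<cdot> \<beta> \<cdot> \<alpha>" for y \<alpha> \<beta>
    unfolding t2_rep_apply[OF M] using skew unfolding skew_def by blast
  have dec: "\<pi> p = (\<Sum>j<n. wedge (X1 j p) (X2 j p))" if p: "p \<in> cdom M x" for p
  proof (rule tensor2_eqI)
    fix \<alpha> \<beta> :: "'e dual"
    define L where "L = locd M x M p id p"
    define y where "y = cmap M x p"
    have 1: "(\<omega> o\<^sub>L L) o\<^sub>L locd M p M x id p = \<omega>" for \<omega> :: "'e dual"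
      unfolding L_def blinfun_compose_assoc locd_id_inverse[OF M p mem_cdom[OF M]]
      by (intro blinfun_eqI) simp
    have 2: "\<pi> p \<cdot> \<alpha> \<cdot> \<beta> = t2_rep M x \<pi> y \<cdot> (\<alpha> o\<^sub>L L) \<cdot> (\<beta> o\<^sub>L L)"
      by (simp add: t2_rep_apply[OF M] y_def cinv_cmap[OF M p] 1)
    have 3: "(\<Sum>j<n. \<omega> \<cdot> V j y * \<eta> \<cdot> b j) = 1/2 * t2_rep M x \<pi> y \<cdot> \<omega> \<cdot> \<eta>" for \<omega> \<eta>
    proof -
      have "t2_rep M x \<pi> y \<cdot> \<omega> \<cdot> \<eta> = t2_rep M x \<pi> y \<cdot> \<omega> \<cdot> (\<Sum>j<n. \<eta> \<cdot> b j *\<^sub>R e j)"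
        by (simp only: frame_sum_functional[OF fr])
      then show ?thesis
        by (simp add: V_apply blinfun.bilinear_simps blinfun.sum_right sum_distrib_left mult_ac)
    qed
    have "(\<Sum>j<n. wedge (X1 j p) (X2 j p)) \<cdot> \<alpha> \<cdot> \<beta> = (\<Sum>j<n. (\<alpha> o\<^sub>L L) \<cdot> V j y * (\<beta> o\<^sub>L L) \<cdot> b j)
        - (\<Sum>j<n. (\<beta> o\<^sub>L L) \<cdot> V j y * (\<alpha> o\<^sub>L L) \<cdot> b j)"
      by (simp add: blinfun.sum_left wedge_def blinfun.diff_left tens_apply X1_def X2_def chart_vf_def
          L_def y_def sum_subtractf mult_ac)
    also have "\<dots> = \<pi> p \<cdot> \<alpha> \<cdot> \<beta>"
      unfolding 2 3 using skew_rep[of y "\<beta> o\<^sub>L L" "\<alpha> o\<^sub>L L"] by simp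
    finally show "\<pi> p \<cdot> \<alpha> \<cdot> \<beta> = (\<Sum>j<n. wedge (X1 j p) (X2 j p)) \<cdot> \<alpha> \<cdot> \<beta>" by simp
  qed
  have dV: "(V j has_derivative V' j) (at (cmap M x x))" for j
    unfolding V_def[abs_def] V'_def[abs_def]
    by (intro has_derivative_sum has_derivative_scaleR_left has_derivative_mult_right
        bounded_linear.has_derivative[OF blinfun.bounded_linear_left] Dt2_has_derivative[OF M \<pi>])
  have D1: "blinfun_apply (Dvf M (X1 j) x) = V' j" for j
    unfolding X1_def by (rule Dvf_chart_vf[OF dV])
  have D2: "blinfun_apply (Dvf M (X2 j) x) = (\<lambda>_. 0)" for j
    unfolding X2_def by (rule Dvf_chart_vf[OF has_derivative_const])
  have c1: "X1 j x = v j" for j unfolding X1_def v_def by (rule chart_vf_center)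
  have c2: "X2 j x = b j" for j unfolding X2_def by (rule chart_vf_center)
  have "S x \<alpha> \<beta> \<gamma> = (\<Sum>i<n. \<Sum>j<n.
             wedge3 (lie_bracket M (X1 i) (X1 j) x) (X2 i x) (X2 j x) \<alpha> \<beta> \<gamma>
           - wedge3 (lie_bracket M (X1 i) (X2 j) x) (X2 i x) (X1 j x) \<alpha> \<beta> \<gamma>
           - wedge3 (lie_bracket M (X2 i) (X1 j) x) (X1 i x) (X2 j x) \<alpha> \<beta> \<gamma>
           + wedge3 (lie_bracket M (X2 i) (X2 j) x) (X1 i x) (X1 j x) \<alpha> \<beta> \<gamma>)"
    using S[unfolded is_schouten_bracket_def, rule_format, of "cdom M x" n X1 X2 n X1 X2 x \<alpha> \<beta> \<gamma>]
      sm1 sm2 dec open_cdom[OF M] mem_cdom[OF M] by blast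
  also have "\<dots> = (\<Sum>i<n. \<Sum>j<n.
             wedge3 (V' j (v i) - V' i (v j)) (b i) (b j) \<alpha> \<beta> \<gamma>
           - wedge3 (- V' i (b j)) (b i) (v j) \<alpha> \<beta> \<gamma> - wedge3 (V' j (b i)) (v i) (b j) \<alpha> \<beta> \<gamma>)"
    by (simp add: lie_bracket_eq D1 D2 c1 c2 wedge3_def)
  finally have S1: "S x \<alpha> \<beta> \<gamma> = (\<Sum>i<n. \<Sum>j<n.
             wedge3 (V' j (v i) - V' i (v j)) (b i) (b j) \<alpha> \<beta> \<gamma>
           - wedge3 (- V' i (b j)) (b i) (v j) \<alpha> \<beta> \<gamma> - wedge3 (V' j (b i)) (v i) (b j) \<alpha> \<beta> \<gamma>)" .
  \<comment> \<open>The sign is opposite to that of \<open>sum_b\<close>: here \<omega> enters the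
    second slot of \<pi> and has to be moved to the first.\<close>
  have sum_v: "(\<Sum>i<n. \<omega> \<cdot> b i *\<^sub>R v i) = - (1/2) *\<^sub>R contract (\<pi> x) \<omega>" for \<omega>
  proof (rule fin_dim_functionals_separate[OF fin_dim_model[OF M]])
    fix \<eta> :: "'e dual"
    have "\<pi> x \<cdot> \<eta> \<cdot> (\<Sum>i<n. \<omega> \<cdot> b i *\<^sub>R e i) = - \<pi> x \<cdot> \<omega> \<cdot> \<eta>"
      using skew[of x] unfolding frame_sum_functional[OF fr] skew_def by blast
    then show "\<eta> \<cdot> (\<Sum>i<n. \<omega> \<cdot> b i *\<^sub>R v i) = \<eta> \<cdot> (- (1/2) *\<^sub>R contract (\<pi> x) \<omega>)"
      by (simp add: v_def V_apply t2_rep_center[OF M] blinfun.bilinear_simps blinfun.sum_right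
          apply_contract[OF fin_dim_model[OF M]] sum_divide_distrib[symmetric] sum_negf[symmetric])
  qed
  have sum_b: "(\<Sum>j<n. \<omega> \<cdot> v j *\<^sub>R b j) = (1/2) *\<^sub>R contract (\<pi> x) \<omega>" for \<omega>
    by (simp add: v_def V_apply t2_rep_center[OF M] contract_apply_frame[OF fr] scaleR_sum_right)
  have dsum: "(\<Sum>i<n. \<Sum>j<n. \<omega> \<cdot> V' j (w i) * (f i * \<eta> \<cdot> b j)) = 1/2 * ?P (\<Sum>i<n. f i *\<^sub>R w i) \<cdot> \<omega> \<cdot> \<eta>"
    for \<omega> \<eta> :: "'e dual" and w and f :: "nat \<Rightarrow> real"
  proof -
    have d: "(\<Sum>j<n. \<omega> \<cdot> V' j (w i) * (f i * \<eta> \<cdot> b j))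
        = f i * (1/2 * ?P (w i) \<cdot> \<omega> \<cdot> (\<Sum>j<n. \<eta> \<cdot> b j *\<^sub>R e j))" for i
      by (simp add: V'_apply blinfun.bilinear_simps blinfun.sum_right sum_distrib_left mult_ac)
    show ?thesis
      unfolding d frame_sum_functional[OF fr]
      by (simp add: blinfun.bilinear_simps blinfun.sum_right blinfun.sum_left sum_distrib_left mult_ac)
  qed
  have dsum': "(\<Sum>i<n. \<Sum>j<n. \<omega> \<cdot> V' i (w j) * (f j * \<eta> \<cdot> b i))
      = 1/2 * ?P (\<Sum>i<n. f i *\<^sub>R w i) \<cdot> \<omega> \<cdot> \<eta>"
    for \<omega> \<eta> :: "'e dual" and w and f :: "nat \<Rightarrow> real"
    by (subst sum.swap) (rule dsum)
  \<comment> \<open>\<open>wedge3\<close> is a determinant. Expanded along the vector that carries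
    the Lie bracket it is a cyclic sum over the covector meeting that vector, and \<open>Q\<close>
    collects the part in which this covector comes first.\<close>
  define Q where "Q \<alpha> \<beta> \<gamma> = (\<Sum>i<n. \<Sum>j<n.
        \<alpha> \<cdot> V' j (v i) * (\<beta> \<cdot> b i * \<gamma> \<cdot> b j) - \<alpha> \<cdot> V' j (v i) * (\<gamma> \<cdot> b i * \<beta> \<cdot> b j)
      - \<alpha> \<cdot> V' i (v j) * (\<gamma> \<cdot> b j * \<beta> \<cdot> b i) + \<alpha> \<cdot> V' i (v j) * (\<beta> \<cdot> b j * \<gamma> \<cdot> b i)
      + \<alpha> \<cdot> V' i (b j) * (\<gamma> \<cdot> v j * \<beta> \<cdot> b i) - \<alpha> \<cdot> V' i (b j) * (\<beta> \<cdot> v j * \<gamma> \<cdot> b i)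
      - \<alpha> \<cdot> V' j (b i) * (\<beta> \<cdot> v i * \<gamma> \<cdot> b j) + \<alpha> \<cdot> V' j (b i) * (\<gamma> \<cdot> v i * \<beta> \<cdot> b j))"
    for \<alpha> \<beta> \<gamma> :: "'e dual"
  have Q: "Q \<alpha> \<beta> \<gamma> = ?P (contract (\<pi> x) \<gamma>) \<cdot> \<alpha> \<cdot> \<beta> - ?P (contract (\<pi> x) \<beta>) \<cdot> \<alpha> \<cdot> \<gamma>" for \<alpha> \<beta> \<gamma>
    unfolding Q_def sum_subtractf sum.distrib dsum dsum' sum_v sum_b
    by (simp add: blinfun.bilinear_simps)
  have "S x \<alpha> \<beta> \<gamma> = Q \<alpha> \<beta> \<gamma> + Q \<beta> \<gamma> \<alpha> + Q \<gamma> \<alpha> \<beta>"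
    unfolding S1 Q_def sum.distrib[symmetric] wedge3_def
    by (intro sum.cong refl) (simp add: blinfun.bilinear_simps algebra_simps)
  moreover have "?P w \<cdot> \<alpha> \<cdot> \<beta> = - ?P w \<cdot> \<beta> \<cdot> \<alpha>" for w \<alpha> \<beta>
    using Dt2_skew[OF \<pi> skew] unfolding skew_def by blast
  from this[of "contract (\<pi> x) \<beta>" \<alpha> \<gamma>] this[of "contract (\<pi> x) \<gamma>" \<beta> \<alpha>] this[of "contract (\<pi> x) \<alpha>" \<gamma> \<beta>]
  have "Q \<alpha> \<beta> \<gamma> + Q \<beta> \<gamma> \<alpha> + Q \<gamma> \<alpha> \<beta> = 2 * (?P (contract (\<pi> x) \<alpha>) \<cdot> \<beta> \<cdot> \<gamma>
      + ?P (contract (\<pi> x) \<beta>) \<cdot> \<gamma> \<cdot> \<alpha> + ?P (contract (\<pi> x) \<gamma>) \<cdot> \<alpha> \<cdot> \<beta>)"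
    unfolding Q by simp
  ultimately show ?thesis by simp
qed

end

section \<open>The anchor of a quasi-Poisson manifold\<close>

lemma linear_vf_Dvf:
  fixes M :: "('m::{t2_space, second_countable_topology}, 'e::real_normed_vector) atlas"
    and \<rho> :: "'g::real_vector \<Rightarrow> 'm \<Rightarrow> 'e"
  assumes M: "smooth_manifold M" and \<rho>: "\<And>u. smooth_vf_on M UNIV (\<rho> u)" and lin: "\<And>x. linear (\<lambda>u. \<rho> u x)"
  shows "linear (\<lambda>u. Dvf M (\<rho> u) x \<cdot> w)"
proof (rule linearI)
  have d: "(vf_rep M x (\<rho> u) has_derivative blinfun_apply (Dvf M (\<rho> u) x)) (at (cmap M x x))" for u
    by (rule Dvf_has_derivative[OF M \<rho>])
  show "Dvf M (\<rho> (u + v)) x \<cdot> w = Dvf M (\<rho> u) x \<cdot> w + Dvf M (\<rho> v) x \<cdot> w" for u v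
  proof -
    have "vf_rep M x (\<rho> (u + v)) = (\<lambda>y. vf_rep M x (\<rho> u) y + vf_rep M x (\<rho> v) y)"
      by (intro ext) (simp add: vf_rep_eq[OF M] linear_add[OF lin] blinfun.add_right)
    then have "(vf_rep M x (\<rho> (u + v)) has_derivative
        (\<lambda>w. Dvf M (\<rho> u) x \<cdot> w + Dvf M (\<rho> v) x \<cdot> w)) (at (cmap M x x))"
      using has_derivative_add[OF d d] by simp
    from fun_cong[OF has_derivative_unique[OF d this]] show ?thesis .
  qed
  show "Dvf M (\<rho> (r *\<^sub>R u)) x \<cdot> w = r *\<^sub>R Dvf M (\<rho> u) x \<cdot> w" for r u
  proof -
    have "vf_rep M x (\<rho> (r *\<^sub>R u)) = (\<lambda>y. r *\<^sub>R vf_rep M x (\<rho> u) y)"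
      by (intro ext) (simp add: vf_rep_eq[OF M] linear_scale[OF lin] blinfun.scaleR_right)
    then have "(vf_rep M x (\<rho> (r *\<^sub>R u)) has_derivative
        (\<lambda>w. r *\<^sub>R Dvf M (\<rho> u) x \<cdot> w)) (at (cmap M x x))"
      using has_derivative_scaleR_right[OF d] by simp
    from fun_cong[OF has_derivative_unique[OF d this]] show ?thesis .
  qed
qed

lemma tsum_wedge_apply:
  fixes F R :: "'g::real_vector \<Rightarrow> 'e::real_normed_vector"
  assumes G: "quadratic_lie_algebra G" and F: "linear F"
  shows "tsum G (\<lambda>a b. wedge (F a) (R b)) \<cdot> \<beta> \<cdot> \<gamma> = \<beta> \<cdot> F (tsharp G (\<lambda>u. \<gamma> \<cdot> R u))
      - \<gamma> \<cdot> F (tsharp G (\<lambda>u. \<beta> \<cdot> R u))"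
proof -
  have l: "linear (\<lambda>a. \<beta> \<cdot> F a)" for \<beta>
    using linear_compose[OF F bounded_linear.linear[OF blinfun.bounded_linear_right]] by (simp add: o_def)
  have "tsum G (\<lambda>a b. wedge (F a) (R b)) \<cdot> \<beta> \<cdot> \<gamma> = tsum G (\<lambda>a b. \<beta> \<cdot> F a * \<gamma> \<cdot> R b)
      - tsum G (\<lambda>a b. \<gamma> \<cdot> F a * \<beta> \<cdot> R b)"
    by (simp add: tsum_apply2 wedge_def blinfun.diff_left tens_apply tsum_diff mult.commute)
  then show ?thesis by (simp only: tsum_tsharp_right[OF G l])
qed

text \<open>The vector \<open>\<sigma>(\<cdot>, \<gamma>)\<close>, since \<open>\<pi>\<close> is skew and \<open>t\<close> is symmetric.\<close>

definition cosigma :: "'g::real_vector quad_lie \<Rightarrow> ('g \<Rightarrow> 'm \<Rightarrow> 'e::real_normed_vector) \<Rightarrow> ('m \<Rightarrow> 'e tensor2) \<Rightarrow>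
    'm \<Rightarrow> 'e dual \<Rightarrow> 'e" where
  "cosigma G \<rho> \<pi> x \<gamma> = (1/2) *\<^sub>R \<rho> (tsharp G (\<lambda>u. \<gamma> \<cdot> \<rho> u x)) x - contract (\<pi> x) \<gamma>"

context
  fixes G :: "'g::real_vector quad_lie"
    and M :: "('m::{t2_space, second_countable_topology}, 'e::real_normed_vector) atlas"
    and \<rho> :: "'g \<Rightarrow> 'm \<Rightarrow> 'e" and \<pi> :: "'m \<Rightarrow> 'e tensor2"
  assumes G: "quadratic_lie_algebra G" and qpm: "quasi_poisson_manifold G M \<rho> \<pi>"
begin

private abbreviation (input) "\<Sigma> \<equiv> sigma G \<rho> \<pi>"
private abbreviation (input) "anc \<alpha> \<equiv> (\<lambda>x. contract (\<Sigma> x) (\<alpha> x))"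
private abbreviation (input) "coanc \<equiv> cosigma G \<rho> \<pi>"

lemma qpm_manifold: "smooth_manifold M"
  and qpm_smooth_action: "smooth_vf_on M UNIV (\<rho> u)"
  and qpm_linear_action: "linear (\<lambda>u. \<rho> u x)"
  and qpm_action_bracket: "\<rho> (gbr G u v) x = lie_bracket M (\<rho> u) (\<rho> v) x"
  and qpm_smooth_bivector: "smooth_t2 M \<pi>"
  and qpm_skew: "skew (\<pi> x)"
  and qpm_invariant: "lie_deriv2 M (\<rho> u) \<pi> x = 0"
  using qpm unfolding quasi_poisson_manifold_def lie_action_def by blast+

lemma qpm_jet: "quasi_poisson_jet G (\<pi> x) (Dt2 M \<pi> x) (\<lambda>u. \<rho> u x) (\<lambda>u. Dvf M (\<rho> u) x)"
proof (rule quasi_poisson_jet.intro)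
  show "quadratic_lie_algebra G" by (rule G)
  show "fin_dim (UNIV :: 'e set)" by (rule fin_dim_model[OF qpm_manifold])
  show "linear (\<lambda>u. \<rho> u x)" by (rule qpm_linear_action)
  show "linear (\<lambda>u. Dvf M (\<rho> u) x \<cdot> w)" for w
    by (rule linear_vf_Dvf[OF qpm_manifold qpm_smooth_action qpm_linear_action])
  show "skew (\<pi> x)" by (rule qpm_skew)
  show "skew (Dt2 M \<pi> x \<cdot> w)" for w
    by (rule Dt2_skew[OF qpm_manifold qpm_smooth_bivector qpm_skew])
  show "\<rho> (gbr G u v) x = Dvf M (\<rho> v) x \<cdot> \<rho> u x - Dvf M (\<rho> u) x \<cdot> \<rho> v x" for u v
    unfolding qpm_action_bracket lie_bracket_eq ..
  show "Dt2 M \<pi> x \<cdot> \<rho> u x \<cdot> \<beta> \<cdot> \<gamma> = \<pi> x \<cdot> (\<beta> o\<^sub>L Dvf M (\<rho> u) x) \<cdot> \<gamma>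
      + \<pi> x \<cdot> \<beta> \<cdot> (\<gamma> o\<^sub>L Dvf M (\<rho> u) x)" for u \<beta> \<gamma>
    using lie_deriv2_apply[of M "\<rho> u" \<pi> x \<beta> \<gamma>] unfolding qpm_invariant by simp
  have "is_schouten_bracket M \<pi> \<pi> (\<lambda>x \<alpha> \<beta> \<gamma>. 2 * phi G (\<lambda>u. \<alpha> \<cdot> \<rho> u x)
      (\<lambda>u. \<beta> \<cdot> \<rho> u x) (\<lambda>u. \<gamma> \<cdot> \<rho> u x))"
    using qpm unfolding quasi_poisson_manifold_def by blast
  note jac = schouten_bracket_coordinates[OF qpm_manifold qpm_smooth_bivector qpm_skew this, where x = x]
  show "Dt2 M \<pi> x \<cdot> contract (\<pi> x) \<alpha> \<cdot> \<beta> \<cdot> \<gamma> + Dt2 M \<pi> x \<cdot> contract (\<pi> x) \<beta> \<cdot> \<gamma> \<cdot> \<alpha>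
      + Dt2 M \<pi> x \<cdot> contract (\<pi> x) \<gamma> \<cdot> \<alpha> \<cdot> \<beta>
      = phi G (\<lambda>u. \<alpha> \<cdot> \<rho> u x) (\<lambda>u. \<beta> \<cdot> \<rho> u x) (\<lambda>u. \<gamma> \<cdot> \<rho> u x)"
    for \<alpha> \<beta> \<gamma> using jac[of \<alpha> \<beta> \<gamma>] by simp
qed

lemma qpm_smooth_sigma: "smooth_t2 M (\<Sigma>)"
  by (rule smooth_t2_sigma[OF qpm_manifold qpm_smooth_action qpm_smooth_bivector])

interpretation jet: quasi_poisson_jet G "\<pi> x" "Dt2 M \<pi> x" "\<lambda>u. \<rho> u x" "\<lambda>u. Dvf M (\<rho> u) x" for x
  by (rule qpm_jet)

lemma cosigma_eq: "jet.coanchor x \<gamma> = coanc x \<gamma>"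
  by (simp add: jet.coanchor_def cosigma_def jet.tau_def)

lemma sigma_tau: "\<Sigma> x \<cdot> \<alpha> \<cdot> \<beta> = \<pi> x \<cdot> \<alpha> \<cdot> \<beta> + (1/2) * \<alpha> \<cdot> \<rho> (jet.tau x \<beta>) x"
  unfolding sigma_apply jet.tsum_tau_right[OF jet.linear_R_comp] ..

lemma apply_cosigma: "\<alpha> \<cdot> coanc x \<beta> = \<Sigma> x \<cdot> \<alpha> \<cdot> \<beta>"
  unfolding sigma_tau cosigma_eq[symmetric] jet.coanchor_def
  by (simp add: blinfun.bilinear_simps jet.P_apply_left)

lemma anchor_eq: "jet.anchor x \<alpha> = contract (\<Sigma> x) \<alpha>"
proof (rule fin_dim_functionals_separate[OF fin_dim_model[OF qpm_manifold]])
  show "\<gamma> \<cdot> jet.anchor x \<alpha> = \<gamma> \<cdot> contract (\<Sigma> x) \<alpha>"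
    for \<gamma> :: "'e dual"
    unfolding apply_contract[OF fin_dim_model[OF qpm_manifold]] sigma_tau jet.anchor_def
    by (simp add: blinfun.bilinear_simps jet.apply_contract_P jet.tau_symmetric[where x = x and \<alpha> = \<gamma> and \<beta> = \<alpha>])
qed

lemma anchor_deriv_contract:
  assumes "smooth_form M \<alpha>"
  shows "jet.anchor_deriv x (\<alpha> x) (Dform M \<alpha> x) (Dvf M (anc \<alpha>) x)"
  unfolding jet.anchor_deriv_def
proof (intro allI)
  fix w and \<gamma> :: "'e dual"
  show "\<gamma> \<cdot> (Dvf M (anc \<alpha>) x \<cdot> w) = \<pi> x \<cdot> (Dform M \<alpha> x \<cdot> w) \<cdot> \<gamma> + Dt2 M \<pi> x \<cdot> w \<cdot> \<alpha> x \<cdot> \<gamma>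
    + (1/2) * (Dform M \<alpha> x \<cdot> w \<cdot> \<rho> (jet.tau x \<gamma>) x + \<alpha> x \<cdot> (Dvf M (\<rho> (jet.tau x \<gamma>)) x \<cdot> w)
        + \<gamma> \<cdot> (Dvf M (\<rho> (jet.tau x (\<alpha> x))) x \<cdot> w))"
    unfolding Dvf_contract[OF qpm_manifold qpm_smooth_sigma assms] sigma_tau
      Dt2_sigma[OF qpm_manifold qpm_smooth_action qpm_smooth_bivector]
      tsum_add jet.tsum_tau_right[OF jet.linear_R'_comp] jet.tsum_tau_left[OF jet.linear_R'_comp]
    by simp
qed

text \<open>The Lie derivative of the form is split by Cartan's formula into i d + d i. Exterior
  derivatives and derivatives of functions are compatible with maps of manifolds, while the jet
  \<open>Dform\<close> is not.\<close>

lemma apply_bracket_action_anchor: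
  assumes \<alpha>: "smooth_form M \<alpha>"
  shows "\<gamma> \<cdot> lie_bracket M (\<rho> u) (anc \<alpha>) x = ext_deriv M \<alpha> x (\<rho> u x) (coanc x \<gamma>)
    + Dfun M (\<lambda>p. \<alpha> p \<cdot> \<rho> u p) x \<cdot> coanc x \<gamma>"
  unfolding lie_bracket_eq Dfun_pairing[OF qpm_manifold \<alpha> qpm_smooth_action] ext_deriv_def
  using jet.bracket_action_anchor[OF anchor_deriv_contract[OF \<alpha>, where x = x], of \<gamma> u]
  unfolding anchor_eq cosigma_eq by simp

lemma linear_bracket_action_anchor:
  assumes \<alpha>: "smooth_form M \<alpha>"
  shows "linear (\<lambda>u. lie_bracket M (\<rho> u) (anc \<alpha>) x)"
  unfolding lie_bracket_eq
  by (intro linear_compose_sub linear_compose[OF qpm_linear_action, unfolded o_def] jet.linear_R'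
      bounded_linear.linear[OF blinfun.bounded_linear_right])

lemma lie_deriv2_anchor:
  assumes \<alpha>: "smooth_form M \<alpha>"
  shows "lie_deriv2 M (anc \<alpha>) \<pi> x \<cdot> \<beta> \<cdot> \<gamma> = (1/2) * tsum G (\<lambda>a b.
          wedge (lie_bracket M (\<rho> a) (anc \<alpha>) x) (\<rho> b x)) \<cdot> \<beta> \<cdot> \<gamma>
      + ext_deriv M \<alpha> x (coanc x \<beta>) (coanc x \<gamma>)"
  unfolding tsum_wedge_apply[OF G linear_bracket_action_anchor[OF \<alpha>]] lie_deriv2_apply
  using jet.lie_derivative_anchor[OF anchor_deriv_contract[OF \<alpha>, where x = x], of \<beta> \<gamma>]
  unfolding anchor_eq cosigma_eq ext_deriv_def lie_bracket_eq jet.tau_def by simp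

text \<open>The jet identity with its chart-dependent terms regrouped: \<beta> applied to the anchor
  of \<alpha> is the function \<sigma>(\<alpha>, \<beta>), and its derivative absorbs the derivative
  of the anchor field.\<close>

lemma apply_bracket_anchor_anchor:
  assumes \<alpha>: "smooth_form M \<alpha>" and \<beta>: "smooth_form M \<beta>"
  shows "\<gamma> \<cdot> lie_bracket M (anc \<alpha>) (anc \<beta>) x = ext_deriv M \<beta> x (contract (\<Sigma> x) (\<alpha> x)) (coanc x \<gamma>)
    + Dfun M (\<lambda>p. \<Sigma> p \<cdot> \<alpha> p \<cdot> \<beta> p) x \<cdot> coanc x \<gamma> + ext_deriv M \<alpha> x (coanc x (\<beta> x)) (coanc x \<gamma>)
    - \<gamma> \<cdot> lie_bracket M (\<rho> (tsharp G (\<lambda>u. \<beta> x \<cdot> \<rho> u x)))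
        (anc \<alpha>) x"
proof -
  let ?a = "\<lambda>x. contract (\<Sigma> x) (\<alpha> x)"
  have "(\<lambda>p. \<Sigma> p \<cdot> \<alpha> p \<cdot> \<beta> p) = (\<lambda>p. \<beta> p \<cdot> ?a p)"
    by (simp add: apply_contract[OF fin_dim_model[OF qpm_manifold]])
  then have "Dfun M (\<lambda>p. \<Sigma> p \<cdot> \<alpha> p \<cdot> \<beta> p) x \<cdot> w = \<beta> x \<cdot> (Dvf M ?a x \<cdot> w)
       + Dform M \<beta> x \<cdot> w \<cdot> ?a x" for w
    using Dfun_pairing[OF qpm_manifold \<beta> smooth_vf_contract[OF qpm_manifold qpm_smooth_sigma \<alpha>]] by simp
  then show ?thesis
    using jet.bracket_anchor_anchor[OF anchor_deriv_contract[OF \<alpha>, where x = x]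
          anchor_deriv_contract[OF \<beta>, where x = x], of \<gamma>]
    unfolding anchor_eq cosigma_eq ext_deriv_def lie_bracket_eq jet.tau_def by simp
qed

end

section \<open>Product manifolds\<close>

lemma fin_dim_prod:
  assumes "fin_dim (UNIV :: 'e::real_vector set)" "fin_dim (UNIV :: 'f::real_vector set)"
  shows "fin_dim (UNIV :: ('e \<times> 'f) set)"
proof -
  obtain B C where B: "finite B" "(UNIV :: 'e set) \<subseteq> span B" and C: "finite C" "(UNIV :: 'f set) \<subseteq> span C"
    using assms unfolding fin_dim_def by blast
  let ?D = "(\<lambda>b. (b, 0 :: 'f)) ` B \<union> (\<lambda>c. (0 :: 'e, c)) ` C"
  have l: "linear (\<lambda>b. (b :: 'e, 0 :: 'f))" "linear (\<lambda>c. (0 :: 'e, c :: 'f))"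
    by (auto intro!: linearI)
  have "z \<in> span ?D" for z :: "'e \<times> 'f"
  proof -
    have "(fst z, 0) \<in> span ((\<lambda>b. (b, 0 :: 'f)) ` B)" "(0, snd z) \<in> span ((\<lambda>c. (0 :: 'e, c)) ` C)"
      using B C unfolding linear_span_image[OF l(1)] linear_span_image[OF l(2)] by auto
    then have "(fst z, 0) \<in> span ?D" "(0, snd z) \<in> span ?D"
      using span_mono[of "(\<lambda>b. (b, 0 :: 'f)) ` B" ?D] span_mono[of "(\<lambda>c. (0 :: 'e, c)) ` C" ?D] by auto
    from span_add[OF this] show ?thesis by simp
  qed
  then show ?thesis unfolding fin_dim_def using B C by (intro exI[of _ ?D]) auto
qed

lemma prod_atlas_simps [simp]:
  "cdom (prod_atlas M N) (p, q) = cdom M p \<times> cdom N q"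
  "cmap (prod_atlas M N) (p, q) = map_prod (cmap M p) (cmap N q)"
  "cimg (prod_atlas M N) (p, q) = cimg M p \<times> cimg N q"
  by (auto simp: prod_atlas_def cdom_def cmap_def cimg_def)

context
  fixes M :: "('m::{t2_space, second_countable_topology}, 'e::real_normed_vector) atlas"
    and N :: "('n::{t2_space, second_countable_topology}, 'f::real_normed_vector) atlas"
  assumes M: "smooth_manifold M" and N: "smooth_manifold N"
begin

lemma cinv_prod_atlas:
  assumes "y \<in> cimg M p" "z \<in> cimg N q"
  shows "cinv (prod_atlas M N) (p, q) (y, z) = (cinv M p y, cinv N q z)"
  unfolding cinv_def[of "prod_atlas M N"]
proof (rule inv_into_f_eq)
  show "inj_on (cmap (prod_atlas M N) (p, q)) (cdom (prod_atlas M N) (p, q))"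
    by (rule inj_on_inverseI[where g = "map_prod (cinv M p) (cinv N q)"])
      (auto simp: cinv_cmap[OF M] cinv_cmap[OF N])
  show "(cinv M p y, cinv N q z) \<in> cdom (prod_atlas M N) (p, q)"
    using cinv_mem[OF M assms(1)] cinv_mem[OF N assms(2)] by simp
  show "cmap (prod_atlas M N) (p, q) (cinv M p y, cinv N q z) = (y, z)"
    using cmap_cinv[OF M assms(1)] cmap_cinv[OF N assms(2)] by simp
qed

lemma smooth_manifold_prod: "smooth_manifold (prod_atlas M N)"
  unfolding smooth_manifold_def
proof (intro conjI allI)
  show "fin_dim (UNIV :: ('e \<times> 'f) set)" by (rule fin_dim_prod[OF fin_dim_model[OF M] fin_dim_model[OF N]])
  fix P Q :: "'m \<times> 'n"
  obtain p p' where P: "P = (p, p')" by (cases P)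
  obtain q q' where Q: "Q = (q, q')" by (cases Q)
  show "P \<in> cdom (prod_atlas M N) P" by (simp add: P mem_cdom[OF M] mem_cdom[OF N])
  show "open (cdom (prod_atlas M N) P)" by (simp add: P open_Times open_cdom[OF M] open_cdom[OF N])
  show "open (cimg (prod_atlas M N) P)" by (simp add: P open_Times open_cimg[OF M] open_cimg[OF N])
  have hM: "homeomorphism (cdom M p) (cimg M p) (cmap M p) (cinv M p)" by (rule chart_homeomorphism[OF M])
  have hN: "homeomorphism (cdom N p') (cimg N p') (cmap N p') (cinv N p')" by (rule chart_homeomorphism[OF N])
  have c: "continuous_on (A \<times> B) (map_prod f g)" if "continuous_on A f" "continuous_on B g"
    for A :: "'a::topological_space set" and B :: "'b::topological_space set"
      and f :: "'a \<Rightarrow> 'c::topological_space" and g :: "'b \<Rightarrow> 'd::topological_space"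
    unfolding map_prod_def case_prod_beta
    using continuous_on_compose2[OF that(1) continuous_on_fst[OF continuous_on_id], of "A \<times> B"]
      continuous_on_compose2[OF that(2) continuous_on_snd[OF continuous_on_id], of "A \<times> B"]
    by (intro continuous_on_Pair) auto
  have "homeomorphism (cdom M p \<times> cdom N p') (cimg M p \<times> cimg N p') (map_prod (cmap M p) (cmap N p'))
      (map_prod (cinv M p) (cinv N p'))"
    using hM hN unfolding homeomorphism_def
    by (auto simp: c intro!: image_eqI)
  then show "homeomorphism (cdom (prod_atlas M N) P) (cimg (prod_atlas M N) P) (cmap (prod_atlas M
        N) P) (cinv (prod_atlas M N) P)"
    unfolding P by (rule homeomorphism_cong) (auto simp: cinv_prod_atlas)
  let ?S = "cmap M p ` (cdom M p \<inter> cdom M q)" and ?T = "cmap N p' ` (cdom N p' \<inter> cdom N q')"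
  have S: "open ?S" and T: "open ?T"
    by (rule open_cmap_image[OF M open_cdom[OF M]], rule open_cmap_image[OF N open_cdom[OF N]])
  have sS: "smooth_on ?S (cmap M q \<circ> cinv M p)" and sT: "smooth_on ?T (cmap N q' \<circ> cinv N p')"
    using M N unfolding smooth_manifold_def by blast+
  have ST: "open (?S \<times> ?T)" by (rule open_Times[OF S T])
  have f: "smooth_on (?S \<times> ?T) fst" and g: "smooth_on (?S \<times> ?T) snd"
    by (rule smooth_on_linear[OF ST bounded_linear_fst smooth_on_id[OF ST]],
        rule smooth_on_linear[OF ST bounded_linear_snd smooth_on_id[OF ST]])
  have "smooth_on (?S \<times> ?T) (\<lambda>z. (cmap M q \<circ> cinv M p) (fst z))"
    using smooth_on_compose[OF fin_dim_model[OF M] ST S _ f sS] by force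
  moreover have "smooth_on (?S \<times> ?T) (\<lambda>z. (cmap N q' \<circ> cinv N p') (snd z))"
    using smooth_on_compose[OF fin_dim_model[OF N] ST T _ g sT] by force
  ultimately have "smooth_on (?S \<times> ?T) (\<lambda>z. ((cmap M q \<circ> cinv M p) (fst z), (cmap N q' \<circ> cinv N p') (snd z)))"
    by (rule smooth_on_Pair[OF ST])
  then have "smooth_on (?S \<times> ?T) (cmap (prod_atlas M N) Q \<circ> cinv (prod_atlas M N) P)"
    by (rule smooth_on_cong[OF ST]) (auto simp: P Q cinv_prod_atlas cmap_mem[OF M] cmap_mem[OF N])
  moreover have "cmap (prod_atlas M N) P ` (cdom (prod_atlas M N) P \<inter> cdom (prod_atlas M N) Q) = ?S \<times> ?T"
    unfolding P Q by (force simp: image_iff)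
  ultimately show "smooth_on (cmap (prod_atlas M N) P ` (cdom (prod_atlas M N) P \<inter> cdom (prod_atlas M N) Q))
      (cmap (prod_atlas M N) Q \<circ> cinv (prod_atlas M N) P)" by simp
qed

end

section \<open>Constant, paired and composed smooth maps\<close>

lemma smooth_map_const:
  fixes M :: "('m::{t2_space, second_countable_topology}, 'e::real_normed_vector) atlas"
  assumes "smooth_manifold M"
  shows "smooth_map M N (\<lambda>_. c)"
  unfolding smooth_map_def
proof (intro conjI allI)
  fix p q
  have "open (cmap M p ` (cdom M p \<inter> (\<lambda>_. c) -` cdom N q))"
    by (rule open_cmap_image[OF assms]) (cases "c \<in> cdom N q", auto)
  then show "smooth_on (cmap M p ` (cdom M p \<inter> (\<lambda>_. c) -` cdom N q)) (cmap N q \<circ> (\<lambda>_. c) \<circ> cinv M p)"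
    by (simp add: o_def smooth_on_const)
qed (rule continuous_on_const)

lemma locd_const: "locd M q N r (\<lambda>_. c) x \<cdot> v = 0"
  unfolding locd_def o_def by (rule fun_cong[OF blinfun_apply_bderiv[OF has_derivative_const]])

context
  fixes M :: "('m::{t2_space, second_countable_topology}, 'e::real_normed_vector) atlas"
    and N :: "('n::{t2_space, second_countable_topology}, 'f::real_normed_vector) atlas"
    and Q :: "('q::{t2_space, second_countable_topology}, 'g::real_normed_vector) atlas"
    and f :: "'m \<Rightarrow> 'n" and g :: "'m \<Rightarrow> 'q"
  assumes M: "smooth_manifold M" and N: "smooth_manifold N" and Q: "smooth_manifold Q"
    and f: "smooth_map M N f" and g: "smooth_map M Q g"
begin

lemma smooth_map_Pair: "smooth_map M (prod_atlas N Q) (\<lambda>x. (f x, g x))"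
  unfolding smooth_map_def
proof (intro conjI allI)
  show "continuous_on UNIV (\<lambda>x. (f x, g x))"
    using f g unfolding smooth_map_def by (intro continuous_on_Pair) auto
  fix p and P :: "'n \<times> 'q"
  obtain r s where P: "P = (r, s)" by (cases P)
  let ?S = "cmap M p ` (cdom M p \<inter> (\<lambda>x. (f x, g x)) -` cdom (prod_atlas N Q) P)"
  have e: "(\<lambda>x. (f x, g x)) -` cdom (prod_atlas N Q) P = f -` cdom N r \<inter> g -` cdom Q s"
    unfolding P by auto
  have S: "open ?S" unfolding e
    by (rule open_cmap_image[OF M open_Int[OF open_locrep_domain(2)[OF M N f] open_locrep_domain(2)[OF M Q g]]])
  have "smooth_on ?S (cmap N r \<circ> f \<circ> cinv M p)" "smooth_on ?S (cmap Q s \<circ> g \<circ> cinv M p)"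
    by (rule smooth_on_subset[OF smooth_map_locrep[OF f]] smooth_on_subset[OF smooth_map_locrep[OF g]], force simp: P)+
  from smooth_on_Pair[OF S this]
  show "smooth_on ?S (cmap (prod_atlas N Q) P \<circ> (\<lambda>x. (f x, g x)) \<circ> cinv M p)"
    by (simp add: P o_def)
qed

lemma locd_Pair:
  assumes "x \<in> cdom M p" "f x \<in> cdom N r" "g x \<in> cdom Q s"
  shows "locd M p (prod_atlas N Q) (r, s) (\<lambda>x. (f x, g x)) x \<cdot> v
    = (locd M p N r f x \<cdot> v, locd M p Q s g x \<cdot> v)"
proof -
  have "((\<lambda>y. ((cmap N r \<circ> f \<circ> cinv M p) y, (cmap Q s \<circ> g \<circ> cinv M p) y)) has_derivative
      (\<lambda>v. (locd M p N r f x \<cdot> v, locd M p Q s g x \<cdot> v))) (at (cmap M p x))"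
    using assms by (intro has_derivative_Pair locd_has_derivative f g)
  then show ?thesis
    unfolding locd_def[of M p "prod_atlas N Q"]
    by (subst blinfun_apply_bderiv[where f' = "\<lambda>v. (locd M p N r f x \<cdot> v, locd M p Q s g x \<cdot> v)"])
      (simp_all add: o_def)
qed

end

lemma smooth_map_compose:
  fixes M :: "('m::{t2_space, second_countable_topology}, 'e::real_normed_vector) atlas"
    and N :: "('n::{t2_space, second_countable_topology}, 'f::real_normed_vector) atlas"
    and Q :: "('q::{t2_space, second_countable_topology}, 'g::real_normed_vector) atlas"
  assumes M: "smooth_manifold M" and N: "smooth_manifold N" and Q: "smooth_manifold Q"
    and f: "smooth_map M N f" and g: "smooth_map N Q g"
  shows "smooth_map M Q (g \<circ> f)"
  unfolding smooth_map_def
proof (intro conjI allI)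
  have cf: "continuous_on UNIV f" and cg: "continuous_on UNIV g"
    using f g by (auto simp: smooth_map_def)
  show "continuous_on UNIV (g \<circ> f)"
    using continuous_on_compose[OF cf] continuous_on_subset[OF cg] by blast
  fix p q
  show "smooth_on (cmap M p ` (cdom M p \<inter> (g \<circ> f) -` cdom Q q)) (cmap Q q \<circ> (g \<circ> f) \<circ> cinv M p)"
  proof (rule smooth_on_local)
    fix y assume "y \<in> cmap M p ` (cdom M p \<inter> (g \<circ> f) -` cdom Q q)"
    then obtain x where x: "x \<in> cdom M p" "g (f x) \<in> cdom Q q" "y = cmap M p x" by auto
    define r where "r = f x"
    define F where "F = cmap N r \<circ> f \<circ> cinv M p"
    define H where "H = cmap Q q \<circ> g \<circ> cinv N r"
    define U where "U = cmap N r ` (cdom N r \<inter> g -` cdom Q q)"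
    define T where "T = cmap M p ` (cdom M p \<inter> f -` (cdom N r \<inter> g -` cdom Q q))"
    have U: "open U" unfolding U_def by (rule open_locrep_domain(1)[OF N Q g])
    have "open (f -` (cdom N r \<inter> g -` cdom Q q))"
      by (rule open_vimage[OF _ cf], rule open_Int[OF open_cdom[OF N] open_locrep_domain(2)[OF N Q g]])
    then have T: "open T" unfolding T_def by (rule open_cmap_image[OF M])
    have yT: "y \<in> T" using x mem_cdom[OF N] unfolding T_def r_def by auto
    have F: "smooth_on T F" unfolding T_def F_def
      by (rule smooth_on_subset[OF smooth_map_locrep[OF f]]) auto
    have H: "smooth_on U H" unfolding U_def H_def by (rule smooth_map_locrep[OF g])
    have FU: "F z \<in> U" if "z \<in> T" for z
      using that unfolding T_def F_def U_def by (auto simp: cinv_cmap[OF M])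
    from smooth_on_compose[OF fin_dim_model[OF N] T U FU F H]
    have "smooth_on T (\<lambda>z. H (F z))" by simp
    then have "smooth_on T (cmap Q q \<circ> (g \<circ> f) \<circ> cinv M p)"
      by (rule smooth_on_cong[OF T]) (auto simp: T_def H_def F_def cinv_cmap[OF M] cinv_cmap[OF N])
    with T yT show "\<exists>T. open T \<and> y \<in> T \<and> smooth_on T (cmap Q q \<circ> (g \<circ> f) \<circ> cinv M p)" by blast
  qed
qed

section \<open>Left-invariant fields and forms on a Lie group\<close>

context
  fixes K :: "('k::{t2_space, second_countable_topology}, 'e::real_normed_vector) atlas"
    and mul :: "'k \<Rightarrow> 'k \<Rightarrow> 'k" and one :: 'k and iv :: "'k \<Rightarrow> 'k"
  assumes lg: "lie_group K mul one iv"
begin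

private abbreviation (input) "LV \<equiv> left_inv_vf K mul one"
private abbreviation (input) "LF \<equiv> left_inv_form K mul iv"

lemma lg_manifold: "smooth_manifold K"
  and lg_group: "group mul one iv"
  and lg_smooth_mul: "smooth_map (prod_atlas K K) K (case_prod mul)"
  and lg_smooth_iv: "smooth_map K K iv"
  using lg unfolding lie_group_def by blast+

interpretation group mul one iv by (rule lg_group)

lemma lg_simps: "mul k one = k" "mul one k = k" "mul (iv k) k = one" "mul k (iv k) = one"
    "mul (iv k) (mul k l) = l" "mul k (mul (iv k) l) = l"
  by (simp_all flip: assoc)

lemma lg_manifold_prod: "smooth_manifold (prod_atlas K K)"
  by (rule smooth_manifold_prod[OF lg_manifold lg_manifold])

lemma smooth_map_const_id: "smooth_map K (prod_atlas K K) (\<lambda>k. (h, id k))"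
  and smooth_map_id_const: "smooth_map K (prod_atlas K K) (\<lambda>h. (id h, k))"
  by (rule smooth_map_Pair[OF lg_manifold lg_manifold lg_manifold smooth_map_const[OF lg_manifold]
        smooth_map_id[OF lg_manifold]],
      rule smooth_map_Pair[OF lg_manifold lg_manifold lg_manifold smooth_map_id[OF lg_manifold]
            smooth_map_const[OF lg_manifold]])

lemma smooth_mul_left: "smooth_map K K (mul h)"
  using smooth_map_compose[OF lg_manifold lg_manifold_prod lg_manifold smooth_map_const_id lg_smooth_mul, of h]
  by (simp add: o_def)

text \<open>Translations become partial Jacobians of the multiplication, so that their dependence on
  the translating element is controlled by smoothness of the multiplication.\<close>

lemma locd_mul_left:
  assumes "h \<in> cdom K p" "k \<in> cdom K q" "mul h k \<in> cdom K r"
  shows "locd K q K r (mul h) k \<cdot> v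
    = locd (prod_atlas K K) (p, q) K r (case_prod mul) (h, k) \<cdot> (0, v)"
proof -
  have "locd K q K r ((case_prod mul) \<circ> (\<lambda>k. (h, id k))) k
      = locd (prod_atlas K K) (p, q) K r (case_prod mul) (h, id k) o\<^sub>L locd K q (prod_atlas K K) (p, q) (\<lambda>k. (h, id k)) k"
    using assms by (intro locd_compose[OF lg_manifold lg_manifold_prod smooth_map_const_id lg_smooth_mul]) auto
  moreover have "locd K q (prod_atlas K K) (p, q) (\<lambda>k. (h, id k)) k \<cdot> v = (0, v)"
    using locd_Pair[OF lg_manifold lg_manifold lg_manifold smooth_map_const[OF lg_manifold]
          smooth_map_id[OF lg_manifold], of k q h p q v] assms
    by (simp add: locd_const locd_id[OF lg_manifold])
  moreover have "(case_prod mul) \<circ> (\<lambda>k. (h, id k)) = mul h" by auto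
  ultimately show ?thesis by simp
qed

lemma locd_mul_right:
  assumes "h \<in> cdom K p" "k \<in> cdom K q" "mul h k \<in> cdom K r"
  shows "locd K p K r (\<lambda>h. mul h k) h \<cdot> v
    = locd (prod_atlas K K) (p, q) K r (case_prod mul) (h, k) \<cdot> (v, 0)"
proof -
  have "locd K p K r ((case_prod mul) \<circ> (\<lambda>h. (id h, k))) h
      = locd (prod_atlas K K) (p, q) K r (case_prod mul) (id h, k) o\<^sub>L locd K p (prod_atlas K K) (p, q) (\<lambda>h. (id h, k)) h"
    using assms by (intro locd_compose[OF lg_manifold lg_manifold_prod smooth_map_id_const lg_smooth_mul]) auto
  moreover have "locd K p (prod_atlas K K) (p, q) (\<lambda>h. (id h, k)) h \<cdot> v = (v, 0)"
    using locd_Pair[OF lg_manifold lg_manifold lg_manifold smooth_map_id[OF lg_manifold]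
          smooth_map_const[OF lg_manifold], of h p p k q v] assms
    by (simp add: locd_const locd_id[OF lg_manifold])
  moreover have "(case_prod mul) \<circ> (\<lambda>h. (id h, k)) = (\<lambda>h. mul h k)" by auto
  ultimately show ?thesis by simp
qed

lemma left_inv_vf_eq: "LV v k = locd K one K k (mul k) one \<cdot> v"
  by (simp add: left_inv_vf_def tangent_map_eq_locd lg_simps)

text \<open>Over a whole chart the field is a partial derivative, at the unit, of one fixed
  coordinate expression of the multiplication. This gives smoothness, and later identifies the
  derivative of the field with a mixed second derivative.\<close>

lemma vf_rep_left_inv:
  assumes "k \<in> cdom K q"
  shows "vf_rep K q (LV v) (cmap K q k)
    = bderiv (cmap K q \<circ> (case_prod mul) \<circ> cinv (prod_atlas K K) (q, one)) (cmap K q k, cmap K one one) \<cdot> (0, v)"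
proof -
  have "vf_rep K q (LV v) (cmap K q k) = (locd K k K q id k o\<^sub>L locd K one K k (mul k) one) \<cdot> v"
    by (simp add: vf_rep_eq[OF lg_manifold] cinv_cmap[OF lg_manifold assms] left_inv_vf_eq)
  also have "locd K k K q id k o\<^sub>L locd K one K k (mul k) one = locd K one K q (id \<circ> mul k) one"
    using locd_compose[OF lg_manifold lg_manifold smooth_mul_left smooth_map_id[OF lg_manifold], of one one k k q]
      assms mem_cdom[OF lg_manifold] by (simp add: lg_simps)
  also have "locd K one K q (id \<circ> mul k) one \<cdot> v
      = locd (prod_atlas K K) (q, one) K q (case_prod mul) (k, one) \<cdot> (0, v)"
    using locd_mul_left[of k q one one q v] assms mem_cdom[OF lg_manifold] by (simp add: lg_simps)
  finally show ?thesis by (simp add: locd_def)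
qed

lemma smooth_left_inv_vf: "smooth_vf_on K UNIV (LV v)"
  unfolding smooth_vf_on_def
proof
  fix q
  define m where "m = cmap K q \<circ> (case_prod mul) \<circ> cinv (prod_atlas K K) (q, one)"
  define S where "S = cmap (prod_atlas K K) (q, one) ` (cdom (prod_atlas K K) (q, one) \<inter> (case_prod mul) -` cdom K q)"
  define j where "j y = (y, cmap K one one)" for y :: 'e
  have S: "open S" unfolding S_def by (rule open_locrep_domain(1)[OF lg_manifold_prod lg_manifold lg_smooth_mul])
  have m: "smooth_on S m" unfolding S_def m_def by (rule smooth_map_locrep[OF lg_smooth_mul])
  have j: "smooth_on (cimg K q) j"
    unfolding j_def by (intro smooth_on_Pair smooth_on_id smooth_on_const open_cimg[OF lg_manifold])
  have jS: "j y \<in> S" if "y \<in> cimg K q" for y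
  proof -
    have "j y = cmap (prod_atlas K K) (q, one) (cinv K q y, one)" by (simp add: j_def cmap_cinv[OF lg_manifold that])
    moreover have "(cinv K q y, one) \<in> cdom (prod_atlas K K) (q, one) \<inter> (case_prod mul) -` cdom K q"
      using cinv_mem[OF lg_manifold that] mem_cdom[OF lg_manifold] by (simp add: lg_simps)
    ultimately show ?thesis unfolding S_def by blast
  qed
  from smooth_on_compose[OF fin_dim_model[OF lg_manifold_prod] open_cimg[OF lg_manifold] S jS j
        smooth_on_bderiv_apply[OF S m]]
  have "smooth_on (cimg K q) (\<lambda>y. bderiv m (j y) \<cdot> (0, v))" by simp
  then have "smooth_on (cimg K q) (vf_rep K q (LV v))"
  proof (rule smooth_on_cong[OF open_cimg[OF lg_manifold]])
    show "bderiv m (j y) \<cdot> (0, v) = vf_rep K q (LV v) y" if "y \<in> cimg K q" for y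
      using vf_rep_left_inv[OF cinv_mem[OF lg_manifold that], of v] by (simp add: cmap_cinv[OF lg_manifold that] m_def j_def)
  qed
  then show "smooth_on (cmap K q ` (cdom K q \<inter> UNIV)) (vf_rep K q (LV v))"
    by (simp add: cimg_def)
qed

text \<open>Translation by \<open>iv k\<close> moves with k, so the partial Jacobian of the
  multiplication is evaluated along k -> (\<open>iv k\<close>, k). A chart around one inverse covers
  nearby inverses only, hence the local argument.\<close>

lemma smooth_left_inv_form: "smooth_form K (LF \<xi>)"
  unfolding smooth_form_def
proof
  fix q
  show "smooth_on (cimg K q) (form_rep K q (LF \<xi>))"
  proof (rule smooth_on_local)
    fix y0 assume y0: "y0 \<in> cimg K q"
    define r where "r = iv (cinv K q y0)"
    define i where "i = cmap K r \<circ> iv \<circ> cinv K q"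
    define T where "T = cmap K q ` (cdom K q \<inter> iv -` cdom K r)"
    define m where "m = cmap K one \<circ> (case_prod mul) \<circ> cinv (prod_atlas K K) (r, q)"
    define S where "S = cmap (prod_atlas K K) (r, q) ` (cdom (prod_atlas K K) (r, q) \<inter> (case_prod mul) -` cdom K one)"
    define j where "j y = (i y, y)" for y
    have S: "open S" unfolding S_def by (rule open_locrep_domain(1)[OF lg_manifold_prod lg_manifold lg_smooth_mul])
    have T: "open T" unfolding T_def by (rule open_locrep_domain(1)[OF lg_manifold lg_manifold lg_smooth_iv])
    have y0T: "y0 \<in> T" unfolding T_def cmap_image_eq[OF lg_manifold]
      using y0 mem_cdom[OF lg_manifold] by (simp add: r_def)
    have m: "smooth_on S m" unfolding S_def m_def by (rule smooth_map_locrep[OF lg_smooth_mul])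
    have i: "smooth_on T i" unfolding T_def i_def by (rule smooth_map_locrep[OF lg_smooth_iv])
    have j: "smooth_on T j" unfolding j_def by (intro smooth_on_Pair smooth_on_id i T)
    have jS: "j y \<in> S" if yT: "y \<in> T" for y
    proof -
      obtain k where k: "k \<in> cdom K q" "iv k \<in> cdom K r" "y = cmap K q k" using yT unfolding T_def by auto
      have "j y = cmap (prod_atlas K K) (r, q) (iv k, k)" by (simp add: j_def i_def k(3) cinv_cmap[OF lg_manifold k(1)])
      moreover have "(iv k, k) \<in> cdom (prod_atlas K K) (r, q) \<inter> (case_prod mul) -` cdom K one"
        using k mem_cdom[OF lg_manifold] by (simp add: lg_simps)
      ultimately show ?thesis unfolding S_def by blast
    qed
    have "smooth_on T (form_rep K q (LF \<xi>))"
    proof (rule smooth_on_blinfunI[OF fin_dim_model[OF lg_manifold] T])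
      fix w
      from smooth_on_compose[OF fin_dim_model[OF lg_manifold_prod] T S jS j smooth_on_bderiv_apply[OF S m]]
      have "smooth_on T (\<lambda>y. bderiv m (j y) \<cdot> (0, w))" by simp
      from smooth_on_linear[OF T blinfun.bounded_linear_right this]
      have "smooth_on T (\<lambda>y. \<xi> \<cdot> (bderiv m (j y) \<cdot> (0, w)))" .
      then show "smooth_on T (\<lambda>y. form_rep K q (LF \<xi>) y \<cdot> w)"
      proof (rule smooth_on_cong[OF T])
        fix y assume yT: "y \<in> T"
        then obtain k where k: "k \<in> cdom K q" "iv k \<in> cdom K r" "y = cmap K q k" unfolding T_def by auto
        have "form_rep K q (LF \<xi>) y \<cdot> w
            = \<xi> \<cdot> ((locd K k K one (mul (iv k)) k o\<^sub>L locd K q K k id k) \<cdot> w)"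
          by (simp add: form_rep_def k(3) cinv_cmap[OF lg_manifold k(1)] left_inv_form_def tangent_map_eq_locd lg_simps)
        also have "locd K k K one (mul (iv k)) k o\<^sub>L locd K q K k id k = locd K q K one (mul (iv k) \<circ> id) k"
          using locd_compose[OF lg_manifold lg_manifold smooth_map_id[OF lg_manifold] smooth_mul_left, of k q k "iv k" one]
            k mem_cdom[OF lg_manifold] by (simp add: lg_simps)
        also have "locd K q K one (mul (iv k) \<circ> id) k \<cdot> w
            = locd (prod_atlas K K) (r, q) K one (case_prod mul) (iv k, k) \<cdot> (0, w)"
          using locd_mul_left[of "iv k" r k q one w] k mem_cdom[OF lg_manifold] by (simp add: lg_simps)
        also have "\<dots> = bderiv m (j y) \<cdot> (0, w)"
          by (simp add: locd_def m_def j_def i_def k(3) cinv_cmap[OF lg_manifold k(1)])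
        finally show "\<xi> \<cdot> (bderiv m (j y) \<cdot> (0, w)) = form_rep K q (LF \<xi>) y \<cdot> w" by simp
      qed
    qed
    with T y0T show "\<exists>T. open T \<and> y0 \<in> T \<and> smooth_on T (form_rep K q (LF \<xi>))" by blast
  qed
qed

lemma tangent_mul_left_inverse:
  "tangent_map K K (mul (iv k)) k \<cdot> LV v k = v"
  "LV (tangent_map K K (mul (iv k)) k \<cdot> w) k = w"
proof -
  have 1: "tangent_map K K (mul (iv k)) k = locd K k K one (mul (iv k)) k"
    by (simp add: tangent_map_eq_locd lg_simps)
  have i1: "mul (iv k) \<circ> mul k = id" and i2: "mul k \<circ> mul (iv k) = id" by (auto simp: lg_simps)
  have "locd K k K one (mul (iv k)) k o\<^sub>L locd K one K k (mul k) one = locd K one K one id one"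
    using locd_compose[OF lg_manifold lg_manifold smooth_mul_left smooth_mul_left, of one one k k "iv k" one]
      mem_cdom[OF lg_manifold] by (simp add: lg_simps i1)
  then have "(locd K k K one (mul (iv k)) k o\<^sub>L locd K one K k (mul k) one) \<cdot> v = v"
    by (simp add: locd_id[OF lg_manifold mem_cdom[OF lg_manifold]])
  then show "tangent_map K K (mul (iv k)) k \<cdot> LV v k = v"
    by (simp add: 1 left_inv_vf_eq)
  have "locd K one K k (mul k) one o\<^sub>L locd K k K one (mul (iv k)) k = locd K k K k id k"
    using locd_compose[OF lg_manifold lg_manifold smooth_mul_left smooth_mul_left, of k k "iv k" one k k]
      mem_cdom[OF lg_manifold] by (simp add: lg_simps i2)
  then have "(locd K one K k (mul k) one o\<^sub>L locd K k K one (mul (iv k)) k) \<cdot> w = w"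
    by (simp add: locd_id[OF lg_manifold mem_cdom[OF lg_manifold]])
  then show "LV (tangent_map K K (mul (iv k)) k \<cdot> w) k = w"
    by (simp add: 1 left_inv_vf_eq)
qed

lemma left_inv_vf_one: "LV v one = v"
proof -
  have "mul one = id" by (auto simp: lg_simps)
  then show ?thesis by (simp add: left_inv_vf_eq locd_id[OF lg_manifold mem_cdom[OF lg_manifold]])
qed

lemma left_inv_form_vf:
  "LF \<xi> k \<cdot> LV v k = \<xi> \<cdot> v"
  by (simp add: left_inv_form_def tangent_mul_left_inverse)

text \<open>The pairing of a left-invariant form with a left-invariant field is constant; its
  derivative is zero, and the product rule moves the derivative from the form to the field.\<close>

lemma Dform_left_inv:
  "Dform K (LF \<xi>) k \<cdot> w \<cdot> LV v k = - LF \<xi> k \<cdot> (Dvf K (LV v) k \<cdot> w)"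
proof -
  have "Dfun K (\<lambda>k. LF \<xi> k \<cdot> LV v k) k = 0"
    unfolding left_inv_form_vf Dfun_def o_def
    by (intro blinfun_eqI) (simp add: blinfun_apply_bderiv[OF has_derivative_const])
  then show ?thesis
    using Dfun_pairing[OF lg_manifold smooth_left_inv_form smooth_left_inv_vf, of \<xi> v k w] by simp
qed

lemma maurer_cartan:
  "ext_deriv K (LF \<xi>) k (LV u k) (LV v k) = - LF \<xi> k \<cdot>
        lie_bracket K (LV u) (LV v) k"
  by (simp add: ext_deriv_def Dform_left_inv lie_bracket_eq blinfun.diff_right)

end

section \<open>Differentiating the multiplicativity of the bivector field\<close>

definition inl :: "'e::real_normed_vector \<Rightarrow>\<^sub>L ('e \<times> 'f::real_normed_vector)" where
  "inl = Blinfun (\<lambda>v. (v, 0))"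

definition inr :: "'f::real_normed_vector \<Rightarrow>\<^sub>L ('e::real_normed_vector \<times> 'f)" where
  "inr = Blinfun (\<lambda>w. (0, w))"

lemma inl_inr_apply [simp]: "inl \<cdot> v = (v, 0)" "inr \<cdot> w = (0, w)"
  unfolding inl_def inr_def
  by (simp_all add: bounded_linear_Blinfun_apply bounded_linear_Pair bounded_linear_ident bounded_linear_zero)

lemma fusion_bivector_apply:
  "fusion_bivector G \<rho> \<pi> \<rho>' \<pi>' (h, k) \<cdot> \<omega> \<cdot> \<eta> = \<pi> h \<cdot> (\<omega> o\<^sub>L inl) \<cdot> (\<eta> o\<^sub>L inl)
    + \<pi>' k \<cdot> (\<omega> o\<^sub>L inr) \<cdot> (\<eta> o\<^sub>L inr) - (1/2) * tsum G (\<lambda>a b. \<omega> \<cdot> (\<rho> a h, 0) * \<eta> \<cdot> (0, \<rho>' b k)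
        - \<eta> \<cdot> (\<rho> a h, 0) * \<omega> \<cdot> (0, \<rho>' b k))"
  by (simp add: fusion_bivector_def blinfun.bilinear_simps tmap2_apply tsum_apply2 wedge_def tens_apply
      inl_def[symmetric] inr_def[symmetric] mult.commute)

context
  fixes G :: "'g::real_vector quad_lie"
    and K :: "('k::{t2_space, second_countable_topology}, 'e::real_normed_vector) atlas"
    and mul :: "'k \<Rightarrow> 'k \<Rightarrow> 'k" and one :: 'k and iv :: "'k \<Rightarrow> 'k"
    and \<rho> :: "'g \<Rightarrow> 'k \<Rightarrow> 'e" and \<pi> :: "'k \<Rightarrow> 'e tensor2"
  assumes G: "quadratic_lie_algebra G" and qplg: "quasi_poisson_lie_group G K mul one iv \<rho> \<pi>"
begin

private abbreviation (input) "LI \<equiv> left_inv_vf K mul one"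

lemma qplg_lie_group: "lie_group K mul one iv"
  and qplg_qpm: "quasi_poisson_manifold G K \<rho> \<pi>"
  and qplg_map: "quasi_poisson_map (prod_atlas K K) (fusion_action \<rho> \<rho>) (fusion_bivector G \<rho> \<pi> \<rho> \<pi>) K \<rho> \<pi>
       (case_prod mul)"
  using qplg unfolding quasi_poisson_lie_group_def by blast+

private lemmas K = lg_manifold[OF qplg_lie_group]
  and KK = lg_manifold_prod[OF qplg_lie_group]
  and group_simps = lg_simps[OF qplg_lie_group]
  and smooth_mul = lg_smooth_mul[OF qplg_lie_group]

lemma multiplicative_action:
  "locd (prod_atlas K K) (h, k) K (mul h k) (case_prod mul) (h, k) \<cdot> (\<rho> u h, \<rho> u k) = \<rho> u (mul h k)"
proof -
  have "tangent_map (prod_atlas K K) K (case_prod mul) x \<cdot> fusion_action \<rho> \<rho> u x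
      = \<rho> u ((case_prod mul) x)" for x
    using qplg_map unfolding quasi_poisson_map_def by blast
  from this[of "(h, k)"] show ?thesis by (simp add: tangent_map_eq_locd fusion_action_def)
qed

lemma multiplicative_bivector:
  "fusion_bivector G \<rho> \<pi> \<rho> \<pi> (h, k) \<cdot>
      (\<alpha> o\<^sub>L locd (prod_atlas K K) (h, k) K (mul h k) (case_prod mul) (h, k)) \<cdot>
      (\<beta> o\<^sub>L locd (prod_atlas K K) (h, k) K (mul h k) (case_prod mul) (h, k)) = \<pi> (mul h k) \<cdot> \<alpha> \<cdot> \<beta>"
proof -
  have "tmap2 (tangent_map (prod_atlas K K) K (case_prod mul) x) (tangent_map (prod_atlas K K) K (case_prod mul) x)
      (fusion_bivector G \<rho> \<pi> \<rho> \<pi> x) = \<pi> ((case_prod mul) x)" for x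
    using qplg_map unfolding quasi_poisson_map_def by blast
  from this[of "(h, k)"] show ?thesis by (simp add: tangent_map_eq_locd flip: tmap2_apply)
qed

lemma locd_mul_one:
  "locd (prod_atlas K K) (h, one) K h (case_prod mul) (h, one) \<cdot> (v, w) = v + LI w h"
proof -
  let ?W = "locd (prod_atlas K K) (h, one) K h (case_prod mul) (h, one)"
  have "(\<lambda>h. mul h one) = id" by (auto simp: group_simps)
  then have 1: "?W \<cdot> (v, 0) = v"
    using locd_mul_right[OF qplg_lie_group, of h h one one h v] mem_cdom[OF K]
    by (simp add: group_simps locd_id[OF K])
  have 2: "?W \<cdot> (0, w) = LI w h"
    using locd_mul_left[OF qplg_lie_group, of h h one one h w] mem_cdom[OF K]
    by (simp add: group_simps left_inv_vf_eq[OF qplg_lie_group])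
  have "?W \<cdot> (v, w) = ?W \<cdot> ((v, 0) + (0, w))" by simp
  then show ?thesis unfolding blinfun.add_right 1 2 .
qed

text \<open>At (1, 1) equivariance of the multiplication reads \<rho>(u) + \<rho>(u) =
  \<rho>(u).\<close>

lemma action_one: "\<rho> u one = 0"
  using multiplicative_action[of one one u]
  by (simp add: group_simps locd_mul_one left_inv_vf_one[OF qplg_lie_group])

text \<open>At (1, 1) the mixed term of the fusion product vanishes together with \<rho>, and
  multiplicativity reads \<pi> + \<pi> = \<pi>.\<close>

lemma bivector_one: "\<pi> one = 0"
proof (rule tensor2_eqI)
  fix \<alpha> \<beta> :: "'e dual"
  let ?W = "locd (prod_atlas K K) (one, one) K one (case_prod mul) (one, one)"
  have l: "(\<omega> o\<^sub>L ?W) o\<^sub>L inl = \<omega>" and r: "(\<omega> o\<^sub>L ?W) o\<^sub>L inr = \<omega>" for \<omega> :: "'e dual"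
    using locd_mul_one[of one _ 0] locd_mul_one[of one 0]
    by (auto intro!: blinfun_eqI simp: left_inv_vf_one[OF qplg_lie_group])
  show "\<pi> one \<cdot> \<alpha> \<cdot> \<beta> = 0 \<cdot> \<alpha> \<cdot> \<beta>"
    using multiplicative_bivector[of one one \<alpha> \<beta>]
    by (simp add: group_simps fusion_bivector_apply l r action_one tsum_def flip: zero_prod_def)
qed

text \<open>Multiplicativity holds in the charts at k and h k, which move with k. Transported to the
  fixed charts at 1 and h it becomes an equation between functions of the coordinate z of k, ready
  to be differentiated.\<close>

lemma multiplicative_bivector_chart:
  fixes h :: 'k
  defines "m \<equiv> cmap K h \<circ> (case_prod mul) \<circ> cinv (prod_atlas K K) (h, one)"
    and "E \<equiv> \<lambda>z. bderiv (cmap K h \<circ> (case_prod mul) \<circ> cinv (prod_atlas K K) (h, one)) (cmap K h h, z)"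
  assumes z: "z \<in> cimg K one" "mul h (cinv K one z) \<in> cdom K h"
  shows "t2_rep K h \<pi> (m (cmap K h h, z)) \<cdot> \<alpha> \<cdot> \<beta>
    = \<pi> h \<cdot> (\<alpha> o\<^sub>L (E z o\<^sub>L inl)) \<cdot> (\<beta> o\<^sub>L (E z o\<^sub>L inl))
    + t2_rep K one \<pi> z \<cdot> (\<alpha> o\<^sub>L (E z o\<^sub>L inr)) \<cdot> (\<beta> o\<^sub>L (E z o\<^sub>L inr))
    - (1/2) * tsum G (\<lambda>a b. \<alpha> \<cdot> (E z \<cdot> (\<rho> a h, 0)) * \<beta> \<cdot> (E z \<cdot> (0, vf_rep K one (\<rho> b) z))
        - \<beta> \<cdot> (E z \<cdot> (\<rho> a h, 0)) * \<alpha> \<cdot> (E z \<cdot> (0, vf_rep K one (\<rho> b) z)))"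
proof -
  define k where "k = cinv K one z"
  define l where "l = mul h k"
  have k: "k \<in> cdom K one" unfolding k_def by (rule cinv_mem[OF K z(1)])
  have zk: "z = cmap K one k" unfolding k_def by (simp add: cmap_cinv[OF K z(1)])
  have l: "l \<in> cdom K h" using z(2) by (simp add: l_def k_def)
  have hk: "cinv (prod_atlas K K) (h, one) (cmap K h h, z) = (h, k)"
    using cinv_prod_atlas[OF K K cmap_mem[OF K mem_cdom[OF K]] z(1)] cinv_cmap[OF K mem_cdom[OF K]]
    by (simp add: k_def)
  have ml: "m (cmap K h h, z) = cmap K h l" by (simp add: m_def hk l_def)
  have E: "E z = locd (prod_atlas K K) (h, one) K h (case_prod mul) (h, k)"
    by (simp add: E_def locd_def zk)
  let ?W = "locd (prod_atlas K K) (h, k) K h (case_prod mul) (h, k)"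
  let ?c = "locd K k K one id k"
  have W: "locd K l K h id l o\<^sub>L locd (prod_atlas K K) (h, k) K l (case_prod mul) (h, k) = ?W"
    using locd_compose[OF KK K smooth_mul smooth_map_id[OF K], of "(h, k)" "(h, k)" l h] l mem_cdom[OF K]
    by (simp add: l_def)
  have W1: "?W \<cdot> (v, 0) = E z \<cdot> (v, 0)" for v
    unfolding E using locd_mul_right[OF qplg_lie_group, of h h k k h v] locd_mul_right[OF qplg_lie_group, of h h k one h v]
      l k mem_cdom[OF K] by (simp add: l_def)
  \<comment> \<open>The factor \<open>?c\<close> changes from the chart at k to the chart at the
    unit; it is what turns \<pi> and \<rho> at k into their expressions in the latter.\<close>
  have W2: "?W \<cdot> (0, w) = E z \<cdot> (0, ?c \<cdot> w)" for w
  proof -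
    have "?W \<cdot> (0, w) = locd K k K h (mul h \<circ> id) k \<cdot> w"
      using locd_mul_left[OF qplg_lie_group, of h h k k h w] l mem_cdom[OF K] by (simp add: l_def)
    also have "locd K k K h (mul h \<circ> id) k = locd K one K h (mul h) k o\<^sub>L ?c"
      using locd_compose[OF K K smooth_map_id[OF K] smooth_mul_left[OF qplg_lie_group], of k k one h h]
        l k mem_cdom[OF K] by (simp add: l_def)
    also have "blinfun_apply \<dots> w = E z \<cdot> (0, ?c \<cdot> w)"
      unfolding E using locd_mul_left[OF qplg_lie_group, of h h k one h "?c \<cdot> w"] l k mem_cdom[OF K]
      by (simp add: l_def)
    finally show ?thesis .
  qed
  have f1: "(\<omega> o\<^sub>L ?W) o\<^sub>L inl = \<omega> o\<^sub>L (E z o\<^sub>L inl)" and f2: "(\<omega> o\<^sub>L ?W) o\<^sub>L inr = (\<omega> o\<^sub>L (E z o\<^sub>L inr)) o\<^sub>L ?c"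
    for \<omega> :: "'e dual"
    by (auto intro!: blinfun_eqI simp: W1 W2)
  have "t2_rep K h \<pi> (m (cmap K h h, z)) \<cdot> \<alpha> \<cdot> \<beta>
      = \<pi> l \<cdot> (\<alpha> o\<^sub>L locd K l K h id l) \<cdot> (\<beta> o\<^sub>L locd K l K h id l)"
    by (simp add: ml t2_rep_apply[OF K] cinv_cmap[OF K l])
  also have "\<dots> = fusion_bivector G \<rho> \<pi> \<rho> \<pi> (h, k) \<cdot> (\<alpha> o\<^sub>L ?W) \<cdot> (\<beta> o\<^sub>L ?W)"
    unfolding l_def multiplicative_bivector[symmetric] blinfun_compose_assoc W[unfolded l_def] ..
  finally show ?thesis
    unfolding fusion_bivector_apply f1 f2
    by (simp add: W1 W2 t2_rep_apply[OF K] vf_rep_eq[OF K] k_def[symmetric])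
qed

text \<open>The mixed second derivative of the multiplication at \<open>(h, 1)\<close> is, by symmetry, the derivative of
  the left-invariant vector field at \<open>h\<close>; of the factors at the unit only the derivatives survive,
  since \<open>\<pi>\<close> and \<open>\<rho>\<close> vanish there.\<close>

lemma Dt2_left_invariant:
  "Dt2 K \<pi> h \<cdot> LI v h \<cdot> \<alpha> \<cdot> \<beta> = \<pi> h \<cdot> (\<alpha> o\<^sub>L Dvf K (LI v) h) \<cdot> \<beta> + \<pi> h \<cdot> \<alpha> \<cdot> (\<beta> o\<^sub>L Dvf K (LI v) h)
    + Dt2 K \<pi> one \<cdot> v \<cdot> (\<alpha> o\<^sub>L tangent_map K K (mul h) one) \<cdot> (\<beta> o\<^sub>L tangent_map K K (mul h) one)
    - (1/2) * tsum G (\<lambda>a b. \<alpha> \<cdot> \<rho> a h * \<beta> \<cdot> LI (Dvf K (\<rho> b) one \<cdot> v) h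
        - \<beta> \<cdot> \<rho> a h * \<alpha> \<cdot> LI (Dvf K (\<rho> b) one \<cdot> v) h)"
proof -
  define m where "m = cmap K h \<circ> (case_prod mul) \<circ> cinv (prod_atlas K K) (h, one)"
  define S where "S = cmap (prod_atlas K K) (h, one) ` (cdom (prod_atlas K K) (h, one) \<inter> (case_prod mul) -` cdom K h)"
  define y0 where "y0 = cmap K h h"
  define z0 where "z0 = cmap K one one"
  define E where "E z = bderiv m (y0, z)" for z
  define \<Gamma> where "\<Gamma> = bderiv (bderiv m) (y0, z0)"
  \<comment> \<open>The coordinates of those k for which h k stays in the chart at h. As an open
    neighbourhood of the unit's coordinates it is enough for comparing derivatives.\<close>
  define Z where "Z = cmap K one ` (cdom K one \<inter> mul h -` cdom K h)"
  have S: "open S" unfolding S_def by (rule open_locrep_domain(1)[OF KK K smooth_mul])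
  have Z: "open Z" unfolding Z_def by (rule open_locrep_domain(1)[OF K K smooth_mul_left[OF qplg_lie_group]])
  have m: "smooth_on S m" unfolding S_def m_def by (rule smooth_map_locrep[OF smooth_mul])
  have z0Z: "z0 \<in> Z" unfolding Z_def z0_def using mem_cdom[OF K] by (auto simp: group_simps)
  have yzS: "(y0, z0) \<in> S"
    unfolding S_def y0_def z0_def using mem_cdom[OF K]
    by (intro image_eqI[of _ _ "(h, one)"]) (auto simp: group_simps)
  have dm: "smooth_on S (bderiv m)" by (rule smooth_on_bderiv[OF fin_dim_model[OF KK] S m])
  have E0: "E z0 \<cdot> (v, w) = v + LI w h" for v w
    using locd_mul_one[of h v w] by (simp add: E_def m_def locd_def y0_def z0_def)
  have pz: "((\<lambda>z. (y0, z)) has_derivative (\<lambda>v. (0, v))) (at z0)"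
    by (intro has_derivative_Pair has_derivative_const has_derivative_ident)
  have dE: "(E has_derivative (\<lambda>v. \<Gamma> \<cdot> (0, v))) (at z0)"
    unfolding E_def[abs_def] \<Gamma>_def
    using has_derivative_compose[OF pz smooth_on_has_derivative[OF dm yzS]] .
  have py: "((\<lambda>y. (y, z0)) has_derivative (\<lambda>w. (w, 0))) (at y0)"
    by (intro has_derivative_Pair has_derivative_const has_derivative_ident)
  have G1: "\<Gamma> \<cdot> (0, v) \<cdot> (w, 0) = Dvf K (LI v) h \<cdot> w" for v w
  proof -
    have "\<Gamma> \<cdot> (0, v) \<cdot> (w, 0) = \<Gamma> \<cdot> (w, 0) \<cdot> (0, v)"
      using second_derivative_symmetric[OF fin_dim_model[OF K] S m yzS, of "(w, 0)" "(0, v)"]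
      unfolding \<Gamma>_def bderiv_apply_const[OF smooth_on_differentiable[OF dm yzS]] .
    moreover have "((\<lambda>y. bderiv m (y, z0) \<cdot> (0, v)) has_derivative
        (\<lambda>w. \<Gamma> \<cdot> (w, 0) \<cdot> (0, v))) (at y0)"
      unfolding \<Gamma>_def
      by (rule bounded_linear.has_derivative[OF blinfun.bounded_linear_left
            has_derivative_compose[OF py smooth_on_has_derivative[OF dm yzS]]])
    then have "(vf_rep K h (LI v) has_derivative (\<lambda>w. \<Gamma> \<cdot> (w, 0) \<cdot> (0, v))) (at y0)"
    proof (rule has_derivative_cong_open[OF _ open_cimg[OF K, of h]])
      show "y0 \<in> cimg K h" unfolding y0_def by (rule cmap_mem[OF K mem_cdom[OF K]])
      show "bderiv m (y, z0) \<cdot> (0, v) = vf_rep K h (LI v) y" if "y \<in> cimg K h" for y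
        using vf_rep_left_inv[OF qplg_lie_group cinv_mem[OF K that], of v]
        by (simp add: cmap_cinv[OF K that] m_def z0_def)
    qed
    then have "blinfun_apply (Dvf K (LI v) h) = (\<lambda>w. \<Gamma> \<cdot> (w, 0) \<cdot> (0, v))"
      unfolding Dvf_def y0_def by (rule blinfun_apply_bderiv)
    ultimately show ?thesis by simp
  qed
  have dEl: "((\<lambda>z. \<omega> o\<^sub>L (E z o\<^sub>L inl)) has_derivative (\<lambda>v. \<omega> o\<^sub>L Dvf K (LI v) h)) (at z0)"
    for \<omega> :: "'e dual"
  proof -
    have "(\<lambda>v. \<omega> o\<^sub>L (\<Gamma> \<cdot> (0, v) o\<^sub>L inl)) = (\<lambda>v. \<omega> o\<^sub>L Dvf K (LI v) h)"
      by (intro ext blinfun_eqI) (simp add: G1)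
    then show ?thesis
      using bounded_linear.has_derivative[OF bounded_bilinear.bounded_linear_right[OF bounded_bilinear_blinfun_compose]
          bounded_linear.has_derivative[OF bounded_bilinear.bounded_linear_left[OF
                bounded_bilinear_blinfun_compose] dE], of \<omega> inl]
      by simp
  qed
  have dEr: "((\<lambda>z. \<omega> o\<^sub>L (E z o\<^sub>L inr)) has_derivative (\<lambda>v. \<omega> o\<^sub>L (\<Gamma> \<cdot> (0, v) o\<^sub>L inr))) (at z0)"
    for \<omega> :: "'e dual"
    by (rule bounded_linear.has_derivative[OF bounded_bilinear.bounded_linear_right[OF bounded_bilinear_blinfun_compose]
          bounded_linear.has_derivative[OF bounded_bilinear.bounded_linear_left[OF bounded_bilinear_blinfun_compose] dE]])
  have E0l: "\<omega> o\<^sub>L (E z0 o\<^sub>L inl) = \<omega>" and E0r: "\<omega> o\<^sub>L (E z0 o\<^sub>L inr) = \<omega> o\<^sub>L tangent_map K K (mul h) one"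
    for \<omega> :: "'e dual"
  proof -
    have "LI 0 h = 0" by (simp add: left_inv_vf_def)
    then show "\<omega> o\<^sub>L (E z0 o\<^sub>L inl) = \<omega>" by (intro blinfun_eqI) (simp add: E0)
    show "\<omega> o\<^sub>L (E z0 o\<^sub>L inr) = \<omega> o\<^sub>L tangent_map K K (mul h) one"
      by (intro blinfun_eqI) (simp add: E0 left_inv_vf_def)
  qed
  have t0: "t2_rep K one \<pi> z0 = 0" unfolding z0_def t2_rep_center[OF K] by (rule bivector_one)
  have v0: "vf_rep K one (\<rho> b) z0 = 0" for b unfolding z0_def vf_rep_center[OF K] by (rule action_one)
  have dt: "(t2_rep K one \<pi> has_derivative blinfun_apply (Dt2 K \<pi> one)) (at z0)"
    unfolding z0_def by (rule Dt2_has_derivative[OF K qpm_smooth_bivector[OF G qplg_qpm]])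
  have dv: "(vf_rep K one (\<rho> b) has_derivative blinfun_apply (Dvf K (\<rho> b) one)) (at z0)" for b
    unfolding z0_def by (rule Dvf_has_derivative[OF K qpm_smooth_action[OF G qplg_qpm]])
  have 1: "((\<lambda>z. \<pi> h \<cdot> (\<alpha> o\<^sub>L (E z o\<^sub>L inl)) \<cdot> (\<beta> o\<^sub>L (E z o\<^sub>L inl))) has_derivative
      (\<lambda>v. \<pi> h \<cdot> \<alpha> \<cdot> (\<beta> o\<^sub>L Dvf K (LI v) h) + \<pi> h \<cdot> (\<alpha> o\<^sub>L Dvf K (LI v) h) \<cdot> \<beta>)) (at z0)"
    using bounded_bilinear.FDERIV[OF bounded_bilinear_blinfun_apply
        bounded_linear.has_derivative[OF blinfun.bounded_linear_right dEl[of \<alpha>]] dEl[of \<beta>], of "\<pi> h"]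
    unfolding E0l .
  have 2: "((\<lambda>z. t2_rep K one \<pi> z \<cdot> (\<alpha> o\<^sub>L (E z o\<^sub>L inr)) \<cdot> (\<beta> o\<^sub>L (E z o\<^sub>L inr))) has_derivative
      (\<lambda>v. Dt2 K \<pi> one \<cdot> v \<cdot> (\<alpha> o\<^sub>L tangent_map K K (mul h) one) \<cdot>
         (\<beta> o\<^sub>L tangent_map K K (mul h) one))) (at z0)"
    using bounded_bilinear.FDERIV[OF bounded_bilinear_blinfun_apply
        bounded_bilinear.FDERIV[OF bounded_bilinear_blinfun_apply dt dEr[of \<alpha>]] dEr[of \<beta>]]
    unfolding E0r t0 by simp
  have f: "((\<lambda>z. \<omega> \<cdot> (E z \<cdot> (\<rho> a h, 0))) has_derivative
      (\<lambda>v. \<omega> \<cdot> (\<Gamma> \<cdot> (0, v) \<cdot> (\<rho> a h, 0)))) (at z0)" for \<omega> :: "'e dual" and a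
    by (intro bounded_linear.has_derivative[OF blinfun.bounded_linear_right]
        bounded_linear.has_derivative[OF blinfun.bounded_linear_left] dE)
  have g: "((\<lambda>z. \<omega> \<cdot> (E z \<cdot> (0, vf_rep K one (\<rho> b) z))) has_derivative
      (\<lambda>v. \<omega> \<cdot> LI (Dvf K (\<rho> b) one \<cdot> v) h)) (at z0)" for \<omega> :: "'e dual" and b
  proof -
    have "((\<lambda>z. (0 :: 'e, vf_rep K one (\<rho> b) z)) has_derivative (\<lambda>v. (0, Dvf K (\<rho> b) one \<cdot> v))) (at z0)"
      by (intro has_derivative_Pair has_derivative_const dv)
    from bounded_linear.has_derivative[OF blinfun.bounded_linear_right
        bounded_bilinear.FDERIV[OF bounded_bilinear_blinfun_apply dE this], of \<omega>]
    show ?thesis by (simp add: v0 E0 flip: zero_prod_def)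
  qed
  have fg: "((\<lambda>z. \<omega> \<cdot> (E z \<cdot> (\<rho> a h, 0)) * \<eta> \<cdot> (E z \<cdot> (0, vf_rep K one (\<rho> b) z))) has_derivative
      (\<lambda>v. \<omega> \<cdot> \<rho> a h * \<eta> \<cdot> LI (Dvf K (\<rho> b) one \<cdot> v) h)) (at z0)"
    for \<omega> \<eta> :: "'e dual" and a b
  proof -
    have "LI 0 h = 0" by (simp add: left_inv_vf_def)
    then show ?thesis
      using has_derivative_mult[OF f[of \<omega> a] g[of \<eta> b]] by (simp add: v0 E0 flip: zero_prod_def)
  qed
  have 3: "((\<lambda>z. tsum G (\<lambda>a b. \<alpha> \<cdot> (E z \<cdot> (\<rho> a h, 0)) * \<beta> \<cdot> (E z \<cdot> (0, vf_rep K one (\<rho> b) z))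
        - \<beta> \<cdot> (E z \<cdot> (\<rho> a h, 0)) * \<alpha> \<cdot> (E z \<cdot> (0, vf_rep K one (\<rho> b) z)))) has_derivative
      (\<lambda>v. tsum G (\<lambda>a b. \<alpha> \<cdot> \<rho> a h * \<beta> \<cdot> LI (Dvf K (\<rho> b) one \<cdot> v) h
        - \<beta> \<cdot> \<rho> a h * \<alpha> \<cdot> LI (Dvf K (\<rho> b) one \<cdot> v) h))) (at z0)"
    by (intro has_derivative_tsum has_derivative_diff fg)
  note rhs = has_derivative_diff[OF has_derivative_add[OF 1 2] has_derivative_mult_right[OF 3, of "1/2"]]
  have my: "m (y0, z0) = y0"
    using mem_cdom[OF K] by (simp add: m_def y0_def z0_def cinv_prod_atlas[OF K K] cmap_mem[OF K]
          cinv_cmap[OF K] group_simps)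
  have "((\<lambda>z. m (y0, z)) has_derivative (\<lambda>v. E z0 \<cdot> (0, v))) (at z0)"
    unfolding E_def using has_derivative_compose[OF pz smooth_on_has_derivative[OF m yzS]] .
  from has_derivative_compose[OF this, of "t2_rep K h \<pi>" "blinfun_apply (Dt2 K \<pi> h)"]
  have "((\<lambda>z. t2_rep K h \<pi> (m (y0, z))) has_derivative (\<lambda>v. Dt2 K \<pi> h \<cdot> LI v h)) (at z0)"
    using Dt2_has_derivative[OF K qpm_smooth_bivector[OF G qplg_qpm], of h, folded y0_def] unfolding my by (simp add: E0)
  then have lhs: "((\<lambda>z. t2_rep K h \<pi> (m (y0, z)) \<cdot> \<alpha> \<cdot> \<beta>) has_derivative
      (\<lambda>v. Dt2 K \<pi> h \<cdot> LI v h \<cdot> \<alpha> \<cdot> \<beta>)) (at z0)"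
    by (intro bounded_linear.has_derivative[OF blinfun.bounded_linear_left])
  note lhs' = has_derivative_cong_open[OF lhs Z z0Z]
  have eq: "t2_rep K h \<pi> (m (y0, z)) \<cdot> \<alpha> \<cdot> \<beta> = \<pi> h \<cdot> (\<alpha> o\<^sub>L (E z o\<^sub>L inl)) \<cdot> (\<beta> o\<^sub>L (E z o\<^sub>L inl))
    + t2_rep K one \<pi> z \<cdot> (\<alpha> o\<^sub>L (E z o\<^sub>L inr)) \<cdot> (\<beta> o\<^sub>L (E z o\<^sub>L inr))
    - (1/2) * tsum G (\<lambda>a b. \<alpha> \<cdot> (E z \<cdot> (\<rho> a h, 0)) * \<beta> \<cdot> (E z \<cdot> (0, vf_rep K one (\<rho> b) z))
        - \<beta> \<cdot> (E z \<cdot> (\<rho> a h, 0)) * \<alpha> \<cdot> (E z \<cdot> (0, vf_rep K one (\<rho> b) z)))"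
    if "z \<in> Z" for z
    using that multiplicative_bivector_chart[of z h \<alpha> \<beta>]
    unfolding Z_def cmap_image_eq[OF K] m_def[symmetric] E_def y0_def by simp
  show ?thesis
    using fun_cong[OF has_derivative_unique[OF lhs'[OF eq] rhs], of v] by simp
qed

end

section \<open>The function \<sigma>(X^L, Y^L) on the group\<close>

lemma ext_deriv_swap: "ext_deriv M \<theta> x v w = - ext_deriv M \<theta> x w v"
  by (simp add: ext_deriv_def)

context
  fixes G :: "'g::real_vector quad_lie"
    and K :: "('k::{t2_space, second_countable_topology}, 'e::real_normed_vector) atlas"
    and mul :: "'k \<Rightarrow> 'k \<Rightarrow> 'k" and one :: 'k and iv :: "'k \<Rightarrow> 'k"
    and \<rho> :: "'g \<Rightarrow> 'k \<Rightarrow> 'e" and \<pi> :: "'k \<Rightarrow> 'e tensor2"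
  assumes G: "quadratic_lie_algebra G" and qplg: "quasi_poisson_lie_group G K mul one iv \<rho> \<pi>"
begin

private abbreviation (input) "LW \<equiv> left_inv_vf K mul one"
private abbreviation (input) "LG \<equiv> left_inv_form K mul iv"

text \<open>The Leibniz rule for the Lie derivative along a left-invariant field. On left-invariant
  forms it reduces to contraction with the exterior derivative, since their pairing with the field
  is constant. The skew terms in t coming from \<pi> and the symmetric ones from \<rho>(t)/2 combine
  so that only the term with the sharp of \<eta> survives.\<close>

lemma Dfun_sigma_left_inv:
  fixes \<xi> \<eta> :: "'e dual"
  assumes D: "\<And>a. lie_bracket K (\<rho> a) (LW v) = LW (D a)"
  shows "Dfun K (\<lambda>k. sigma G \<rho> \<pi> k \<cdot> LG \<xi> k \<cdot> LG \<eta> k) h \<cdot>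
      LW v h = ext_deriv K (LG \<xi>) h (LW v h) (cosigma G \<rho> \<pi> h (LG \<eta> h))
    + ext_deriv K (LG \<eta>) h (LW v h) (contract (sigma G \<rho> \<pi> h) (LG \<xi> h))
    + lie_deriv2 K (LW v) \<pi> one \<cdot> \<xi> \<cdot> \<eta> - \<xi> \<cdot> D (tsharp G (\<lambda>u. LG \<eta> h \<cdot> \<rho> u h))"
proof -
  note lg = qplg_lie_group[OF G qplg]
  note qpm = qplg_qpm[OF G qplg]
  note K = lg_manifold[OF lg]
  define X where "X = LG \<xi>"
  define Y where "Y = LG \<eta>"
  define L where "L = LW v"
  define DL where "DL = Dvf K L h"
  define \<tau> where "\<tau> \<omega> = tsharp G (\<lambda>u. \<omega> \<cdot> \<rho> u h)" for \<omega> :: "'e dual"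
  define d where "d a = Dvf K (\<rho> a) one \<cdot> v" for a
  have sX: "smooth_form K X" and sY: "smooth_form K Y"
    unfolding X_def Y_def by (rule smooth_left_inv_form[OF lg])+
  have sig: "smooth_t2 K (sigma G \<rho> \<pi>)" by (rule qpm_smooth_sigma[OF G qpm])
  have XL: "X h \<cdot> LW w h = \<xi> \<cdot> w"
    and YL: "Y h \<cdot> LW w h = \<eta> \<cdot> w" for w
    unfolding X_def Y_def by (rule left_inv_form_vf[OF lg])+
  \<comment> \<open>The bracket is evaluated at the unit, where \<rho> vanishes and only the
    derivative of \<rho>(a) contributes.\<close>
  have Dd: "D a = - d a" for a
  proof -
    have "D a = lie_bracket K (\<rho> a) L one" unfolding L_def D by (simp add: left_inv_vf_one[OF lg])
    then show ?thesis
      unfolding lie_bracket_eq L_def left_inv_vf_one[OF lg] action_one[OF G qplg] d_def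
      by (simp add: blinfun.zero_right)
  qed
  have br: "Dvf K (\<rho> a) h \<cdot> L h = DL \<cdot> \<rho> a h + LW (d a) h" for a
  proof -
    have "lie_bracket K (\<rho> a) L h = - LW (d a) h"
      unfolding L_def D Dd by (simp add: left_inv_vf_def blinfun.minus_right)
    then show ?thesis unfolding lie_bracket_eq DL_def by (simp add: algebra_simps)
  qed
  have co: "\<omega> \<cdot> cosigma G \<rho> \<pi> h \<zeta> = sigma G \<rho> \<pi> h \<cdot> \<omega> \<cdot> \<zeta>" for \<omega> \<zeta>
    by (rule apply_cosigma[OF G qpm])
  have ct: "\<omega> \<cdot> contract (sigma G \<rho> \<pi> h) \<zeta> = sigma G \<rho> \<pi> h \<cdot> \<zeta> \<cdot> \<omega>" for \<omega> \<zeta>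
    by (rule apply_contract[OF fin_dim_model[OF K]])
  have fX: "Dform K X h \<cdot> L h \<cdot> w = ext_deriv K X h (L h) w - (X h o\<^sub>L DL) \<cdot> w"
    and fY: "Dform K Y h \<cdot> L h \<cdot> w = ext_deriv K Y h (L h) w - (Y h o\<^sub>L DL) \<cdot> w" for w
    unfolding ext_deriv_def X_def Y_def L_def DL_def by (simp_all add: Dform_left_inv[OF lg])
  have lin: "linear (\<lambda>u. \<omega> \<cdot> \<rho> u h)" "linear (\<lambda>u. \<omega> \<cdot> (DL \<cdot> \<rho> u h))"
      "linear (\<lambda>u. \<omega> \<cdot> d u)" for \<omega> :: "'e dual"
    unfolding d_def
    using linear_compose[OF qpm_linear_action[OF G qpm, of h] bounded_linear.linear[OF blinfun.bounded_linear_right[of \<omega>]]]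
      linear_compose[OF qpm_linear_action[OF G qpm, of h] bounded_linear.linear[OF
            blinfun.bounded_linear_right[of "\<omega> o\<^sub>L DL"]]]
      linear_compose[OF linear_vf_Dvf[OF K qpm_smooth_action[OF G qpm] qpm_linear_action[OF G qpm], of one v]
        bounded_linear.linear[OF blinfun.bounded_linear_right[of \<omega>]]]
    by (simp_all add: o_def)
  have tr: "tsum G (\<lambda>a b. F a * \<omega> \<cdot> \<rho> b h) = F (\<tau> \<omega>)"
    and tl: "tsum G (\<lambda>a b. \<omega> \<cdot> \<rho> a h * F b) = F (\<tau> \<omega>)"
    if "linear F" for F :: "'g \<Rightarrow> real" and \<omega> :: "'e dual"
    unfolding \<tau>_def using tsum_tsharp_right[OF G that] tsum_tsharp_left[OF that] by simp_all
  have "lie_deriv2 K L \<pi> one \<cdot> \<xi> \<cdot> \<eta> = Dt2 K \<pi> one \<cdot> v \<cdot> \<xi> \<cdot> \<eta>"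
    unfolding lie_deriv2_apply bivector_one[OF G qplg] L_def left_inv_vf_one[OF lg] by simp
  moreover have "X h o\<^sub>L tangent_map K K (mul h) one = \<xi>" "Y h o\<^sub>L tangent_map K K (mul h) one = \<eta>"
    using XL YL unfolding left_inv_vf_def by (auto intro!: blinfun_eqI)
  ultimately have Dpi: "Dt2 K \<pi> h \<cdot> L h \<cdot> X h \<cdot> Y h = \<pi> h \<cdot> (X h o\<^sub>L DL) \<cdot> Y h
    + \<pi> h \<cdot> X h \<cdot> (Y h o\<^sub>L DL) + lie_deriv2 K L \<pi> one \<cdot> \<xi> \<cdot> \<eta>
    - (1/2) * (\<eta> \<cdot> d (\<tau> (X h)) - \<xi> \<cdot> d (\<tau> (Y h)))"
    using Dt2_left_invariant[OF G qplg, of h v "X h" "Y h"]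
    unfolding L_def[symmetric] DL_def[symmetric] d_def[symmetric] XL YL
    by (simp only: tsum_diff tl[OF lin(3)])
  have s1: "sigma G \<rho> \<pi> h \<cdot> (X h o\<^sub>L DL) \<cdot> Y h
      = \<pi> h \<cdot> (X h o\<^sub>L DL) \<cdot> Y h + (1/2) * X h \<cdot> (DL \<cdot> \<rho> (\<tau> (Y h)) h)"
    unfolding sigma_apply blinfun_apply_blinfun_compose tr[OF lin(2)] ..
  have s2: "sigma G \<rho> \<pi> h \<cdot> X h \<cdot> (Y h o\<^sub>L DL)
      = \<pi> h \<cdot> X h \<cdot> (Y h o\<^sub>L DL) + (1/2) * Y h \<cdot> (DL \<cdot> \<rho> (\<tau> (X h)) h)"
    unfolding sigma_apply blinfun_apply_blinfun_compose tl[OF lin(2)] ..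
  have Dsig: "Dt2 K (sigma G \<rho> \<pi>) h \<cdot> L h \<cdot> X h \<cdot> Y h = Dt2 K \<pi> h \<cdot> L h \<cdot> X h \<cdot> Y h
      + (1/2) * (X h \<cdot> (DL \<cdot> \<rho> (\<tau> (Y h)) h) + \<xi> \<cdot> d (\<tau> (Y h))
         + (Y h \<cdot> (DL \<cdot> \<rho> (\<tau> (X h)) h) + \<eta> \<cdot> d (\<tau> (X h))))"
    unfolding Dt2_sigma[OF K qpm_smooth_action[OF G qpm] qpm_smooth_bivector[OF G qpm]] br blinfun.add_right XL YL
    by (simp only: tsum_add distrib_left distrib_right tl[OF lin(2)] tl[OF lin(3)] tr[OF lin(2)] tr[OF lin(3)])
  have "Dfun K (\<lambda>k. sigma G \<rho> \<pi> k \<cdot> X k \<cdot> Y k) h \<cdot> L h = sigma G \<rho> \<pi> h \<cdot> X h \<cdot> (Dform K Y h \<cdot> L h)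
     + sigma G \<rho> \<pi> h \<cdot> (Dform K X h \<cdot> L h) \<cdot> Y h + Dt2 K (sigma G \<rho> \<pi>) h \<cdot> L h \<cdot> X h \<cdot> Y h"
    by (rule Dfun_t2[OF K sig sX sY])
  then show ?thesis
    unfolding ct[symmetric, of "X h" "Dform K Y h \<cdot> L h"]
      co[symmetric, of "Dform K X h \<cdot> L h" "Y h"] fX fY
      ct[of "Y h o\<^sub>L DL" "X h"] co[of "X h o\<^sub>L DL" "Y h"] s1 s2 Dsig Dpi
    unfolding X_def[symmetric] Y_def[symmetric] L_def[symmetric] \<tau>_def[symmetric] Dd
    by (simp add: blinfun.minus_right field_simps)
qed

end

text \<open>All that is used of the common Manin quadruple. Both cobrackets are transposes of
  brackets in reversed order, because the correspondence pairs with [B, A]. The action on the dual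
  is contragredient, by invariance of the pairing and antisymmetry of the big bracket.\<close>

lemma dual_lie_quasi_bialgebra_pairings:
  fixes G :: "'g::real_vector quad_lie"
    and br :: "'h::real_normed_vector \<Rightarrow> 'h \<Rightarrow> 'h"
  assumes "dual_lie_quasi_bialgebra G br dr \<delta> brs drs \<delta>s"
  shows "\<delta> X \<cdot> A \<cdot> B = brs B A \<cdot> X"
    and "drs u A \<cdot> X = - A \<cdot> dr u X"
    and "\<delta>s A \<cdot> Blinfun (\<lambda>B. B \<cdot> X) \<cdot> Blinfun (\<lambda>B. B \<cdot> Y) = A \<cdot> br Y X"
proof -
  obtain brd and pr :: "'h \<times> 'g \<times> 'h dual \<Rightarrow> 'h \<times> 'g \<times> 'h dual \<Rightarrow> real"
    where pr: "\<And>A X. pr (0, 0, A) (X, 0, 0) = A \<cdot> X"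
      and m: "manin_corresponds G brd pr (\<lambda>X. (X, 0, 0)) (\<lambda>u. (0, u, 0)) (\<lambda>A. (0, 0, A)) br dr \<delta>"
      and ms: "manin_corresponds G brd pr (\<lambda>A. (0, 0, A)) (\<lambda>u. (0, u, 0)) (\<lambda>X. (X, 0, 0)) brs drs \<delta>s"
    using assms unfolding dual_lie_quasi_bialgebra_def by blast
  have mq: "manin_quadruple brd pr (range (\<lambda>X. (X, 0, 0))) (range (\<lambda>u. (0, u, 0))) (range (\<lambda>A. (0, 0, A)))"
    using m unfolding manin_corresponds_def by blast
  note mq' = mq[unfolded manin_quadruple_def]
  have la: "lie_algebra brd" by (rule conjunct1[OF mq'])
  have bp: "bilinear pr" by (rule conjunct1[OF conjunct2[OF mq']])
  have sym': "\<forall>x y. pr x y = pr y x" by (rule conjunct1[OF conjunct2[OF conjunct2[OF mq']]])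
  have inv': "\<forall>x y z. pr (brd x y) z = pr x (brd y z)"
    by (rule conjunct1[OF conjunct2[OF conjunct2[OF conjunct2[OF conjunct2[OF mq']]]]])
  have sym: "pr x y = pr y x" and inv: "pr (brd x y) z = pr x (brd y z)" for x y z
    using sym' inv' by blast+
  have bil: "bilinear pr" "bilinear brd" and alt: "brd x x = 0" for x
    using bp la unfolding lie_algebra_def by blast+
  have anti: "brd x y = - brd y x" for x y
  proof -
    have "brd (x + y) (x + y) = brd x x + brd x y + (brd y x + brd y y)"
      by (simp add: bilinear_ladd[OF bil(2)] bilinear_radd[OF bil(2)] add_ac)
    then show ?thesis by (simp add: alt eq_neg_iff_add_eq_0)
  qed
  have pr': "pr (X, 0, 0) (0, 0, A) = A \<cdot> X" for A X using sym pr by metis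
  have d: "\<delta> X \<cdot> Blinfun (\<lambda>Y. pr (0, 0, A) (Y, 0, 0)) \<cdot> Blinfun (\<lambda>Y. pr (0, 0, B) (Y, 0, 0))
      = pr (X, 0, 0) (brd (0, 0, B) (0, 0, A))"
    using m unfolding manin_corresponds_def by blast
  have brs: "(0, 0, brs B A) = brd (0, 0, B) (0, 0, A)" for A B
    using ms unfolding manin_corresponds_def by blast
  show "\<delta> X \<cdot> A \<cdot> B = brs B A \<cdot> X"
    using d unfolding pr blinfun_apply_inverse brs[symmetric] pr' .
  have drs: "(0, 0, drs u A) = brd (0, u, 0) (0, 0, A)" and dr: "(dr u X, 0, 0) = brd (0, u, 0) (X, 0, 0)"
    using m ms unfolding manin_corresponds_def by blast+
  have "pr (0, 0, drs u A) (X, 0, 0) = pr (- brd (0, 0, A) (0, u, 0)) (X, 0, 0)"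
    unfolding drs using anti by metis
  also have "\<dots> = - pr (0, 0, A) (dr u X, 0, 0)"
    unfolding bilinear_lneg[OF bil(1)] inv dr ..
  finally show "drs u A \<cdot> X = - A \<cdot> dr u X" unfolding pr .
  have ds: "\<delta>s A \<cdot> Blinfun (\<lambda>B. pr (X, 0, 0) (0, 0, B)) \<cdot> Blinfun (\<lambda>B. pr (Y, 0, 0) (0, 0, B))
      = pr (0, 0, A) (brd (Y, 0, 0) (X, 0, 0))"
    using ms unfolding manin_corresponds_def by blast
  have br: "(br Y X, 0, 0) = brd (Y, 0, 0) (X, 0, 0)"
    using m unfolding manin_corresponds_def by blast
  show "\<delta>s A \<cdot> Blinfun (\<lambda>B. B \<cdot> X) \<cdot> Blinfun (\<lambda>B. B \<cdot> Y) = A \<cdot> br Y X"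
    using ds unfolding pr' br[symmetric] pr .
qed

section \<open>The action induced by a moment map\<close>

definition moment_form :: "('m, 'f::real_normed_vector) atlas \<Rightarrow> ('k, 'e::real_normed_vector) atlas \<Rightarrow>
    ('k \<Rightarrow> 'k \<Rightarrow> 'k) \<Rightarrow> ('k \<Rightarrow> 'k) \<Rightarrow> ('h::real_normed_vector dual \<Rightarrow>\<^sub>L 'e) \<Rightarrow> ('m \<Rightarrow> 'k) \<Rightarrow>
    'h \<Rightarrow> 'm \<Rightarrow> 'f dual" where
  "moment_form M K mul iv J \<mu> X = pullback_form M K \<mu> (left_inv_form K mul iv (cotangent_of J X))"

text \<open>The pullback by \<open>\<mu>\<close> of the Maurer-Cartan form.\<close>

definition moment_vec :: "('m, 'f::real_normed_vector) atlas \<Rightarrow> ('k, 'e::real_normed_vector) atlas \<Rightarrow>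
    ('k \<Rightarrow> 'k \<Rightarrow> 'k) \<Rightarrow> ('k \<Rightarrow> 'k) \<Rightarrow> ('h::real_normed_vector dual \<Rightarrow>\<^sub>L 'e) \<Rightarrow> ('m \<Rightarrow> 'k) \<Rightarrow>
    'm \<Rightarrow> 'f \<Rightarrow> ('h dual)" where
  "moment_vec M K mul iv J \<mu> x w = inv (blinfun_apply J)
     (tangent_map K K (mul (iv (\<mu> x))) (\<mu> x) \<cdot> (tangent_map M K \<mu> x \<cdot> w))"

lemma linear_inv_blinfun:
  fixes J :: "'a::real_normed_vector \<Rightarrow>\<^sub>L 'b::real_normed_vector"
  assumes "bij (blinfun_apply J)"
  shows "linear (inv (blinfun_apply J))"
proof (rule linearI)
  have r: "J \<cdot> inv (blinfun_apply J) v = v" for v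
    using assms by (simp add: bij_is_surj surj_f_inv_f)
  have i: "u = v" if "J \<cdot> u = J \<cdot> v" for u v
    using assms that by (meson bij_is_inj injD)
  show "inv (blinfun_apply J) (u + v) = inv (blinfun_apply J) u + inv (blinfun_apply J) v" for u v
    by (rule i) (simp add: r blinfun.add_right)
  show "inv (blinfun_apply J) (c *\<^sub>R v) = c *\<^sub>R inv (blinfun_apply J) v" for c v
    by (rule i) (simp add: r blinfun.scaleR_right)
qed

context
  fixes G :: "'g::real_vector quad_lie"
    and br :: "'h::real_normed_vector \<Rightarrow> 'h \<Rightarrow> 'h"
    and dr :: "'g \<Rightarrow> 'h \<Rightarrow> 'h"
    and \<delta> :: "'h \<Rightarrow> 'h tensor2"
    and brs :: "'h dual \<Rightarrow> 'h dual \<Rightarrow> ('h dual)"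
    and drs :: "'g \<Rightarrow> 'h dual \<Rightarrow> ('h dual)"
    and \<delta>s :: "'h dual \<Rightarrow> ('h dual) tensor2"
    and K :: "('k::{t2_space, second_countable_topology}, 'e::real_normed_vector) atlas"
    and mul :: "'k \<Rightarrow> 'k \<Rightarrow> 'k" and one :: 'k and iv :: "'k \<Rightarrow> 'k"
    and \<rho>K :: "'g \<Rightarrow> 'k \<Rightarrow> 'e" and \<pi>K :: "'k \<Rightarrow> 'e tensor2"
    and J :: "'h dual \<Rightarrow>\<^sub>L 'e"
    and M :: "('m::{t2_space, second_countable_topology}, 'f::real_normed_vector) atlas"
    and \<rho> :: "'g \<Rightarrow> 'm \<Rightarrow> 'f" and \<pi> :: "'m \<Rightarrow> 'f tensor2"
    and \<mu> :: "'m \<Rightarrow> 'k"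
  assumes G: "quadratic_lie_algebra G"
    and lqb: "lie_quasi_bialgebra G br dr \<delta>"
    and dual: "dual_lie_quasi_bialgebra G br dr \<delta> brs drs \<delta>s"
    and qplg: "quasi_poisson_lie_group G K mul one iv \<rho>K \<pi>K"
    and integ: "integrates K mul one \<rho>K \<pi>K J brs drs \<delta>s"
    and qpm: "quasi_poisson_manifold G M \<rho> \<pi>"
    and qpmap: "quasi_poisson_map M \<rho> \<pi> K \<rho>K \<pi>K \<mu>"
begin

private lemmas lg = qplg_lie_group[OF G qplg]
  and qpK = qplg_qpm[OF G qplg]
  and manM = qpm_manifold[OF G qpm]
  and pairings = dual_lie_quasi_bialgebra_pairings[OF dual]

private lemmas manK = lg_manifold[OF lg]

private abbreviation (input) "LL \<equiv> left_inv_vf K mul one"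
private abbreviation (input) "FF X \<equiv> left_inv_form K mul iv (cotangent_of J X)"
private abbreviation (input) "\<alpha> \<equiv> moment_form M K mul iv J \<mu>"
private abbreviation (input) "A \<equiv> moment_vec M K mul iv J \<mu>"
private abbreviation (input) "T \<equiv> tangent_map M K \<mu>"
private abbreviation (input) "\<sigma> \<equiv> sigma G \<rho> \<pi>"
private abbreviation (input) "\<sigma>K \<equiv> sigma G \<rho>K \<pi>K"
private abbreviation (input) "co \<equiv> cosigma G \<rho> \<pi>"
private abbreviation (input) "an X \<equiv> (\<lambda>x. contract (\<sigma> x) (\<alpha> X x))"

lemma smooth_mu: "smooth_map M K \<mu>"
  and mu_action: "T x \<cdot> \<rho> u x = \<rho>K u (\<mu> x)"
  and mu_bivector: "tmap2 (T x) (T x) (\<pi> x) = \<pi>K (\<mu> x)"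
  using qpmap unfolding quasi_poisson_map_def by blast+

lemma bij_J: "bij (blinfun_apply J)"
  and integ_bracket: "LL (J \<cdot> brs a b) = lie_bracket K (LL (J \<cdot> a)) (LL (J \<cdot> b))"
  and integ_action: "LL (J \<cdot> drs u a) = lie_bracket K (\<rho>K u) (LL (J \<cdot> a))"
  and integ_cobracket: "tmap2 J J (\<delta>s a) = lie_deriv2 K (LL (J \<cdot> a)) \<pi>K one"
  using integ unfolding integrates_def Let_def by blast+

lemma inv_J: "inv (blinfun_apply J) (J \<cdot> a) = a" "J \<cdot> inv (blinfun_apply J) v = v"
  using bij_J by (simp_all add: bij_is_inj bij_is_surj inv_f_f surj_f_inv_f)

lemma cotangent_apply: "cotangent_of J X \<cdot> v = inv (blinfun_apply J) v \<cdot> X"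
proof -
  have "linear (\<lambda>v. inv (blinfun_apply J) v \<cdot> X)"
    using linear_compose[OF linear_inv_blinfun[OF bij_J] bounded_linear.linear[OF blinfun.bounded_linear_left]]
    by (simp add: o_def)
  then show ?thesis unfolding cotangent_of_def by (simp add: Blinfun_apply_linear[OF fin_dim_model[OF manK]])
qed

lemma moment_form_apply: "\<alpha> X x \<cdot> w = A x w \<cdot> X"
  by (simp add: moment_form_def pullback_form_def left_inv_form_def cotangent_apply moment_vec_def)

text \<open>Lets any tangent vector of M be continued, after applying the differential of \<mu>, to
  a left-invariant field on the group, for which all brackets are prescribed by
  \<open>integrates\<close>.\<close>

lemma T_moment_vec: "T x \<cdot> w = LL (J \<cdot> A x w) (\<mu> x)"
  by (simp add: moment_vec_def inv_J tangent_mul_left_inverse[OF lg])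

lemma FF_LL: "FF X k \<cdot> LL (J \<cdot> a) k = a \<cdot> X"
  by (simp add: left_inv_form_vf[OF lg] cotangent_apply inv_J)

lemma alpha_eq: "\<alpha> X x = FF X (\<mu> x) o\<^sub>L T x"
  by (simp add: moment_form_def pullback_form_def)

lemma smooth_alpha: "smooth_form M (\<alpha> X)"
  unfolding moment_form_def
  by (rule smooth_form_pullback[OF manM manK smooth_mu smooth_left_inv_form[OF lg]])

lemma ext_deriv_alpha_FF: "ext_deriv M (\<alpha> X) x v w = ext_deriv K (FF X) (\<mu> x) (T x \<cdot> v) (T x \<cdot> w)"
  unfolding moment_form_def
  by (rule ext_deriv_pullback[OF manM manK smooth_mu smooth_left_inv_form[OF lg]])

text \<open>The Maurer-Cartan equation, with the bracket of left-invariant fields expressed by the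
  bracket of the dual Lie algebra.\<close>

lemma ext_deriv_alpha: "ext_deriv M (\<alpha> X) x v w = - brs (A x v) (A x w) \<cdot> X"
  unfolding ext_deriv_alpha_FF T_moment_vec[of x]
  by (simp add: maurer_cartan[OF lg] FF_LL flip: integ_bracket)

lemma alpha_linear: "\<alpha> (X + Y) x = \<alpha> X x + \<alpha> Y x" "\<alpha> (c *\<^sub>R X) x = c *\<^sub>R \<alpha> X x"
  by (auto intro!: blinfun_eqI simp: moment_form_apply blinfun.bilinear_simps)

lemma contract_linear:
  "contract (\<sigma> x) (\<beta> + \<gamma>) = contract (\<sigma> x) \<beta> + contract (\<sigma> x) \<gamma>"
  "contract (\<sigma> x) (c *\<^sub>R \<beta>) = c *\<^sub>R contract (\<sigma> x) \<beta>"
  by (rule fin_dim_functionals_separate[OF fin_dim_model[OF manM]],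
      simp add: apply_contract[OF fin_dim_model[OF manM]] blinfun.bilinear_simps)+

text \<open>Transposition of \<sigma> replaces the test functional by the tangent vector
  \<open>co x \<gamma>\<close>; comparing anchors becomes comparing elements of the Lie algebra
  paired with one element of its dual.\<close>

lemma apply_an: "\<gamma> \<cdot> an X x = A x (co x \<gamma>) \<cdot> X"
  by (simp add: apply_contract[OF fin_dim_model[OF manM]] moment_form_apply flip: apply_cosigma[OF G qpm])

lemma bracket_action_an: "lie_bracket M (\<rho> u) (an X) x = an (dr u X) x"
proof (rule fin_dim_functionals_separate[OF fin_dim_model[OF manM]])
  fix \<gamma> :: "'f dual"
  define w where "w = co x \<gamma>"
  define k where "k = \<mu> x"
  define L where "L = LL (J \<cdot> A x w)"
  have Tw: "T x \<cdot> w = L k" unfolding L_def k_def by (rule T_moment_vec)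
  have sF: "smooth_form K (FF X)" by (rule smooth_left_inv_form[OF lg])
  have s\<rho>: "smooth_vf_on K UNIV (\<rho>K u)" by (rule qpm_smooth_action[OF G qpK])
  have f: "(\<lambda>p. \<alpha> X p \<cdot> \<rho> u p) = (\<lambda>k. FF X k \<cdot> \<rho>K u k) \<circ> \<mu>"
    by (auto simp: alpha_eq mu_action)
  have "((\<lambda>k. FF X k \<cdot> \<rho>K u k) \<circ> cinv K k) differentiable at (cmap K k k)"
    using Dfun_pairing_has_derivative[OF manK sF s\<rho>] unfolding differentiable_def by blast
  then have D: "Dfun M (\<lambda>p. \<alpha> X p \<cdot> \<rho> u p) x \<cdot> w = Dfun K (\<lambda>k. FF X k \<cdot> \<rho>K u k) k \<cdot> L k"
    unfolding f k_def Tw[unfolded k_def, symmetric] by (rule Dfun_compose[OF manM manK smooth_mu])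
  have "\<gamma> \<cdot> lie_bracket M (\<rho> u) (an X) x
      = ext_deriv K (FF X) k (\<rho>K u k) (L k) + Dfun K (\<lambda>k. FF X k \<cdot> \<rho>K u k) k \<cdot> L k"
    unfolding apply_bracket_action_anchor[OF G qpm smooth_alpha] w_def[symmetric] D ext_deriv_alpha_FF Tw mu_action
    by (simp add: k_def)
  \<comment> \<open>By Cartan's formula the sum is the Lie derivative of the left-invariant form
    along the action, evaluated on \<open>L\<close>. The form is constant on \<open>L\<close>, so
    only the bracket remains.\<close>
  also have "\<dots> = - FF X k \<cdot> lie_bracket K (\<rho>K u) L k"
    unfolding Dfun_pairing[OF manK sF s\<rho>] ext_deriv_def lie_bracket_eq L_def Dform_left_inv[OF lg]
    by (simp add: blinfun.diff_right)
  also have "\<dots> = A x w \<cdot> dr u X"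
    unfolding L_def integ_action[symmetric] FF_LL pairings(2) by simp
  finally show "\<gamma> \<cdot> lie_bracket M (\<rho> u) (an X) x = \<gamma> \<cdot> an (dr u X) x"
    unfolding apply_an w_def .
qed

text \<open>Equivariance matches the symmetric parts of the two tensors, and the push-forward of
  \<pi> matches the skew parts.\<close>

lemma sigma_mu: "\<sigma> x \<cdot> (\<omega> o\<^sub>L T x) \<cdot> (\<eta> o\<^sub>L T x) = \<sigma>K (\<mu> x) \<cdot> \<omega> \<cdot> \<eta>"
  unfolding sigma_apply mu_bivector[symmetric] tmap2_apply by (simp add: mu_action)

lemma T_cosigma: "T x \<cdot> co x (\<omega> o\<^sub>L T x) = cosigma G \<rho>K \<pi>K (\<mu> x) \<omega>"
proof (rule fin_dim_functionals_separate[OF fin_dim_model[OF manK]])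
  show "\<eta> \<cdot> (T x \<cdot> co x (\<omega> o\<^sub>L T x)) = \<eta> \<cdot> cosigma G \<rho>K \<pi>K (\<mu> x) \<omega>"
    for \<eta> :: "'e dual"
    using apply_cosigma[OF G qpm, of "\<eta> o\<^sub>L T x" x "\<omega> o\<^sub>L T x"] apply_cosigma[OF G qpK, of \<eta> "\<mu> x" \<omega>]
    by (simp add: sigma_mu)
qed

lemma T_contract: "T x \<cdot> contract (\<sigma> x) (\<omega> o\<^sub>L T x) = contract (\<sigma>K (\<mu> x)) \<omega>"
proof (rule fin_dim_functionals_separate[OF fin_dim_model[OF manK]])
  show "\<eta> \<cdot> (T x \<cdot> contract (\<sigma> x) (\<omega> o\<^sub>L T x)) = \<eta> \<cdot> contract (\<sigma>K (\<mu> x)) \<omega>"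
    for \<eta> :: "'e dual"
    using apply_contract[OF fin_dim_model[OF manM], of "\<eta> o\<^sub>L T x" "\<sigma> x" "\<omega> o\<^sub>L T x"]
    by (simp add: sigma_mu apply_contract[OF fin_dim_model[OF manK]])
qed

text \<open>The order of X and Y is reversed because the transpose of the dual cobracket is, see
  \<open>pairings\<close>. So \<open>an\<close> is an anti-homomorphism.\<close>

lemma bracket_an_an: "lie_bracket M (an X) (an Y) x = an (br Y X) x"
proof (rule fin_dim_functionals_separate[OF fin_dim_model[OF manM]])
  fix \<gamma> :: "'f dual"
  define w where "w = co x \<gamma>"
  define k where "k = \<mu> x"
  define a where "a = A x w"
  define \<tau> where "\<tau> = tsharp G (\<lambda>u. \<alpha> Y x \<cdot> \<rho> u x)"
  have Tw: "T x \<cdot> w = LL (J \<cdot> a) k" unfolding a_def k_def by (rule T_moment_vec)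
  let ?s = "\<lambda>k. \<sigma>K k \<cdot> FF X k \<cdot> FF Y k"
  have sF: "smooth_form K (FF X)" for X by (rule smooth_left_inv_form[OF lg])
  have sig: "smooth_t2 K \<sigma>K" by (rule qpm_smooth_sigma[OF G qpK])
  have f: "(\<lambda>p. \<sigma> p \<cdot> \<alpha> X p \<cdot> \<alpha> Y p) = ?s \<circ> \<mu>"
    by (auto simp: alpha_eq sigma_mu)
  have "(?s \<circ> cinv K k) differentiable at (cmap K k k)"
    using Dfun_t2_has_derivative[OF manK sig sF sF] unfolding differentiable_def by blast
  then have D: "Dfun M (\<lambda>p. \<sigma> p \<cdot> \<alpha> X p \<cdot> \<alpha> Y p) x \<cdot> w = Dfun K ?s k \<cdot> LL (J \<cdot> a) k"
    unfolding f k_def Tw[unfolded k_def, symmetric] by (rule Dfun_compose[OF manM manK smooth_mu])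
  have cj: "cotangent_of J X o\<^sub>L J = Blinfun (\<lambda>B. B \<cdot> X)" for X
    by (intro blinfun_eqI) (simp add: cotangent_apply inv_J bounded_linear_Blinfun_apply blinfun.bounded_linear_left)
  have ld: "lie_deriv2 K (LL (J \<cdot> a)) \<pi>K one \<cdot> cotangent_of J X \<cdot> cotangent_of J Y = a \<cdot> br Y X"
    unfolding integ_cobracket[symmetric] tmap2_apply cj by (rule pairings(3))
  have \<tau>: "\<tau> = tsharp G (\<lambda>u. FF Y k \<cdot> \<rho>K u k)"
    by (simp add: \<tau>_def alpha_eq mu_action k_def)
  have "cotangent_of J X \<cdot> (J \<cdot> drs \<tau> a) = - a \<cdot> dr \<tau> X"
    by (simp add: cotangent_apply inv_J pairings(2))
  \<comment> \<open>The derivative is computed on the group, but its exterior derivative terms are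
    written again as terms on M, where they can be matched with those of the bracket
    formula.\<close>
  then have D': "Dfun M (\<lambda>p. \<sigma> p \<cdot> \<alpha> X p \<cdot> \<alpha> Y p) x \<cdot> w
      = ext_deriv M (\<alpha> X) x w (co x (\<alpha> Y x)) + ext_deriv M (\<alpha> Y) x w (an X x)
      + a \<cdot> br Y X + a \<cdot> dr \<tau> X"
    unfolding D Dfun_sigma_left_inv[OF G qplg integ_action[symmetric]] ld \<tau>[symmetric]
    unfolding ext_deriv_alpha_FF Tw alpha_eq T_cosigma T_contract k_def by simp
  have "\<gamma> \<cdot> lie_bracket M (an X) (an Y) x
      = ext_deriv M (\<alpha> Y) x (an X x) w + (ext_deriv M (\<alpha> X) x w (co x (\<alpha> Y x)) + ext_deriv M (\<alpha> Y) x w (an X x)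
      + a \<cdot> br Y X + a \<cdot> dr \<tau> X) + ext_deriv M (\<alpha> X) x (co x (\<alpha> Y x)) w - \<gamma> \<cdot> an (dr \<tau> X) x"
    unfolding apply_bracket_anchor_anchor[OF G qpm smooth_alpha smooth_alpha] w_def[symmetric] D' bracket_action_an \<tau>_def ..
  \<comment> \<open>The four exterior derivatives cancel in pairs by skewness, and the two terms
    with \<open>dr \<tau> X\<close> cancel by \<open>apply_an\<close>.\<close>
  also have "\<dots> = a \<cdot> br Y X"
    unfolding apply_an w_def[symmetric] a_def
      ext_deriv_swap[of M "\<alpha> Y" x "an X x" w] ext_deriv_swap[of M "\<alpha> X" x "co x (\<alpha> Y x)" w] by simp
  finally show "\<gamma> \<cdot> lie_bracket M (an X) (an Y) x = \<gamma> \<cdot> an (br Y X) x"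
    unfolding apply_an a_def w_def .
qed

text \<open>The exterior derivative of the moment form, taken on two coanchors, is minus the dual
  bracket paired with X. By skewness this is \<delta>(X) in the same arguments, so it equals the
  image of \<delta>(X) under the anchor.\<close>

lemma lie_deriv2_an:
  "lie_deriv2 M (an X) \<pi> x = (1/2) *\<^sub>R tsum G (\<lambda>a b. wedge (an (dr a X) x) (\<rho> b x))
    + tmap2 (Blinfun (\<lambda>Y. an Y x)) (Blinfun (\<lambda>Y. an Y x)) (\<delta> X)"
proof (rule tensor2_eqI)
  fix \<beta> \<gamma> :: "'f dual"
  have fh: "fin_dim (UNIV :: 'h set)" using lqb unfolding lie_quasi_bialgebra_def lie_algebra_def by blast
  have "linear (\<lambda>Y. an Y x)" by (intro linearI) (simp_all add: alpha_linear contract_linear)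
  then have ev: "\<omega> o\<^sub>L Blinfun (\<lambda>Y. an Y x) = A x (co x \<omega>)" for \<omega> :: "'f dual"
    by (intro blinfun_eqI) (simp add: Blinfun_apply_linear[OF fh] apply_an)
  have "skew (\<delta> X)" using lqb unfolding lie_quasi_bialgebra_def by blast
  then have sk: "\<delta> X \<cdot> B \<cdot> C = - brs B C \<cdot> X" for B C
    unfolding skew_def pairings(1)[of X C B, symmetric] by blast
  show "lie_deriv2 M (an X) \<pi> x \<cdot> \<beta> \<cdot> \<gamma> = ((1/2) *\<^sub>R tsum G (\<lambda>a b. wedge (an (dr a X) x) (\<rho> b x))
        + tmap2 (Blinfun (\<lambda>Y. an Y x)) (Blinfun (\<lambda>Y. an Y x)) (\<delta> X)) \<cdot> \<beta> \<cdot> \<gamma>"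
    unfolding lie_deriv2_anchor[OF G qpm smooth_alpha] bracket_action_an ext_deriv_alpha
    by (simp add: blinfun.bilinear_simps tmap2_apply ev sk)
qed

text \<open>Writing the negative of \<open>an X\<close> as \<open>an (- X)\<close> makes every
  clause an instance of an identity for \<open>an\<close>. The sign turns the anti-homomorphism into
  a homomorphism. In the cobracket term the two signs of the tensor square cancel, while linearity
  of \<delta> leaves the minus required in the definition.\<close>

lemma quasi_poisson_action_moment: "quasi_poisson_action G br dr \<delta> M \<rho> \<pi> (\<lambda>X x. - an X x)"
proof -
  have an_minus: "- an X x = an (- X) x" for X x
    using alpha_linear(2)[of "-1" X x] contract_linear(2)[of x "-1" "\<alpha> X x"] by simp
  have lin: "linear (\<lambda>X. an X x)" for x by (intro linearI) (simp_all add: alpha_linear contract_linear)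
  have fh: "fin_dim (UNIV :: 'h set)" and bil: "bilinear br" "bilinear dr" and alt: "br X X = 0" for X
    using lqb unfolding lie_quasi_bialgebra_def lie_algebra_def by blast+
  have anti: "br X Y = - br Y X" for X Y
  proof -
    have "br (X + Y) (X + Y) = br X X + br X Y + (br Y X + br Y Y)"
      by (simp add: bilinear_ladd[OF bil(1)] bilinear_radd[OF bil(1)] add_ac)
    then show ?thesis by (simp add: alt eq_neg_iff_add_eq_0)
  qed
  have br: "br (- Y) (- X) = - br X Y" for X Y
    using anti[of X Y] by (simp add: bilinear_lneg[OF bil(1)] bilinear_rneg[OF bil(1)])
  have dr: "dr u (- X) = - dr u X" for u X by (rule bilinear_rneg[OF bil(2)])
  show ?thesis
    unfolding quasi_poisson_action_def lie_action_def
  proof (intro conjI allI)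
    show "smooth_vf_on M UNIV (\<lambda>x. - an X x)" for X
      unfolding an_minus by (rule smooth_vf_contract[OF manM qpm_smooth_sigma[OF G qpm] smooth_alpha])
    show "linear (\<lambda>X. - an X x)" for x by (rule linear_compose_neg[OF lin])
    show "- an (br X Y) x = lie_bracket M (\<lambda>x. - an X x) (\<lambda>x. - an Y x) x" for X Y x
      unfolding an_minus bracket_an_an br ..
    show "- an (dr u X) x = lie_bracket M (\<rho> u) (\<lambda>x. - an X x) x" for u X x
      unfolding an_minus bracket_action_an dr ..
    fix X x
    have "linear (\<lambda>Y. - an Y x)" by (rule linear_compose_neg[OF lin])
    then have neg: "\<beta> o\<^sub>L Blinfun (\<lambda>Y. - an Y x) = - (\<beta> o\<^sub>L Blinfun (\<lambda>Y. an Y x))" for \<beta> :: "'f dual"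
      by (intro blinfun_eqI) (simp add: Blinfun_apply_linear[OF fh] lin blinfun.bilinear_simps)
    have "linear \<delta>" using lqb unfolding lie_quasi_bialgebra_def by blast
    then have t: "tmap2 (Blinfun (\<lambda>Y. an Y x)) (Blinfun (\<lambda>Y. an Y x)) (\<delta> (- X))
        = - tmap2 (Blinfun (\<lambda>Y. - an Y x)) (Blinfun (\<lambda>Y. - an Y x)) (\<delta> X)"
      by (intro tensor2_eqI) (simp add: tmap2_apply neg linear_neg blinfun.bilinear_simps)
    show "lie_deriv2 M (\<lambda>x. - an X x) \<pi> x = - tmap2 (Blinfun (\<lambda>Y. - an Y x)) (Blinfun (\<lambda>Y. - an Y x)) (\<delta> X)
        + (1/2) *\<^sub>R tsum G (\<lambda>a b. wedge (- an (dr a X) x) (\<rho> b x))"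
      unfolding an_minus[of _ X] lie_deriv2_an t dr unfolding an_minus[symmetric] by simp
  qed
qed

end

theorem theorem6p1:
  fixes G :: "'g::real_vector quad_lie"
    and br :: "'h::real_normed_vector \<Rightarrow> 'h \<Rightarrow> 'h"
    and dr :: "'g \<Rightarrow> 'h \<Rightarrow> 'h"
    and \<delta> :: "'h \<Rightarrow> 'h tensor2"
    and brs :: "('h \<Rightarrow>\<^sub>L real) \<Rightarrow> ('h \<Rightarrow>\<^sub>L real) \<Rightarrow> ('h \<Rightarrow>\<^sub>L real)"
    and drs :: "'g \<Rightarrow> ('h \<Rightarrow>\<^sub>L real) \<Rightarrow> ('h \<Rightarrow>\<^sub>L real)"
    and \<delta>s :: "('h \<Rightarrow>\<^sub>L real) \<Rightarrow> ('h \<Rightarrow>\<^sub>L real) tensor2"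
    and K :: "('k::{t2_space, second_countable_topology}, 'e::real_normed_vector) atlas"
    and mul :: "'k \<Rightarrow> 'k \<Rightarrow> 'k" and one :: 'k and iv :: "'k \<Rightarrow> 'k"
    and \<rho>K :: "'g \<Rightarrow> 'k \<Rightarrow> 'e" and \<pi>K :: "'k \<Rightarrow> 'e tensor2"
    and J :: "('h \<Rightarrow>\<^sub>L real) \<Rightarrow>\<^sub>L 'e"
    and M :: "('m::{t2_space, second_countable_topology}, 'f::real_normed_vector) atlas"
    and \<rho> :: "'g \<Rightarrow> 'm \<Rightarrow> 'f" and \<pi> :: "'m \<Rightarrow> 'f tensor2"
    and \<mu> :: "'m \<Rightarrow> 'k"
  assumes "quadratic_lie_algebra G"
    and "lie_quasi_bialgebra G br dr \<delta>"
    and "dual_lie_quasi_bialgebra G br dr \<delta> brs drs \<delta>s"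
    and "quasi_poisson_lie_group G K mul one iv \<rho>K \<pi>K"
    and "connected (UNIV :: 'k set)" and "simply_connected (UNIV :: 'k set)"
    and "integrates K mul one \<rho>K \<pi>K J brs drs \<delta>s"
    and "quasi_poisson_manifold G M \<rho> \<pi>"
    and "quasi_poisson_map M \<rho> \<pi> K \<rho>K \<pi>K \<mu>"
  shows "quasi_poisson_action G br dr \<delta> M \<rho> \<pi>
    (\<lambda>X x. - contract (sigma G \<rho> \<pi> x)
       (pullback_form M K \<mu> (left_inv_form K mul iv (cotangent_of J X)) x))"
  using quasi_poisson_action_moment[OF assms(1-4) assms(7-9)] unfolding moment_form_def .

end
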